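(* Consider a finite two-player zero-sum stochastic game with state set $K=\{1,\dots,n\}$, finite state-dependent action sets, stage payoff function $g$ and transition function $q$. For $\lambda\in(0,1]$ let $v_\lambda=(v^1_\lambda,\dots,v^n_\lambda)$ be the vector of $\lambda$-discounted values, let $v^k_0:=\lim_{\lambda\to0}v^k_\lambda$ (which exists), and let $\dot\Delta^0$ be the reduced auxiliary matrix obtained from a Shapley-Snow kernel of each of the local games at $v_\lambda$, as constructed in the context. For any fixed $1\le k\le n$, with $E^k$ and $W^k$ as defined in the context, one has: (i) There exist $P^k\in E^k$ and $\lambda^k_0>0$ such that $P^k(\lambda,v^k_\lambda)=0$ for all $\lambda\in(0,\lambda^k_0)$. (ii) There exist $\lambda^k_0>0$ and a finite set $W^k$ of Puiseux series on $(0,\lambda^k_0)$ (the one defined in the context) such that the value function $\lambda\mapsto v^k_\lambda$, $\lambda\in(0,\lambda^k_0)$, belongs to $W^k$. (iii) As $\lambda$ vanishes one has $|v^k_\lambda-v^k_0|=O(\lambda^{1/a})$, where $a=\mathrm{rank}(\dot\Delta^0)$.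
   Context: **Matrix games.** A real matrix $A$ is identified with the zero-sum game in which Player 1 (maximizer) chooses rows and Player 2 (minimizer) chooses columns; mixed strategies $x,y$ are column probability vectors, the expected payoff is ${}^{t}xAy$ and $\mathrm{val}(A)=\max_x\min_y{}^{t}xAy=\min_y\max_x{}^{t}xAy$. **Cofactors.** For a square matrix $M$, $\mathrm{co}(M)$ is its cofactor matrix, with $(i,j)$ entry $(-1)^{i+j}$ times the determinant of $M$ with row $i$ and column $j$ deleted ($\mathrm{co}(M)=1$ for $1\times1$ matrices); $S(M)$ is the sum of the entries of $M$; $\mathbf 1$ is a column vector of ones and $U$ a matrix of ones, of the appropriate dimensions. **Shapley-Snow kernel.** Let $G$ be a matrix game. A basic solution is an extreme point $(x,y)$ of the set of pairs of optimal strategies. A Shapley-Snow kernel of $G$ is a square sub-matrix $\dot G$ of $G$ such that, for some basic solution $(x,y)$, with $\dot x,\dot y$ the restrictions of $x,y$ to the row and column indices of $\dot G$: (1) $S(\mathrm{co}(\dot G))\ne0$; (2) $\dot x=\frac{\mathrm{co}(\dot G)}{S(\mathrm{co}(\dot G))}\mathbf 1$ and $\dot y=\frac{{}^{t}\mathrm{co}(\dot G)}{S(\mathrm{co}(\dot G))}\mathbf 1$; (3) $\mathrm{val}(G)=\mathrm{val}(\dot G)=\frac{\det\dot G}{S(\mathrm{co}(\dot G))}$; (4) ${}^{t}\dot x\dot G=\mathrm{val}(G)\,{}^{t}\mathbf 1$ and $\dot G\dot y=\mathrm{val}(G)\mathbf 1$. (By Shapley and Snow (1950), every matrix game has one, and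 (1)-(2) imply (3)-(4).) **Stochastic game.** $I^k$ and $J^k$ are the finite nonempty action sets of Players 1 and 2 in state $k$; for $(i,j)\in I^k\times J^k$, $g(k,i,j)\in\mathbb R$ is the stage payoff and $q(\cdot|k,i,j)$ is a probability on $K$. At each stage $m\ge1$ the players, knowing the current state $k_m$, simultaneously choose $i_m\in I^{k_m}$, $j_m\in J^{k_m}$; the next state is drawn from $q(\cdot|k_m,i_m,j_m)$. From initial state $k$, Player 1 maximizes and Player 2 minimizes the expectation of $\sum_{m\ge1}\lambda(1-\lambda)^{m-1}g(k_m,i_m,j_m)$. This game has a value $v^k_\lambda$. For $z\in\mathbb R^n$, the local game $\mathcal G^k(\lambda,z)$ is the $I^k\times J^k$ matrix with entries $\lambda g(k,i,j)+(1-\lambda)\sum_{\ell=1}^n q(\ell|k,i,j)z^\ell$. By Shapley (1953), $v_\lambda$ is the unique $z\in\mathbb R^n$ with $z^k=\mathrm{val}(\mathcal G^k(\lambda,z))$ for all $k$. **Data array.** For $1\le k\le n$, $0\le\ell\le n$ define $I^k\times J^k$ matrices $M^k_\ell$ by $M^k_0=\lambda(g(k,i,j))_{i,j}$, $M^k_k=(1-\lambda)(q(k|k,i,j))_{i,j}-U$, and $M^k_\ell=(1-\lambda)(q(\ell|k,i,j))_{i,j}$ for $\ell\ge1$, $\ell\neq k$. Then $D(\lambda)$ is the $n\times(n+1)$ array of matrices $(M^k_\ell)$, $1\le k\le n$, $0\le\ell\le n$. **Kronecker determinant and auxiliary matrices.** For an $n\times n$ array $(A^k_\ell)$ of matrices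 in which matrices on the same row $k$ have the same size, $\det_\otimes(A^k_\ell)=\sum_{\sigma}\epsilon(\sigma)A^1_{\sigma(1)}\otimes\cdots\otimes A^n_{\sigma(n)}$, the sum being over permutations $\sigma$ of $\{1,\dots,n\}$, with $\epsilon(\sigma)$ the signature and $\otimes$ the Kronecker product. The auxiliary matrices of an $n\times(n+1)$ array with columns indexed $0,\dots,n$ are $\Delta^\ell=(-1)^\ell\det_\otimes D^{(\ell)}$, $0\le\ell\le n$, where $D^{(\ell)}$ is the array with the column indexed $\ell$ removed. $\Delta^0,\dots,\Delta^n$ denote the auxiliary matrices of $D(\lambda)$; their entries are polynomials in $\lambda$. **Reduced array.** For each $1\le k\le n$, take a Shapley-Snow kernel of the local game $\mathcal G^k(\lambda,v_\lambda)$, with row and column sets $\dot I^k\subset I^k$, $\dot J^k\subset J^k$, $|\dot I^k|=|\dot J^k|$. The reduced array $\dot D(\lambda)=(\dot M^k_\ell)$ consists of the $\dot I^k\times\dot J^k$ sub-matrices of the $M^k_\ell$, and $\dot\Delta^0,\dots,\dot\Delta^n$ are its auxiliary matrices; they are square, of equal size $\prod_{k}|\dot I^k|$, and are sub-matrices of $\Delta^0,\dots,\Delta^n$ respectively. The dependence of $\dot\Delta^0,\dots,\dot\Delta^n$ on $\lambda$ and on the choice of the sets $(\dot I^k,\dot J^k)$ is omitted from the notation. **The sets $E^k$ and $W^k$.** $E^k$ is the finite set of polynomials, among the determinants of all square sub-matrices of $\Delta^k-w\Delta^0$, which are nonzero and of degree in $w$ at most $\mathrm{rank}(\dot\Delta^0)$.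 Since $\Delta^k-w\Delta^0$ depends polynomially on $\lambda$, the elements of $E^k$ are seen as bivariate polynomials $P(\lambda,w)$. A map $f:(0,\varepsilon)\to\mathbb C$ is a Puiseux series if there exist an integer $N\ge1$, $m_0\in\mathbb Z$ and complex numbers $(b_m)_{m\ge m_0}$ such that $f(\lambda)=\sum_{m\ge m_0}b_m\lambda^{m/N}$. By the Puiseux theorem, for any bivariate polynomial $P(\lambda,w)$ with $\deg_wP\ge1$ there exists $\lambda_0>0$ such that the roots of $P(\lambda,\cdot)$ are Puiseux series on $(0,\lambda_0)$. $W^k$ is the finite set of Puiseux series, on a common interval $(0,\lambda^k_0)$, formed by the roots in $w$ of all polynomials $P\in E^k$ with $\deg_wP\ge1$. *)

theory Defs
  imports
    "HOL-Probability.Probability"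
    "HOL-Combinatorics.Permutations"
    "HOL-Library.Landau_Symbols"
    "Jordan_Normal_Form.DL_Rank"
    "Jordan_Normal_Form.DL_Submatrix"
begin

unbundle no vec_syntax
hide_const (open) Finite_Cartesian_Product.vec Finite_Cartesian_Product.mat
  Finite_Cartesian_Product.row Finite_Cartesian_Product.column
  Determinants.det Cartesian_Space.rank Finite_Cartesian_Product.transpose


section \<open>Matrix games\<close>

definition mixed :: "nat \<Rightarrow> real vec set" where
  "mixed m = {x \<in> carrier_vec m. (\<forall>i<m. 0 \<le> x $ i) \<and> (\<Sum>i<m. x $ i) = 1}"

definition game_payoff :: "real mat \<Rightarrow> real vec \<Rightarrow> real vec \<Rightarrow> real" where
  "game_payoff A x y = x \<bullet> (A *\<^sub>v y)"

text \<open>The max-min; it is attained and equals the min-max by von Neumann's theorem.\<close>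
definition game_val :: "real mat \<Rightarrow> real" where
  "game_val A = (SUP x\<in>mixed (dim_row A). INF y\<in>mixed (dim_col A). game_payoff A x y)"

definition optimal_pairs :: "real mat \<Rightarrow> (real vec \<times> real vec) set" where
  "optimal_pairs A = {(x, y).
     x \<in> mixed (dim_row A) \<and> (\<forall>y'\<in>mixed (dim_col A). game_val A \<le> game_payoff A x y') \<and>
     y \<in> mixed (dim_col A) \<and> (\<forall>x'\<in>mixed (dim_row A). game_payoff A x' y \<le> game_val A)}"

text \<open>Extreme points of the set of optimal pairs. This is \<^const>\<open>extreme_point_of\<close>
  written out, since matrix-library vectors are not a real vector space type.\<close>
definition basic_solution :: "real mat \<Rightarrow> real vec \<Rightarrow> real vec \<Rightarrow> bool" where
  "basic_solution A x y \<longleftrightarrow> (x, y) \<in> optimal_pairs A \<and>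
     \<not> (\<exists>(x1, y1)\<in>optimal_pairs A. \<exists>(x2, y2)\<in>optimal_pairs A. \<exists>t.
          (x1, y1) \<noteq> (x2, y2) \<and> 0 < t \<and> t < 1 \<and>
          x = (1 - t) \<cdot>\<^sub>v x1 + t \<cdot>\<^sub>v x2 \<and> y = (1 - t) \<cdot>\<^sub>v y1 + t \<cdot>\<^sub>v y2)"

definition cofactor_mat :: "'a::comm_ring_1 mat \<Rightarrow> 'a mat" where
  "cofactor_mat M = mat (dim_row M) (dim_col M) (\<lambda>(i, j). cofactor M i j)"

definition entry_sum :: "'a::comm_monoid_add mat \<Rightarrow> 'a" where
  "entry_sum M = (\<Sum>i<dim_row M. \<Sum>j<dim_col M. M $$ (i, j))"

definition ones :: "nat \<Rightarrow> real vec" where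
  "ones m = vec m (\<lambda>_. 1)"

definition restrict_vec :: "'a vec \<Rightarrow> nat set \<Rightarrow> 'a vec" where
  "restrict_vec x I = vec (card I) (\<lambda>i. x $ pick I i)"

text \<open>Rows and columns are numbered from 0; \<open>I\<close> and \<open>J\<close> are the row and column
  sets of the kernel.\<close>
definition shapley_snow_kernel :: "real mat \<Rightarrow> nat set \<Rightarrow> nat set \<Rightarrow> bool" where
  "shapley_snow_kernel G I J \<longleftrightarrow>
     I \<subseteq> {..<dim_row G} \<and> J \<subseteq> {..<dim_col G} \<and> I \<noteq> {} \<and> card I = card J \<and>
     (\<exists>x y. basic_solution G x y \<and>
       (let Gd = submatrix G I J; m = card I; C = cofactor_mat Gd; s = entry_sum C;
            xd = restrict_vec x I; yd = restrict_vec y J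
        in s \<noteq> 0 \<and>
           xd = (1 / s) \<cdot>\<^sub>v (C *\<^sub>v ones m) \<and>
           yd = (1 / s) \<cdot>\<^sub>v (transpose_mat C *\<^sub>v ones m) \<and>
           game_val G = game_val Gd \<and> game_val Gd = det Gd / s \<and>
           transpose_mat Gd *\<^sub>v xd = game_val G \<cdot>\<^sub>v ones m \<and>
           Gd *\<^sub>v yd = game_val G \<cdot>\<^sub>v ones m))"


section \<open>Stochastic games\<close>

text \<open>The states are \<open>1, \<dots>, states G\<close>; in state \<open>k\<close> the actions of the two players
  are \<open>0, \<dots>, acts1 G k - 1\<close> and \<open>0, \<dots>, acts2 G k - 1\<close>.\<close>
record sgame =
  states :: nat
  acts1 :: "nat \<Rightarrow> nat"
  acts2 :: "nat \<Rightarrow> nat"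
  stage :: "nat \<Rightarrow> nat \<Rightarrow> nat \<Rightarrow> real"
  trans_pmf :: "nat \<Rightarrow> nat \<Rightarrow> nat \<Rightarrow> nat pmf"

definition stochastic_game :: "sgame \<Rightarrow> bool" where
  "stochastic_game G \<longleftrightarrow> 1 \<le> states G \<and>
     (\<forall>k\<in>{1..states G}. 1 \<le> acts1 G k \<and> 1 \<le> acts2 G k \<and>
        (\<forall>i<acts1 G k. \<forall>j<acts2 G k. set_pmf (trans_pmf G k i j) \<subseteq> {1..states G}))"

text \<open>Behaviour strategies under perfect monitoring: the mixed action depends on the list
  of past triples (state, action 1, action 2), latest first, and on the current state.\<close>
type_synonym strategy = "(nat \<times> nat \<times> nat) list \<Rightarrow> nat \<Rightarrow> nat pmf"

definition strategies :: "nat \<Rightarrow> (nat \<Rightarrow> nat) \<Rightarrow> strategy set" where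
  "strategies n acts = {\<sigma>. \<forall>h. \<forall>k\<in>{1..n}. set_pmf (\<sigma> h k) \<subseteq> {..<acts k}}"

primrec play :: "sgame \<Rightarrow> nat \<Rightarrow> strategy \<Rightarrow> strategy \<Rightarrow> nat \<Rightarrow> ((nat \<times> nat \<times> nat) list \<times> nat) pmf" where
  "play G k1 \<sigma> \<tau> 0 = return_pmf ([], k1)"
| "play G k1 \<sigma> \<tau> (Suc m) =
     bind_pmf (play G k1 \<sigma> \<tau> m) (\<lambda>(h, k).
       bind_pmf (\<sigma> h k) (\<lambda>i.
         bind_pmf (\<tau> h k) (\<lambda>j.
           map_pmf (\<lambda>l. ((k, i, j) # h, l)) (trans_pmf G k i j))))"

text \<open>Payoff of stage \<open>m + 1\<close>: the head of the history after \<open>m + 1\<close> stages is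
  the triple of that stage.\<close>
definition stage_payoff :: "sgame \<Rightarrow> nat \<Rightarrow> strategy \<Rightarrow> strategy \<Rightarrow> nat \<Rightarrow> real" where
  "stage_payoff G k1 \<sigma> \<tau> m =
     measure_pmf.expectation (play G k1 \<sigma> \<tau> (Suc m)) (\<lambda>(h, _). case hd h of (k, i, j) \<Rightarrow> stage G k i j)"

text \<open>Stage payoffs are bounded, so the series of expectations is the expectation of the series.\<close>
definition disc_payoff :: "sgame \<Rightarrow> real \<Rightarrow> nat \<Rightarrow> strategy \<Rightarrow> strategy \<Rightarrow> real" where
  "disc_payoff G l k1 \<sigma> \<tau> = (\<Sum>m. l * (1 - l) ^ m * stage_payoff G k1 \<sigma> \<tau> m)"

text \<open>The sup-inf, which equals the inf-sup by Shapley's theorem.\<close>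
definition disc_value :: "sgame \<Rightarrow> real \<Rightarrow> nat \<Rightarrow> real" where
  "disc_value G l k =
     (SUP \<sigma>\<in>strategies (states G) (acts1 G). INF \<tau>\<in>strategies (states G) (acts2 G). disc_payoff G l k \<sigma> \<tau>)"

definition local_game :: "sgame \<Rightarrow> nat \<Rightarrow> real \<Rightarrow> (nat \<Rightarrow> real) \<Rightarrow> real mat" where
  "local_game G k l z = mat (acts1 G k) (acts2 G k)
     (\<lambda>(i, j). l * stage G k i j + (1 - l) * (\<Sum>s=1..states G. pmf (trans_pmf G k i j) s * z s))"


section \<open>Kronecker determinants and auxiliary matrices\<close>

definition kron :: "'a::comm_ring_1 mat \<Rightarrow> 'a mat \<Rightarrow> 'a mat" where
  "kron A B = mat (dim_row A * dim_row B) (dim_col A * dim_col B)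
     (\<lambda>(i, j). A $$ (i div dim_row B, j div dim_col B) * B $$ (i mod dim_row B, j mod dim_col B))"

text \<open>For an \<open>n\<close> by \<open>n\<close> array with \<open>n \<ge> 1\<close>, rows and columns indexed from 1. The dimensions
  are read off column 1, as all matrices in one row have the same size.\<close>
definition kron_det :: "nat \<Rightarrow> (nat \<Rightarrow> nat \<Rightarrow> 'a::comm_ring_1 mat) \<Rightarrow> 'a mat" where
  "kron_det n A = mat (\<Prod>k=1..n. dim_row (A k 1)) (\<Prod>k=1..n. dim_col (A k 1))
     (\<lambda>(i, j). \<Sum>\<sigma> | \<sigma> permutes {1..n}.
        signof \<sigma> * foldr kron (map (\<lambda>k. A k (\<sigma> k)) [1..<Suc n]) (1\<^sub>m 1) $$ (i, j))"

text \<open>The array \<open>D\<close> has rows \<open>1, \<dots>, n\<close> and columns \<open>0, \<dots>, n\<close>. Once column \<open>c\<close>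
  is removed, the remaining ones are renumbered \<open>1, \<dots>, n\<close> in order.\<close>
definition aux_matrix :: "nat \<Rightarrow> (nat \<Rightarrow> nat \<Rightarrow> 'a::comm_ring_1 mat) \<Rightarrow> nat \<Rightarrow> 'a mat" where
  "aux_matrix n D c = (- 1) ^ c \<cdot>\<^sub>m kron_det n (\<lambda>k j. D k (if j \<le> c then j - 1 else j))"

text \<open>The discount rate is the polynomial variable \<open>[:0, 1:]\<close>, so that
  \<open>1 - \<lambda>\<close> is \<open>[:1, -1:]\<close>.\<close>
definition data_array :: "sgame \<Rightarrow> nat \<Rightarrow> nat \<Rightarrow> real poly mat" where
  "data_array G k c = mat (acts1 G k) (acts2 G k) (\<lambda>(i, j).
     if c = 0 then Polynomial.smult (stage G k i j) [:0, 1:]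
     else Polynomial.smult (pmf (trans_pmf G k i j) c) [:1, - 1:] - (if c = k then 1 else 0))"

definition aux :: "sgame \<Rightarrow> nat \<Rightarrow> real poly mat" where
  "aux G c = aux_matrix (states G) (data_array G) c"

definition reduced_aux :: "sgame \<Rightarrow> (nat \<Rightarrow> nat set) \<Rightarrow> (nat \<Rightarrow> nat set) \<Rightarrow> nat \<Rightarrow> real poly mat" where
  "reduced_aux G Is Js c = aux_matrix (states G) (\<lambda>k l. submatrix (data_array G k l) (Is k) (Js k)) c"

definition mat_at :: "real poly mat \<Rightarrow> real \<Rightarrow> real mat" where
  "mat_at A l = map_mat (\<lambda>p. poly p l) A"

definition mat_rank :: "real mat \<Rightarrow> nat" where
  "mat_rank A = vec_space.rank (dim_row A) A"


section \<open>Bivariate polynomials and Puiseux series\<close>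

text \<open>In \<^typ>\<open>real poly poly\<close> the outer variable is \<open>w\<close> and the inner one is \<open>\<lambda>\<close>:
  \<^const>\<open>degree\<close> is the degree in \<open>w\<close>.\<close>
definition eval2 :: "real poly poly \<Rightarrow> real \<Rightarrow> 'a::real_field \<Rightarrow> 'a" where
  "eval2 P l w = poly (map_poly (\<lambda>c. of_real (poly c l)) P) w"

definition pencil :: "sgame \<Rightarrow> nat \<Rightarrow> real poly poly mat" where
  "pencil G k = mat (dim_row (aux G 0)) (dim_col (aux G 0))
     (\<lambda>(i, j). [: aux G k $$ (i, j), - (aux G 0 $$ (i, j)) :])"

definition E_set :: "sgame \<Rightarrow> nat \<Rightarrow> nat \<Rightarrow> real poly poly set" where
  "E_set G a k = {P. P \<noteq> 0 \<and> degree P \<le> a \<and>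
     (\<exists>R C. R \<subseteq> {..<dim_row (pencil G k)} \<and> C \<subseteq> {..<dim_col (pencil G k)} \<and>
        R \<noteq> {} \<and> card R = card C \<and> P = det (submatrix (pencil G k) R C))}"

definition puiseux_on :: "real \<Rightarrow> (real \<Rightarrow> complex) \<Rightarrow> bool" where
  "puiseux_on \<epsilon> f \<longleftrightarrow> (\<exists>N\<ge>1. \<exists>m0::int. \<exists>b::nat \<Rightarrow> complex. \<forall>l\<in>{0<..<\<epsilon>}.
     (\<lambda>m. b m * of_real (l powr (real_of_int (m0 + int m) / real N))) sums f l)"

text \<open>Functions on \<open>(0, \<epsilon>)\<close> are represented by their extension by \<^const>\<open>undefined\<close>,
  without which this set would never be finite.\<close>
definition root_series :: "real poly poly set \<Rightarrow> real \<Rightarrow> (real \<Rightarrow> complex) set" where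
  "root_series E \<epsilon> = {f \<in> extensional {0<..<\<epsilon>}. puiseux_on \<epsilon> f \<and>
     (\<exists>P\<in>E. 1 \<le> degree P \<and> (\<forall>l\<in>{0<..<\<epsilon>}. eval2 P l (f l) = 0))}"

text \<open>On \<open>(0, \<epsilon>)\<close>, all the roots of all the polynomials in \<open>E\<close> are given by Puiseux series.\<close>
definition puiseux_interval :: "real poly poly set \<Rightarrow> real \<Rightarrow> bool" where
  "puiseux_interval E \<epsilon> \<longleftrightarrow> 0 < \<epsilon> \<and>
     (\<forall>P\<in>E. 1 \<le> degree P \<longrightarrow> (\<forall>l\<in>{0<..<\<epsilon>}. \<forall>w::complex.
        eval2 P l w = 0 \<longrightarrow> (\<exists>f\<in>root_series {P} \<epsilon>. f l = w)))"

definition W_set :: "sgame \<Rightarrow> nat \<Rightarrow> nat \<Rightarrow> real \<Rightarrow> (real \<Rightarrow> complex) set" where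
  "W_set G a k \<epsilon> = root_series (E_set G a k) \<epsilon>"

end

theory Submission
  imports Defs
    "HOL-Complex_Analysis.Complex_Analysis"
    "HOL-Computational_Algebra.Field_as_Ring"
    "HOL-Computational_Algebra.Squarefree"
    "Jordan_Normal_Form.Char_Poly"
begin

text \<open>Fix the discount rate \<open>\<lambda>\<close> and write \<open>v\<close> for the value vector. The array \<open>D(\<lambda>)\<close> is made so that,
  with \<open>z\<^sub>0 = 1\<close> and \<open>z\<^sub>c = v\<^sub>c\<close>, the combination \<open>\<Sum>\<^sub>c z\<^sub>c M\<^sup>s\<^sub>c\<close> is the local game of state \<open>s\<close>
  at \<open>v\<close>, shifted by its own value \<open>v\<^sub>s\<close>. On a Shapley-Snow kernel both players have equalizing
  strategies, so this combination is annihilated from the left by \<open>x\<^sup>s\<close> and from the right by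
  \<open>y\<^sup>s\<close>. By Cramer's rule, applied in every entry, the Kronecker products \<open>x\<close> and \<open>y\<close> of these
  strategies annihilate \<open>A = \<Delta>\<^sup>k - v\<^sub>k \<Delta>\<^sup>0\<close> (formed with the reduced array), whereas
  \<open>x \<Delta>\<^sup>0 y\<close> is the determinant of a matrix \<open>(1 - \<lambda>) Q - 1\<close> with \<open>Q\<close> stochastic, which is
  not zero. Border a maximal nonvanishing minor of \<open>A\<close> with \<open>x\<close> and \<open>y\<close>: for small \<open>t \<noteq> 0\<close> the
  bordered minor of \<open>A - t \<Delta>\<^sup>0\<close> is not zero. Hence some minor of the pencil \<open>\<Delta>\<^sup>k - w \<Delta>\<^sup>0\<close>
  vanishes at \<open>w = v\<^sub>k\<close> but not identically in \<open>w\<close>, and its degree in \<open>w\<close> is at most the rank of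
  \<open>\<Delta>\<^sup>0\<close> (\<open>bordered_minor\<close>, \<open>degree_det_pencil\<close>, \<open>local_minor\<close>).

  This minor may change with \<open>\<lambda>\<close>. Let \<open>R\<close> be a squarefree polynomial that vanishes wherever one of
  the finitely many nonzero minors of the pencil does. Near \<open>0\<close> its roots in \<open>w\<close> are simple, so a
  continuous root function of \<open>R\<close> on an interval is determined by one value, and every minor
  vanishes along it either everywhere or nowhere (\<open>root_function_unique\<close>,
  \<open>root_function_dichotomy\<close>). The value is such a function: it is a fixed point of the local games
  (\<open>disc_value_eq_local\<close>), which makes it continuous in \<open>\<lambda>\<close>. One minor of degree at most \<open>a\<close>
  vanishes at the value for \<open>\<lambda>\<close> arbitrarily close to \<open>0\<close>, hence on a whole interval: this is (i).

  For (ii), the roots of \<open>R\<close> form a covering of a punctured disc, which the exponential unwinds over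
  a half-plane. Each root function lifts to a holomorphic function there, with a smallest period
  \<open>2 \<pi> \<i> N\<close>; it is thus a function of \<open>t = \<lambda>\<^bsup>1/N\<^esup>\<close>, holomorphic apart from a pole at \<open>0\<close>, and its
  Laurent series is the Puiseux series. The \<open>N\<close> determinations of the lifted value are distinct
  roots of the minor found in (i), whence \<open>N \<le> a\<close> (\<open>puiseux_branch\<close>). As the value is bounded
  there is no pole, so it differs from its limit by \<open>O(t)\<close>, which is (iii).\<close>

unbundle no vec_syntax
unbundle no fps_syntax
no_notation fps_nth (infixl "$" 75)
hide_const (open) Finite_Cartesian_Product.vec Finite_Cartesian_Product.mat
  Finite_Cartesian_Product.row Finite_Cartesian_Product.column
  Determinants.det Cartesian_Space.rank Finite_Cartesian_Product.transpose

section \<open>Coprime polynomials in two variables\<close>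

text \<open>An element of least degree in \<open>w\<close> of the ideal generated by \<open>P\<close> and \<open>S\<close> divides both
  generators up to factors in \<open>\<lambda>\<close> alone, by pseudo-division. A prime factor of it that involves
  \<open>w\<close> cannot divide those factors, hence would be common to \<open>P\<close> and \<open>S\<close>. At each \<open>\<lambda>\<close> with
  \<open>c(\<lambda>) \<noteq> 0\<close>, the polynomials \<open>P(\<lambda>, \<cdot>)\<close> and \<open>S(\<lambda>, \<cdot>)\<close> have no common root.\<close>
lemma bezout_constant:
  fixes P S :: "real poly poly"
  assumes nz: "P \<noteq> 0 \<or> S \<noteq> 0"
    and nocommon: "\<And>p. prime_elem p \<Longrightarrow> 1 \<le> degree p \<Longrightarrow> p dvd P \<Longrightarrow> p dvd S \<Longrightarrow> False"
  shows "\<exists>A B c. c \<noteq> 0 \<and> A * P + B * S = [:c:]"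
proof -
  define I where "I = {D. D \<noteq> 0 \<and> (\<exists>A B. D = A * P + B * S)}"
  have P_in: "P \<noteq> 0 \<Longrightarrow> P \<in> I"
    unfolding I_def by (auto intro: exI[of _ 1] exI[of _ 0])
  have S_in: "S \<noteq> 0 \<Longrightarrow> S \<in> I"
    unfolding I_def by (auto intro: exI[of _ 1] exI[of _ 0])
  have "\<exists>D. D \<in> I" using nz P_in S_in by blast
  then obtain D where D: "D \<in> I" and min: "\<And>E. E \<in> I \<Longrightarrow> degree D \<le> degree E"
    using ex_has_least_nat[of "\<lambda>D. D \<in> I" _ degree] by blast
  then obtain A B where AB: "D = A * P + B * S" and D0: "D \<noteq> 0" by (auto simp: I_def)
  have divides: "\<exists>c Q. c \<noteq> 0 \<and> Polynomial.smult c F = D * Q" if F: "F = P \<or> F = S" for F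
  proof -
    obtain Q T where QT: "pseudo_divmod F D = (Q, T)" by force
    define c where "c = lead_coeff D ^ (Suc (degree F) - degree D)"
    have c: "c \<noteq> 0" using D0 by (simp add: c_def)
    have eq: "Polynomial.smult c F = D * Q + T" and deg: "T = 0 \<or> degree T < degree D"
      using pseudo_divmod[OF D0 QT] by (simp_all add: c_def)
    \<comment> \<open>The remainder is again in the ideal.\<close>
    have "T = (if F = P then [:c:] - A * Q else - (A * Q)) * P
             + (if F = P then - (B * Q) else [:c:] - B * Q) * S"
      using eq F AB by (auto simp: algebra_simps split: if_splits)
    hence "T \<noteq> 0 \<Longrightarrow> T \<in> I" unfolding I_def by blast
    with deg min[of T] have "T = 0" by force
    with eq c show ?thesis by auto
  qed
  have "degree D = 0"
  proof (rule ccontr)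
    assume deg: "degree D \<noteq> 0"
    have "\<exists>p. p \<in> prime_factors D \<and> degree p \<noteq> 0"
    proof (rule ccontr)
      assume "\<not> ?thesis"
      hence *: "degree p = 0" if "p \<in># prime_factorization D" for p using that by auto
      have "degree (prod_mset M) = 0" if "\<forall>p\<in>#M. degree p = 0" for M :: "real poly poly multiset"
        using that
      proof (induction M)
        case (add x M)
        thus ?case using degree_mult_le[of x "prod_mset M"] by simp
      qed simp
      hence "degree (prod_mset (prime_factorization D)) = 0" using * by blast
      moreover have "D dvd prod_mset (prime_factorization D)"
        using prod_mset_prime_factorization_weak[OF D0]
        by (metis associatedD2 dvd_refl)
      moreover have "prod_mset (prime_factorization D) \<noteq> 0"
        using prod_mset_prime_factorization_weak[OF D0] D0 by (metis normalize_eq_0_iff)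
      ultimately show False using dvd_imp_degree_le[of D] deg by fastforce
    qed
    then obtain p where p: "p \<in> prime_factors D" "degree p \<noteq> 0" by blast
    hence pr: "prime_elem p" and pD: "p dvd D" by (auto simp: in_prime_factors_iff)
    have "p dvd F" if F: "F = P \<or> F = S" for F
    proof -
      obtain c Q where c: "c \<noteq> 0" and cQ: "Polynomial.smult c F = D * Q" using divides[OF F] by blast
      have "p dvd [:c:] * F" using cQ pD by simp
      hence "p dvd [:c:] \<or> p dvd F" using pr by (simp only: prime_elem_dvd_mult_iff)
      moreover have "\<not> p dvd [:c:]"
        using dvd_imp_degree_le[of p "[:c:]"] c p(2) by auto
      ultimately show ?thesis by blast
    qed
    with nocommon[OF pr] p(2) show False by (auto simp: Suc_le_eq)
  qed
  then obtain c where "D = [:c:]" by (auto elim: degree_eq_zeroE)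
  with D0 AB show ?thesis by (intro exI[of _ A] exI[of _ B] exI[of _ c]) auto
qed

text \<open>So the roots in \<open>w\<close> of a squarefree polynomial are simple, except at finitely many \<open>\<lambda>\<close>.\<close>
lemma squarefree_bezout_pderiv:
  fixes R :: "real poly poly"
  assumes "squarefree R"
  shows "\<exists>A B c. c \<noteq> 0 \<and> A * R + B * pderiv R = [:c:]"
proof (rule bezout_constant)
  show "R \<noteq> 0 \<or> pderiv R \<noteq> 0" using assms by auto
  fix p assume p: "prime_elem p" "1 \<le> degree p" "p dvd R" "p dvd pderiv R"
  from p(3) obtain T where T: "R = p * T" by blast
  have "p dvd pderiv p * T"
    using p(4) unfolding T pderiv_mult by (simp add: dvd_add_right_iff mult.commute)
  moreover have "pderiv p \<noteq> 0" using p(2) by (simp add: pderiv_eq_0_iff)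
  hence "\<not> p dvd pderiv p"
    using dvd_imp_degree_le[of p "pderiv p"] p(2) by (auto simp: degree_pderiv)
  ultimately have "p dvd T" using p(1) by (simp add: prime_elem_dvd_mult_iff)
  hence "p ^ 2 dvd R" unfolding T power2_eq_square by simp
  with assms have "p dvd 1" by (rule squarefreeD)
  with p(1) show False by (simp add: prime_elem_def)
qed

text \<open>With \<open>D\<close> the greatest common divisor of \<open>P\<close> and \<open>R\<close>: a prime that divides both \<open>P\<close> and
  the cofactor \<open>S\<close> would divide \<open>R\<close> twice. Hence, except at finitely many \<open>\<lambda>\<close>, a root of \<open>R\<close> is
  a root of exactly one of \<open>P\<close> and \<open>S\<close>.\<close>
lemma squarefree_bezout_cofactor:
  fixes R P :: "real poly poly"
  assumes "squarefree R"
  shows "\<exists>D S A B c. D dvd P \<and> R = D * S \<and> c \<noteq> 0 \<and> A * P + B * S = [:c:]"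
proof -
  obtain S where S: "R = gcd P R * S" by (metis dvd_def gcd_dvd2)
  have "\<exists>A B c. c \<noteq> 0 \<and> A * P + B * S = [:c:]"
  proof (rule bezout_constant)
    show "P \<noteq> 0 \<or> S \<noteq> 0" using assms S by (metis mult_zero_right not_squarefree_0)
    fix p assume p: "prime_elem p" "p dvd P" "p dvd S"
    hence "p dvd gcd P R" using S by (metis dvd_mult gcd_greatest)
    hence "p ^ 2 dvd R" using p(3) S unfolding power2_eq_square by (metis mult_dvd_mono)
    with assms have "p dvd 1" by (rule squarefreeD)
    with p(1) show False by (simp add: prime_elem_def)
  qed
  with S show ?thesis by (meson gcd_dvd1)
qed

text \<open>The product of the distinct primes that divide some member of \<open>F\<close>. It reduces the study of
  the roots of finitely many polynomials to one polynomial with simple roots.\<close>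
lemma common_squarefree_multiple:
  fixes F :: "real poly poly set"
  assumes "finite F" "0 \<notin> F"
  shows "\<exists>R. squarefree R \<and> (\<forall>P\<in>F. \<exists>m. P dvd R ^ m)"
proof -
  define Q where "Q = \<Prod>F"
  have Q0: "Q \<noteq> 0" using assms by (auto simp: Q_def)
  define R where "R = \<Prod>(prime_factors Q)"
  have "squarefree R" unfolding R_def
  proof (rule squarefree_prod_coprime)
    show "\<And>a b. a \<in> prime_factors Q \<Longrightarrow> b \<in> prime_factors Q \<Longrightarrow> a \<noteq> b \<Longrightarrow> coprime a b"
      by (auto intro: primes_coprime)
    show "\<And>a. a \<in> prime_factors Q \<Longrightarrow> squarefree a"
      by (auto intro: squarefree_prime)
  qed
  moreover have "\<exists>m. Q dvd R ^ m"
  proof -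
    define m where "m = size (prime_factorization Q)"
    have "prod_mset M dvd (\<Prod>A) ^ size M"
      if "set_mset M \<subseteq> A" "finite A" for M and A :: "real poly poly set"
      using that
    proof (induction M)
      case (add x M)
      hence "x dvd \<Prod>A" by (auto intro: dvd_prodI)
      with add show ?case by (auto intro: mult_dvd_mono)
    qed auto
    from this[of "prime_factorization Q" "prime_factors Q"]
    have "prod_mset (prime_factorization Q) dvd R ^ m" by (simp add: R_def m_def)
    moreover have "Q dvd prod_mset (prime_factorization Q)"
      using prod_mset_prime_factorization_weak[OF Q0] by (metis associatedD2 dvd_refl)
    ultimately show ?thesis using dvd_trans by blast
  qed
  moreover have "P dvd Q" if "P \<in> F" for P
    using that assms(1) by (auto simp: Q_def intro: dvd_prodI[of F P "\<lambda>x. x"])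
  ultimately show ?thesis by (meson dvd_trans)
qed

section \<open>Continuous root functions\<close>

definition ceval :: "complex \<Rightarrow> real poly \<Rightarrow> complex" where
  "ceval z c = poly (map_poly of_real c) z"

text \<open>The extension of \<^const>\<open>eval2\<close> to complex \<open>\<lambda>\<close>: the roots are going to be followed around
  the point \<open>\<lambda> = 0\<close>.\<close>
definition beval :: "real poly poly \<Rightarrow> complex \<Rightarrow> complex \<Rightarrow> complex" where
  "beval P z w = poly (map_poly (ceval z) P) w"

lemma ceval_hom: "comm_ring_hom (ceval z)"
proof -
  interpret h: comm_ring_hom "of_real :: real \<Rightarrow> complex" by unfold_locales auto
  interpret mp: map_poly_comm_ring_hom "of_real :: real \<Rightarrow> complex" ..
  show ?thesis by unfold_locales (simp_all add: ceval_def hom_distribs)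
qed

lemma ceval_of_real: "ceval (of_real l) c = of_real (poly c l)"
  by (simp add: ceval_def)

lemma beval_mult: "beval (P * Q) z w = beval P z w * beval Q z w"
proof -
  interpret h: comm_ring_hom "ceval z" by (rule ceval_hom)
  interpret mp: map_poly_comm_ring_hom "ceval z" ..
  show ?thesis by (simp add: beval_def hom_distribs)
qed

lemma beval_add: "beval (P + Q) z w = beval P z w + beval Q z w"
proof -
  interpret h: comm_ring_hom "ceval z" by (rule ceval_hom)
  interpret mp: map_poly_comm_ring_hom "ceval z" ..
  show ?thesis by (simp add: beval_def hom_distribs)
qed

lemma beval_power: "beval (P ^ m) z w = beval P z w ^ m"
  by (induction m) (simp_all add: beval_mult, simp add: beval_def ceval_def)

lemma beval_const: "beval [:c:] z w = ceval z c"
proof -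
  interpret h: comm_ring_hom "ceval z" by (rule ceval_hom)
  show ?thesis by (cases "c = 0") (simp_all add: beval_def map_poly_pCons)
qed

lemma beval_altdef: "beval P z w = (\<Sum>i\<le>degree P. ceval z (coeff P i) * w ^ i)"
proof -
  interpret h: comm_ring_hom "ceval z" by (rule ceval_hom)
  show ?thesis unfolding beval_def poly_altdef
    by (rule sum.mono_neutral_cong_left)
      (auto simp: degree_map_poly_le coeff_map_poly intro: le_degree)
qed

text \<open>The divided difference in \<open>w\<close>. Written as a polynomial it is continuous also on the diagonal,
  where it is the derivative.\<close>
definition divdiff :: "real poly poly \<Rightarrow> complex \<Rightarrow> complex \<Rightarrow> complex \<Rightarrow> complex" where
  "divdiff P z x y = (\<Sum>i\<le>degree P. ceval z (coeff P i) * (\<Sum>j<i. y ^ (i - Suc j) * x ^ j))"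

lemma beval_diff: "beval P z x - beval P z y = (x - y) * divdiff P z x y"
proof -
  have "ceval z (coeff P i) * x ^ i - ceval z (coeff P i) * y ^ i =
      (x - y) * (ceval z (coeff P i) * (\<Sum>j<i. y ^ (i - Suc j) * x ^ j))" for i
    by (simp only: right_diff_distrib[symmetric] power_diff_sumr2) (simp only: mult_ac)
  thus ?thesis
    by (simp add: beval_altdef divdiff_def sum_subtractf[symmetric] sum_distrib_left)
qed

lemma divdiff_same: "divdiff P z x x = beval (pderiv P) z x"
proof -
  interpret h: comm_ring_hom "ceval z" by (rule ceval_hom)
  interpret mp: map_poly_comm_ring_hom "ceval z" ..
  interpret ih: idom_hom "ceval z" ..
  have "((\<lambda>y. beval P z y) has_field_derivative beval (pderiv P) z x) (at x)"
    unfolding beval_def by (subst ih.map_poly_pderiv) (rule poly_DERIV)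
  moreover have "((\<lambda>y. beval P z y) has_field_derivative divdiff P z x x) (at x)"
  proof -
    have "((\<lambda>y. divdiff P z y x) \<longlongrightarrow> divdiff P z x x) (at x)"
      unfolding divdiff_def by (intro tendsto_intros)
    moreover have "eventually (\<lambda>y. divdiff P z y x = (beval P z y - beval P z x) / (y - x)) (at x)"
      by (auto simp: eventually_at_filter beval_diff)
    ultimately show ?thesis unfolding has_field_derivative_iff
      using tendsto_cong by fast
  qed
  ultimately show ?thesis by (rule DERIV_unique[symmetric])
qed

lemma continuous_ceval: "continuous_on X e \<Longrightarrow> continuous_on X (\<lambda>x. ceval (e x) c)"
  unfolding ceval_def by (intro continuous_intros)

lemma continuous_beval:
  assumes "continuous_on X e" "continuous_on X u"
  shows "continuous_on X (\<lambda>x. beval P (e x) (u x))"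
  unfolding beval_altdef using assms by (intro continuous_intros continuous_ceval)

lemma continuous_divdiff:
  assumes "continuous_on X e" "continuous_on X u" "continuous_on X v"
  shows "continuous_on X (\<lambda>x. divdiff P (e x) (u x) (v x))"
  unfolding divdiff_def using assms by (intro continuous_intros continuous_ceval)

text \<open>If \<open>R\<close> vanishes at \<open>u\<close> and at \<open>v\<close>, then \<open>u - v\<close> or the divided difference is zero, and not
  both, since a root is simple. The set where \<open>u = v\<close> is therefore closed and open.\<close>
lemma root_function_unique:
  fixes e u v :: "'a::topological_space \<Rightarrow> complex"
  assumes X: "connected X" and e: "continuous_on X e" and u: "continuous_on X u" and v: "continuous_on X v"
    and ru: "\<And>x. x \<in> X \<Longrightarrow> beval R (e x) (u x) = 0"
    and rv: "\<And>x. x \<in> X \<Longrightarrow> beval R (e x) (v x) = 0"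
    and simple: "\<And>x w. x \<in> X \<Longrightarrow> beval R (e x) w = 0 \<Longrightarrow> beval (pderiv R) (e x) w \<noteq> 0"
    and x0: "x0 \<in> X" "u x0 = v x0" and x: "x \<in> X"
  shows "u x = v x"
proof -
  let ?S = "{x \<in> X. u x - v x = 0}"
  have eq: "?S = {x \<in> X. divdiff R (e x) (u x) (v x) \<noteq> 0}"
  proof (intro Collect_cong conj_cong refl)
    fix x assume x: "x \<in> X"
    have "(u x - v x) * divdiff R (e x) (u x) (v x) = 0"
      using beval_diff[of R "e x" "u x" "v x"] ru[OF x] rv[OF x] by simp
    moreover have "divdiff R (e x) (u x) (v x) \<noteq> 0" if "u x = v x"
      using simple[OF x rv[OF x]] that by (simp add: divdiff_same)
    ultimately show "u x - v x = 0 \<longleftrightarrow> divdiff R (e x) (u x) (v x) \<noteq> 0" by auto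
  qed
  have "closedin (top_of_set X) ?S"
    by (intro continuous_closedin_preimage_constant continuous_intros u v)
  moreover have "openin (top_of_set X) ?S"
  proof -
    have "openin (top_of_set X) (X \<inter> (\<lambda>x. divdiff R (e x) (u x) (v x)) -` (- {0}))"
      by (intro continuous_openin_preimage_gen continuous_divdiff e u v) auto
    also have "X \<inter> (\<lambda>x. divdiff R (e x) (u x) (v x)) -` (- {0}) = ?S"
      unfolding eq by auto
    finally show ?thesis .
  qed
  ultimately have "?S = {} \<or> ?S = X" using X unfolding connected_clopen by blast
  thus ?thesis using x0 x by auto
qed

text \<open>A root of \<open>R\<close> is a root of \<open>P\<close> or of \<open>S\<close>, and by the Bezout identity never of both; a
  connected domain is not the disjoint union of two nonempty closed sets.\<close>
lemma root_function_dichotomy: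
  fixes e u :: "'a::topological_space \<Rightarrow> complex"
  assumes X: "connected X" and e: "continuous_on X e" and u: "continuous_on X u"
    and R: "R = D * S" and DP: "D dvd P" and bez: "A * P + B * S = [:c:]"
    and c: "\<And>x. x \<in> X \<Longrightarrow> ceval (e x) c \<noteq> 0"
    and ru: "\<And>x. x \<in> X \<Longrightarrow> beval R (e x) (u x) = 0"
    and x0: "x0 \<in> X" "beval P (e x0) (u x0) = 0" and x: "x \<in> X"
  shows "beval P (e x) (u x) = 0"
proof -
  let ?S = "{x \<in> X. beval P (e x) (u x) = 0}"
  let ?T = "{x \<in> X. beval S (e x) (u x) = 0}"
  obtain E where E: "P = D * E" using DP by blast
  have "closedin (top_of_set X) ?S" "closedin (top_of_set X) ?T"
    by (intro continuous_closedin_preimage_constant continuous_beval e u)+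
  moreover have "?S \<inter> ?T = {}"
  proof -
    have "ceval (e x) c = 0" if "beval P (e x) (u x) = 0" "beval S (e x) (u x) = 0" for x
      using arg_cong[OF bez, of "\<lambda>P. beval P (e x) (u x)"] that
      by (simp add: beval_add beval_mult beval_const)
    with c show ?thesis by blast
  qed
  moreover have "X \<subseteq> ?S \<union> ?T" using ru by (auto simp: R E beval_mult)
  ultimately have "?S = {} \<or> ?T = {}"
    using X unfolding connected_closedin by blast
  thus ?thesis using x0 x \<open>X \<subseteq> ?S \<union> ?T\<close> by blast
qed

section \<open>Puiseux expansions\<close>

text \<open>Each linear factor of \<open>p\<close> has modulus at least \<open>\<eta>\<close> at \<open>w\<close>. Conversely, a small value of \<open>p\<close>
  at \<open>w\<close> forces a root near \<open>w\<close>: this is the continuity of the roots.\<close>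
lemma poly_root_free_ball:
  fixes p :: "complex poly"
  assumes "0 \<le> \<eta>" "\<And>x. poly p x = 0 \<Longrightarrow> \<eta> \<le> dist w x"
  shows "norm (lead_coeff p) * \<eta> ^ degree p \<le> norm (poly p w)"
  using assms(2)
proof (induction "degree p" arbitrary: p)
  case 0
  then obtain a where "p = [:a:]" by (metis degree_eq_zeroE)
  thus ?case by simp
next
  case (Suc n)
  have "\<not> constant (poly p)" using Suc.hyps(2) by (simp add: constant_degree)
  then obtain x where x: "poly p x = 0" using fundamental_theorem_of_algebra by blast
  then obtain q where q: "p = [:-x, 1:] * q" unfolding poly_eq_0_iff_dvd by blast
  have p0: "p \<noteq> 0" using Suc.hyps(2) by auto
  hence q0: "q \<noteq> 0" using q by auto
  have dq: "degree p = Suc (degree q)" unfolding q using q0 by (subst degree_mult_eq) auto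
  have IH: "norm (lead_coeff q) * \<eta> ^ degree q \<le> norm (poly q w)"
    using Suc.hyps(1)[of q] Suc.hyps(2) dq Suc.prems by (auto simp: q)
  have "\<eta> \<le> norm (w - x)" using Suc.prems[OF x] by (simp add: dist_norm)
  hence "norm (lead_coeff q) * \<eta> ^ degree q * \<eta> \<le> norm (poly q w) * norm (w - x)"
    using IH assms(1) by (intro mult_mono) auto
  moreover have "lead_coeff p = lead_coeff q" unfolding q by (subst lead_coeff_mult) simp
  moreover have "poly p w = (w - x) * poly q w" unfolding q by (simp add: algebra_simps)
  ultimately show ?case unfolding dq by (simp add: norm_mult mult_ac)
qed

lemma finite_separation:
  assumes "finite (Z::complex set)"
  obtains \<eta> where "0 < \<eta>" "\<And>w w'. w \<in> Z \<Longrightarrow> w' \<in> Z \<Longrightarrow> w \<noteq> w' \<Longrightarrow> ball w \<eta> \<inter> ball w' \<eta> = {}"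
proof -
  define Q where "Q = (\<lambda>(w, w'). dist w w' / 2) ` {(w, w') \<in> Z \<times> Z. w \<noteq> w'}"
  have "{(w, w') \<in> Z \<times> Z. w \<noteq> w'} \<subseteq> Z \<times> Z" by auto
  from finite_subset[OF this finite_cartesian_product[OF assms assms]]
  have finQ: "finite (insert 1 Q)" unfolding Q_def by simp
  define \<eta> where "\<eta> = Min (insert 1 Q)"
  show ?thesis
  proof (rule that[of \<eta>])
    show "0 < \<eta>" unfolding \<eta>_def using finQ by (subst Min_gr_iff) (auto simp: Q_def)
    fix w w' assume ww: "w \<in> Z" "w' \<in> Z" "w \<noteq> w'"
    hence "dist w w' / 2 \<in> insert 1 Q" by (force simp: Q_def)
    hence "\<eta> \<le> dist w w' / 2" unfolding \<eta>_def using finQ by (intro Min_le) auto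
    thus "ball w \<eta> \<inter> ball w' \<eta> = {}" by (intro disjoint_ballI) auto
  qed
qed

locale simple_root_family =
  fixes R :: "real poly poly" and r :: real
  assumes r_pos: "0 < r"
    and deg: "1 \<le> degree R"
    and lc: "\<And>z. 0 < norm z \<Longrightarrow> norm z < r \<Longrightarrow> ceval z (lead_coeff R) \<noteq> 0"
    and simple: "\<And>z w. 0 < norm z \<Longrightarrow> norm z < r \<Longrightarrow> beval R z w = 0 \<Longrightarrow> beval (pderiv R) z w \<noteq> 0"
begin

definition pdisc :: "complex set" where "pdisc = {z. 0 < norm z \<and> norm z < r}"
definition rts :: "complex \<Rightarrow> complex set" where "rts z = {w. beval R z w = 0}"
definition fibre_poly :: "complex \<Rightarrow> complex poly" where "fibre_poly z = map_poly (ceval z) R"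
definition curve :: "(complex \<times> complex) set" where "curve = {(z, w). z \<in> pdisc \<and> w \<in> rts z}"

lemma fibre_poly:
  assumes "z \<in> pdisc"
  shows "degree (fibre_poly z) = degree R"
    and "lead_coeff (fibre_poly z) = ceval z (lead_coeff R)"
proof -
  interpret h: comm_ring_hom "ceval z" by (rule ceval_hom)
  show 1: "degree (fibre_poly z) = degree R" unfolding fibre_poly_def
    by (rule map_poly_degree_eq) (use assms lc in \<open>auto simp: pdisc_def\<close>)
  show "lead_coeff (fibre_poly z) = ceval z (lead_coeff R)"
    unfolding 1 by (simp add: fibre_poly_def coeff_map_poly)
qed

lemma card_rts:
  assumes z: "z \<in> pdisc"
  shows "finite (rts z)" "card (rts z) = degree R"
proof -
  interpret h: comm_ring_hom "ceval z" by (rule ceval_hom)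
  interpret ih: idom_hom "ceval z" ..
  let ?p = "fibre_poly z"
  have p0: "?p \<noteq> 0" using fibre_poly(1)[OF z] deg by auto
  have rts: "rts z = {w. poly ?p w = 0}" by (simp add: rts_def fibre_poly_def beval_def)
  show "finite (rts z)" unfolding rts by (rule poly_roots_finite[OF p0])
  have "rsquarefree ?p" unfolding rsquarefree_roots
    using simple[of z] z by (auto simp: fibre_poly_def beval_def pdisc_def ih.map_poly_pderiv)
  from complex_poly_decompose_rsquarefree[OF this]
  have eq: "Polynomial.smult (lead_coeff ?p) (\<Prod>z | poly ?p z = 0. [:- z, 1:]) = ?p" .
  have "degree ?p = degree (\<Prod>z | poly ?p z = 0. [:- z, 1:])"
    by (subst eq[symmetric]) (simp add: p0)
  also have "\<dots> = card {w. poly ?p w = 0}"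
    by (subst degree_prod_eq_sum_degree) auto
  finally show "card (rts z) = degree R" using fibre_poly(1)[OF z] rts by simp
qed

lemma rts_nearby:
  assumes z: "z \<in> pdisc" and w: "w \<in> rts z" and \<eta>: "0 < \<eta>"
  shows "\<exists>\<delta>>0. \<forall>z'\<in>pdisc \<inter> ball z \<delta>. \<exists>w'\<in>rts z'. dist w w' < \<eta>"
proof -
  let ?f = "\<lambda>z'. norm (ceval z' (lead_coeff R)) * \<eta> ^ degree R - norm (beval R z' w)"
  have "continuous_on UNIV ?f"
    by (intro continuous_intros continuous_ceval continuous_beval)
  moreover have "?f z > 0"
    using z w \<eta> lc[of z] by (auto simp: rts_def pdisc_def)
  ultimately obtain \<delta> where \<delta>: "0 < \<delta>" "\<And>z'. dist z' z < \<delta> \<Longrightarrow> dist (?f z') (?f z) < ?f z"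
    unfolding continuous_on_iff by (meson UNIV_I)
  show ?thesis
  proof (intro exI[of _ \<delta>] conjI ballI \<delta>(1))
    fix z' assume z': "z' \<in> pdisc \<inter> ball z \<delta>"
    hence "?f z' > 0" using \<delta>(2)[of z'] by (auto simp: dist_commute dist_real_def)
    moreover have "degree (fibre_poly z') = degree R"
      "lead_coeff (fibre_poly z') = ceval z' (lead_coeff R)"
      using z' fibre_poly by auto
    moreover have "beval R z' w = poly (fibre_poly z') w"
      by (simp add: fibre_poly_def beval_def)
    ultimately have *: "norm (poly (fibre_poly z') w) < norm (lead_coeff (fibre_poly z')) * \<eta> ^ degree (fibre_poly z')"
      by simp
    have "\<not> (\<forall>x. poly (fibre_poly z') x = 0 \<longrightarrow> \<eta> \<le> dist w x)"
      using poly_root_free_ball[of \<eta> "fibre_poly z'" w] * \<eta> by force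
    thus "\<exists>w'\<in>rts z'. dist w w' < \<eta>"
      by (force simp: rts_def fibre_poly_def beval_def)
  qed
qed

text \<open>Draw disjoint discs around the \<open>d\<close> roots over \<open>z\<close>. Over a point near \<open>z\<close> each disc contains a
  root, and as there are only \<open>d\<close> roots, each contains exactly one and they exhaust the fibre. The
  same continuity of the roots, at a nearby point, makes the local sections continuous.\<close>
lemma evenly_covered:
  assumes z: "z \<in> pdisc"
  shows "\<exists>T. z \<in> T \<and> openin (top_of_set pdisc) T \<and>
      (\<exists>v. \<Union>v = curve \<inter> fst -` T \<and> (\<forall>u\<in>v. openin (top_of_set curve) u) \<and>
        disjoint v \<and> (\<forall>u\<in>v. \<exists>q. homeomorphism u T fst q))"
proof -
  obtain \<eta> where \<eta>: "0 < \<eta>"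
    and disj: "\<And>w w'. w \<in> rts z \<Longrightarrow> w' \<in> rts z \<Longrightarrow> w \<noteq> w' \<Longrightarrow> ball w \<eta> \<inter> ball w' \<eta> = {}"
    using finite_separation[OF card_rts(1)[OF z]] by blast
  obtain d where d: "\<And>w. w \<in> rts z \<Longrightarrow> 0 < d w"
    "\<And>w z'. w \<in> rts z \<Longrightarrow> z' \<in> pdisc \<inter> ball z (d w) \<Longrightarrow> \<exists>w'\<in>rts z'. dist w w' < \<eta>"
    using rts_nearby[OF z _ \<eta>] by metis
  define \<delta> where "\<delta> = Min (insert 1 (d ` rts z))"
  have \<delta>: "0 < \<delta>" "\<And>w. w \<in> rts z \<Longrightarrow> \<delta> \<le> d w"
    using d(1) card_rts(1)[OF z] by (auto simp: \<delta>_def)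
  define T where "T = pdisc \<inter> ball z \<delta>"
  have near: "\<exists>w'\<in>rts z' \<inter> ball w \<eta>. True" if "w \<in> rts z" "z' \<in> T" for w z'
    using d(2)[of w z'] \<delta>(2)[of w] that by (force simp: T_def)
  have uniq: "card (rts z' \<inter> ball w \<eta>) = 1 \<and> rts z' \<subseteq> (\<Union>w\<in>rts z. ball w \<eta>)"
    if w: "w \<in> rts z" and z': "z' \<in> T" for w z'
  proof -
    have zp: "z' \<in> pdisc" using z' by (simp add: T_def)
    let ?B = "\<lambda>w. rts z' \<inter> ball w \<eta>"
    have ge: "1 \<le> card (?B w)" if "w \<in> rts z" for w
      using near[OF that z'] card_rts(1)[OF zp] by (auto simp: Suc_le_eq card_gt_0_iff)
    have "(\<Sum>w\<in>rts z. card (?B w)) = card (\<Union>w\<in>rts z. ?B w)"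
      using card_rts(1)[OF zp] card_rts(1)[OF z] disj
      by (intro card_UN_disjoint[symmetric]) blast+
    also have "\<dots> \<le> card (rts z')" using card_rts(1)[OF zp] by (intro card_mono) auto
    also have "\<dots> = (\<Sum>w\<in>rts z. 1)" using card_rts(2)[OF zp] card_rts(2)[OF z] by simp
    finally have le: "(\<Sum>w\<in>rts z. card (?B w)) \<le> (\<Sum>w\<in>rts z. 1)" .
    have eq1: "card (?B w) = 1" if "w \<in> rts z" for w
    proof (rule ccontr)
      assume "card (?B w) \<noteq> 1"
      hence "1 < card (?B w)" using ge[OF that] by simp
      hence "(\<Sum>w\<in>rts z. 1) < (\<Sum>w\<in>rts z. card (?B w))"
        using that ge card_rts(1)[OF z] by (intro sum_strict_mono_ex1) auto
      with le show False by simp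
    qed
    have "card (\<Union>w\<in>rts z. ?B w) = (\<Sum>w\<in>rts z. card (?B w))"
      using card_rts(1)[OF zp] card_rts(1)[OF z] disj
      by (intro card_UN_disjoint) blast+
    also have "\<dots> = card (rts z')" using eq1 card_rts(2)[OF zp] card_rts(2)[OF z] by simp
    finally have "(\<Union>w\<in>rts z. ?B w) = rts z'"
      using card_rts(1)[OF zp] by (intro card_subset_eq) auto
    thus ?thesis using eq1 w by blast
  qed
  define sheet where "sheet w = curve \<inter> (ball z \<delta> \<times> ball w \<eta>)" for w
  show ?thesis
  proof (intro exI[of _ T] conjI exI[of _ "sheet ` rts z"] ballI)
    show "z \<in> T" using z \<delta>(1) by (simp add: T_def)
    show "openin (top_of_set pdisc) T" unfolding T_def by (intro openin_open_Int) simp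
    show "\<Union> (sheet ` rts z) = curve \<inter> fst -` T"
    proof -
      obtain w0 where w0: "w0 \<in> rts z"
        using card_rts[OF z] deg by (metis card.empty ex_in_conv not_one_le_zero)
      have mem: "(a, b) \<in> \<Union> (sheet ` rts z) \<longleftrightarrow> (a, b) \<in> curve \<inter> fst -` T" for a b
      proof
        assume "(a, b) \<in> curve \<inter> fst -` T"
        hence ab: "a \<in> T" "b \<in> rts a" "a \<in> pdisc" by (auto simp: curve_def)
        then obtain w where "w \<in> rts z" "b \<in> ball w \<eta>" using uniq[OF w0, of a] by blast
        thus "(a, b) \<in> \<Union> (sheet ` rts z)"
          using ab by (auto simp: sheet_def curve_def T_def)
      qed (auto simp: sheet_def curve_def T_def)
      show ?thesis
      proof (rule Set.set_eqI)
        fix x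
        show "x \<in> \<Union> (sheet ` rts z) \<longleftrightarrow> x \<in> curve \<inter> fst -` T"
          using mem[of "fst x" "snd x"] by simp
      qed
    qed
    show "disjoint (sheet ` rts z)"
      unfolding disjoint_def sheet_def using disj by blast
    fix u assume "u \<in> sheet ` rts z"
    then obtain w where w: "w \<in> rts z" and u: "u = sheet w" by blast
    show "openin (top_of_set curve) u" unfolding u sheet_def
      by (intro openin_open_Int open_Times) auto
    define s where "s z' = the_elem (rts z' \<inter> ball w \<eta>)" for z'
    have s: "rts z' \<inter> ball w \<eta> = {s z'}" if "z' \<in> T" for z'
    proof -
      obtain b where "rts z' \<inter> ball w \<eta> = {b}"
        using uniq[OF w \<open>z' \<in> T\<close>] card_1_singletonE by blast
      thus ?thesis by (simp add: s_def)
    qed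
    have s_in: "s z' \<in> rts z'" "s z' \<in> ball w \<eta>" if "z' \<in> T" for z'
      using s[OF that] by blast+
    have s_eq: "x = s z'" if "z' \<in> T" "x \<in> rts z'" "x \<in> ball w \<eta>" for x z'
      using s[OF that(1)] that(2,3) by blast
    have "homeomorphism u T fst (\<lambda>z'. (z', s z'))"
    proof (rule homeomorphismI)
      show "continuous_on u fst" by (intro continuous_intros)
      show "continuous_on T (\<lambda>z'. (z', s z'))"
      proof (intro continuous_intros)
        show "continuous_on T s" unfolding continuous_on_iff
        proof (intro ballI allI impI)
          fix z1 e assume z1: "z1 \<in> T" and e: "(0::real) < e"
          have s1: "s z1 \<in> rts z1" "s z1 \<in> ball w \<eta>" using s[OF z1] by auto
          define e' where "e' = min e (\<eta> - dist w (s z1))"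
          have e': "0 < e'" using e s1 by (simp add: e'_def)
          from rts_nearby[OF _ s1(1) e'] z1 obtain \<delta>' where \<delta>': "0 < \<delta>'"
            "\<And>z'. z' \<in> pdisc \<inter> ball z1 \<delta>' \<Longrightarrow> \<exists>w'\<in>rts z'. dist (s z1) w' < e'"
            by (auto simp: T_def)
          show "\<exists>d>0. \<forall>x'\<in>T. dist x' z1 < d \<longrightarrow> dist (s x') (s z1) < e"
          proof (intro exI[of _ \<delta>'] conjI ballI impI \<delta>'(1))
            fix x assume x: "x \<in> T" "dist x z1 < \<delta>'"
            then obtain w' where w': "w' \<in> rts x" "dist (s z1) w' < e'"
              using \<delta>'(2)[of x] by (auto simp: T_def dist_commute)
            have "dist w w' < \<eta>"
            proof -
              have "e' \<le> \<eta> - dist w (s z1)" by (simp add: e'_def)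
              thus ?thesis using dist_triangle[of w w' "s z1"] w'(2) by linarith
            qed
            hence "w' \<in> rts x \<inter> ball w \<eta>" using w'(1) by simp
            hence "w' = s x" unfolding s[OF x(1)] by simp
            moreover have "e' \<le> e" by (simp add: e'_def)
            ultimately show "dist (s x) (s z1) < e" using w'(2) by (simp add: dist_commute)
          qed
        qed
      qed
      show "fst ` u \<subseteq> T" unfolding u sheet_def T_def curve_def by auto
      show "(\<lambda>z'. (z', s z')) ` T \<subseteq> u"
        using s_in unfolding u sheet_def curve_def T_def by blast
      show "(fst x, s (fst x)) = x" if "x \<in> u" for x
      proof -
        have "fst x \<in> T" "snd x \<in> rts (fst x)" "snd x \<in> ball w \<eta>"
          using that unfolding u sheet_def curve_def T_def by auto
        from s_eq[OF this] show ?thesis by (simp add: prod_eq_iff)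
      qed
      show "\<And>y. y \<in> T \<Longrightarrow> fst (y, s y) = y" by simp
    qed
    thus "\<exists>q. homeomorphism u T fst q" by blast
  qed
qed

lemma covering: "covering_space curve fst pdisc"
  unfolding covering_space_def
proof (intro conjI ballI)
  show "continuous_on curve fst" by (intro continuous_intros)
  show "fst ` curve = pdisc"
  proof
    show "pdisc \<subseteq> fst ` curve"
    proof
      fix z assume z: "z \<in> pdisc"
      then obtain w0 where "w0 \<in> rts z"
        using card_rts[OF z] deg by (metis card.empty ex_in_conv not_one_le_zero)
      thus "z \<in> fst ` curve" using z by (force simp: curve_def)
    qed
  qed (auto simp: curve_def)
qed (rule evenly_covered)

definition hplane :: "complex set" where "hplane = {s. Re s < ln r}"

lemma hplane: "convex hplane" "open hplane"
  unfolding hplane_def by (rule convex_halfspace_Re_lt, rule open_halfspace_Re_lt)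

lemma exp_hplane: "s \<in> hplane \<Longrightarrow> exp s \<in> pdisc"
  using r_pos exp_less_cancel_iff[of "Re s" "ln r"] by (simp add: hplane_def pdisc_def)

lemma lift_exists:
  assumes s0: "s0 \<in> hplane" and w0: "w0 \<in> rts (exp s0)"
  obtains w where "continuous_on hplane w" "w s0 = w0" "\<And>s. s \<in> hplane \<Longrightarrow> w s \<in> rts (exp s)"
proof -
  have a: "(exp s0, w0) \<in> curve" using exp_hplane[OF s0] w0 by (simp add: curve_def)
  have cont: "continuous_on hplane (exp :: complex \<Rightarrow> complex)" by (intro continuous_intros)
  obtain g where g: "continuous_on hplane g" "g \<in> hplane \<rightarrow> curve" "g s0 = (exp s0, w0)"
    "\<And>y. y \<in> hplane \<Longrightarrow> fst (g y) = exp y"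
    by (rule covering_space_lift_strong[OF covering a s0
          convex_imp_simply_connected[OF hplane(1)] convex_imp_locally_path_connected[OF hplane(1)] cont])
       (use exp_hplane in auto)
  show ?thesis
  proof (rule that[of "snd \<circ> g"])
    show "continuous_on hplane (snd \<circ> g)"
      using g(1) by (auto intro!: continuous_intros simp: comp_def)
    show "\<And>s. s \<in> hplane \<Longrightarrow> (snd \<circ> g) s \<in> rts (exp s)"
    proof -
      fix s assume s: "s \<in> hplane"
      hence "g s \<in> curve" using g(2) by blast
      thus "(snd \<circ> g) s \<in> rts (exp s)" using g(4)[OF s] by (auto simp: curve_def)
    qed
  qed (use g(3) in simp)
qed

text \<open>Along a continuous root function the difference quotient is minus the quotient in \<open>s\<close> of
  \<open>R(exp s, w)\<close>, divided by the divided difference in \<open>w\<close>, whose limit is not zero because the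
  root is simple.\<close>
lemma lift_holomorphic:
  assumes cont: "continuous_on hplane w" and w: "\<And>s. s \<in> hplane \<Longrightarrow> w s \<in> rts (exp s)"
  shows "w holomorphic_on hplane"
proof -
  have "\<exists>D. (w has_field_derivative D) (at s)" if s: "s \<in> hplane" for s
  proof -
    define H where "H t = divdiff R (exp t) (w t) (w s)" for t
    have contH: "continuous_on hplane H" unfolding H_def
      by (intro continuous_divdiff continuous_intros cont)
    have H0: "H s \<noteq> 0" unfolding H_def divdiff_same
      using simple[of "exp s" "w s"] exp_hplane[OF s] w[OF s] by (simp add: pdisc_def rts_def)
    have "isCont H s" using contH s hplane(2) continuous_on_eq_continuous_at by blast
    hence limH: "(H \<longlongrightarrow> H s) (at s)" by (simp add: isCont_def)
    have "(\<lambda>t. beval R (exp t) (w s)) field_differentiable at s"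
    proof -
      have "(\<lambda>t. beval R (exp t) (w s)) holomorphic_on UNIV"
        unfolding beval_altdef ceval_def by (intro holomorphic_intros)
      thus ?thesis by (simp add: holomorphic_on_def)
    qed
    then obtain D where D: "((\<lambda>t. beval R (exp t) (w s)) has_field_derivative D) (at s)"
      by (auto simp: field_differentiable_def)
    have "beval R (exp s) (w s) = 0" using w[OF s] by (simp add: rts_def)
    with D have "((\<lambda>t. beval R (exp t) (w s) / (t - s)) \<longlongrightarrow> D) (at s)"
      by (simp add: has_field_derivative_iff)
    hence lim: "((\<lambda>t. - (beval R (exp t) (w s) / (t - s)) / H t) \<longlongrightarrow> - D / H s) (at s)"
      using limH H0 by (intro tendsto_intros)
    have "eventually (\<lambda>t. t \<in> hplane) (at s)"
      using s hplane(2) by (intro eventually_at_in_open')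
    moreover have "eventually (\<lambda>t. H t \<noteq> 0) (at s)"
      using limH H0 by (rule tendsto_imp_eventually_ne)
    moreover have "eventually (\<lambda>t. t \<noteq> s) (at s)" by (simp add: eventually_at_filter)
    ultimately have "eventually (\<lambda>t. - (beval R (exp t) (w s) / (t - s)) / H t = (w t - w s) / (t - s)) (at s)"
    proof eventually_elim
      case (elim t)
      have "beval R (exp t) (w t) = 0" using w[OF elim(1)] by (simp add: rts_def)
      with beval_diff[of R "exp t" "w t" "w s"]
      have "- beval R (exp t) (w s) = (w t - w s) * H t" by (simp add: H_def)
      with elim(2,3) show ?case by (simp add: field_simps)
    qed
    with lim have "((\<lambda>t. (w t - w s) / (t - s)) \<longlongrightarrow> - D / H s) (at s)"
      using tendsto_cong by fast
    thus ?thesis by (auto simp: has_field_derivative_iff)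
  qed
  thus ?thesis by (meson field_differentiable_at_within field_differentiable_def holomorphic_onI)
qed

text \<open>In the half-plane, \<open>n\<close> turns of \<open>\<lambda> = exp s\<close> around \<open>0\<close>.\<close>
definition turn :: "nat \<Rightarrow> complex \<Rightarrow> complex" where
  "turn n s = s + of_nat n * (2 * of_real pi * \<i>)"

lemma turn: "turn n s \<in> hplane \<longleftrightarrow> s \<in> hplane" "exp (turn n s) = exp s"
  "turn m (turn n s) = turn (m + n) s" "turn 0 s = s"
proof -
  have "exp (of_nat n * (2 * of_real pi * \<i>)) = (1 :: complex)"
    by (metis exp_of_nat_mult exp_two_pi_i power_one)
  thus "exp (turn n s) = exp s" by (simp add: turn_def exp_add)
qed (simp_all add: turn_def hplane_def algebra_simps)

lemma turn_agree:
  assumes cont: "continuous_on hplane w" and w: "\<And>s. s \<in> hplane \<Longrightarrow> w s \<in> rts (exp s)"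
    and s0: "s0 \<in> hplane" and eq: "w (turn m s0) = w (turn n s0)" and s: "s \<in> hplane"
  shows "w (turn m s) = w (turn n s)"
proof -
  have cont_turn: "continuous_on hplane (\<lambda>s. w (turn m s))" for m
  proof -
    have "continuous_on hplane (turn m)" unfolding turn_def by (intro continuous_intros)
    from continuous_on_compose2[OF cont this] show ?thesis using turn(1) by blast
  qed
  have root_turn: "beval R (exp x) (w (turn m x)) = 0" if "x \<in> hplane" for x m
    using w[of "turn m x"] that by (simp add: turn rts_def)
  have simple_exp: "beval (pderiv R) (exp x) b \<noteq> 0" if "x \<in> hplane" "beval R (exp x) b = 0" for x b
    using simple exp_hplane[OF that(1)] that(2) by (auto simp: pdisc_def)
  have "continuous_on hplane (exp :: complex \<Rightarrow> complex)" by (intro continuous_intros)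
  from root_function_unique[OF convex_connected[OF hplane(1)] this cont_turn cont_turn
      root_turn root_turn simple_exp s0 eq s]
  show ?thesis .
qed

text \<open>The roots over \<open>exp s0\<close> are finitely many, so two turns bring the lift to the same root and
  their difference is a period. For the smallest period the determinations are pairwise distinct,
  which later bounds it by the degree of any polynomial that vanishes along the lift.\<close>
lemma period_exists:
  assumes cont: "continuous_on hplane w" and w: "\<And>s. s \<in> hplane \<Longrightarrow> w s \<in> rts (exp s)"
    and s0: "s0 \<in> hplane"
  obtains N :: nat where "1 \<le> N" "\<And>s. s \<in> hplane \<Longrightarrow> w (turn N s) = w s"
    "inj_on (\<lambda>j. w (turn j s0)) {..<N}"
proof -
  define per where "per n \<longleftrightarrow> 1 \<le> n \<and> w (turn n s0) = w s0" for n
  have perI: "per (n - m)" if "m < n" "w (turn m s0) = w (turn n s0)" for m n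
  proof -
    have "w (turn m s) = w (turn n s)" if "s \<in> hplane" for s
      using turn_agree[OF cont w s0 _ that] \<open>w (turn m s0) = w (turn n s0)\<close> by blast
    \<comment> \<open>Turning back first, so that the two agreeing turns become \<open>0\<close> and \<open>n - m\<close>.\<close>
    moreover define s1 where "s1 = s0 - of_nat m * (2 * of_real pi * \<i>)"
    have "s1 \<in> hplane" using s0 by (simp add: s1_def hplane_def)
    moreover have "turn m s1 = s0" "turn n s1 = turn (n - m) s0"
      using that(1) by (simp_all add: turn_def s1_def of_nat_diff algebra_simps)
    ultimately show ?thesis using that(1) by (metis One_nat_def Suc_leI per_def zero_less_diff)
  qed
  have "(\<lambda>j. w (turn j s0)) ` UNIV \<subseteq> rts (exp s0)"
    using w[of "turn _ s0"] s0 by (auto simp: turn)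
  hence "finite (range (\<lambda>j. w (turn j s0)))"
    using card_rts(1)[OF exp_hplane[OF s0]] by (rule finite_subset)
  hence "\<not> inj (\<lambda>j. w (turn j s0))" using finite_imageD by fastforce
  then obtain m n where "m < n" "w (turn m s0) = w (turn n s0)"
    unfolding inj_def by (metis linorder_neqE_nat)
  hence "\<exists>n. per n" using perI by blast
  define N where "N = (LEAST n. per n)"
  have N: "per N" unfolding N_def using \<open>\<exists>n. per n\<close> by (rule LeastI_ex)
  show ?thesis
  proof (rule that[of N])
    show "1 \<le> N" using N by (simp add: per_def)
    show "w (turn N s) = w s" if "s \<in> hplane" for s
      using turn_agree[OF cont w s0 _ that, of N 0] N by (simp add: per_def turn)
    show "inj_on (\<lambda>j. w (turn j s0)) {..<N}"
    proof (rule linorder_inj_onI)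
      fix i j assume ij: "i < j" "i \<in> {..<N}" "j \<in> {..<N}"
      have "\<not> per (j - i)" using ij unfolding N_def by (intro not_less_Least) auto
      thus "w (turn i s0) \<noteq> w (turn j s0)" using perI ij(1) by blast
    qed auto
  qed
qed

text \<open>Multiplied by the leading coefficient, the roots become integral over \<open>\<complex>[\<lambda>]\<close>, hence bounded
  on bounded sets.\<close>
lemma root_growth:
  obtains K where "\<And>z w. z \<in> pdisc \<Longrightarrow> w \<in> rts z \<Longrightarrow> norm (ceval z (lead_coeff R) * w) \<le> K"
proof -
  have "\<exists>B. \<forall>z\<in>cball 0 r. norm (ceval z (coeff R i)) \<le> B" for i
  proof -
    have "compact ((\<lambda>z. ceval z (coeff R i)) ` cball 0 r)"
      by (intro compact_continuous_image continuous_ceval continuous_intros) auto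
    thus ?thesis by (auto simp: compact_eq_bounded_closed bounded_iff)
  qed
  then obtain B where B: "\<And>i z. z \<in> cball 0 r \<Longrightarrow> norm (ceval z (coeff R i)) \<le> B i" by metis
  have "0 \<in> cball (0::complex) r" using r_pos by simp
  hence B0: "0 \<le> B i" for i by (rule order_trans[OF norm_ge_zero B])
  show ?thesis
  proof (rule that[of "\<Sum>i\<le>degree R. B i"])
    fix z w assume z: "z \<in> pdisc" and w: "w \<in> rts z"
    have zr: "z \<in> cball 0 r" using z by (simp add: pdisc_def)
    have sumB: "(\<Sum>i\<le>degree R. B i) = (\<Sum>i<degree R. B i) + B (degree R)"
      by (simp add: lessThan_Suc_atMost[symmetric])
    have sB0: "0 \<le> (\<Sum>i<degree R. B i)" by (intro sum_nonneg B0)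
    let ?a = "ceval z (lead_coeff R)"
    show "norm (?a * w) \<le> (\<Sum>i\<le>degree R. B i)"
    proof (cases "norm w \<le> 1")
      case True
      hence "norm (?a * w) \<le> norm ?a" by (simp add: norm_mult mult_left_le)
      also have "\<dots> \<le> B (degree R)" by (rule B[OF zr])
      finally show ?thesis using sumB sB0 by linarith
    next
      case False
      have "(\<Sum>i<degree R. ceval z (coeff R i) * w ^ i) + ?a * w ^ degree R = 0"
        using w by (simp add: rts_def beval_altdef lessThan_Suc_atMost[symmetric])
      hence "?a * w ^ degree R = - (\<Sum>i<degree R. ceval z (coeff R i) * w ^ i)"
        by (simp add: add_eq_0_iff2 add.commute)
      hence "norm (?a * w ^ degree R) = norm (\<Sum>i<degree R. ceval z (coeff R i) * w ^ i)"
        by (simp only: norm_minus_cancel)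
      also have "\<dots> \<le> (\<Sum>i<degree R. B i * norm w ^ (degree R - 1))"
      proof (rule sum_norm_le)
        fix i assume "i \<in> {..<degree R}"
        thus "norm (ceval z (coeff R i) * w ^ i) \<le> B i * norm w ^ (degree R - 1)"
          unfolding norm_mult norm_power using False B0
          by (intro mult_mono B[OF zr] power_increasing) auto
      qed
      also have "\<dots> = (\<Sum>i<degree R. B i) * norm w ^ (degree R - 1)"
        by (simp add: sum_distrib_right)
      finally have "norm (?a * w ^ degree R) \<le> (\<Sum>i<degree R. B i) * norm w ^ (degree R - 1)" .
      moreover have "norm (?a * w ^ degree R) = norm (?a * w) * norm w ^ (degree R - 1)"
        using deg by (cases "degree R") (simp_all add: norm_mult norm_power)
      moreover have "0 < norm w ^ (degree R - 1)" using False by (intro zero_less_power) linarith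
      ultimately have "norm (?a * w) \<le> (\<Sum>i<degree R. B i)"
        by (metis mult_right_le_imp_le)
      thus ?thesis using sumB B0[of "degree R"] by linarith
    qed
  qed
qed

text \<open>A lift with period \<open>2 \<pi> \<i> N\<close> is a function of \<open>t = exp (s / N)\<close>. By the growth estimate the
  product with the leading coefficient extends over \<open>t = 0\<close>; as a polynomial in \<open>\<lambda> = t\<^sup>N\<close> the
  leading coefficient is a power of \<open>t\<close> times a factor without zeros.\<close>
lemma lift_meromorphic:
  assumes cont: "continuous_on hplane w" and w: "\<And>s. s \<in> hplane \<Longrightarrow> w s \<in> rts (exp s)"
    and N: "1 \<le> N" and per: "\<And>s. s \<in> hplane \<Longrightarrow> w (turn N s) = w s"
  obtains \<psi> M where "\<psi> holomorphic_on ball 0 (r powr (1 / real N))"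
    "\<And>l. 0 < l \<Longrightarrow> l < r \<Longrightarrow>
      w (of_real (ln l)) = \<psi> (of_real (l powr (1 / real N))) / of_real (l powr (1 / real N)) ^ M"
proof -
  define \<rho> where "\<rho> = r powr (1 / real N)"
  have \<rho>: "0 < \<rho>" "\<rho> ^ N = r" using r_pos N by (simp_all add: \<rho>_def powr_realpow[symmetric] powr_powr)
  have pow_less: "norm (t ^ N) < r" if "norm t < \<rho>" for t :: complex
    using power_strict_mono[OF that, of N] N \<rho> by (simp add: norm_power)
  have to_hplane: "of_nat N * L \<in> hplane" if L: "exp L = t" "norm t < \<rho>" for t L :: complex
  proof -
    have "norm (exp (of_nat N * L)) < r" using pow_less[of t] L by (simp add: exp_of_nat_mult)
    hence "exp (Re (of_nat N * L)) < exp (ln r)" using r_pos by (simp del: Re_complex_of_real)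
    thus ?thesis by (simp add: hplane_def)
  qed
  define h where "h t = w (of_nat N * Ln t)" for t
  have per_mult: "w (turn (n * N) s) = w s" if "s \<in> hplane" for n s
  proof (induction n)
    case (Suc n)
    have "w (turn (Suc n * N) s) = w (turn N (turn (n * N) s))" by (simp add: turn)
    also have "\<dots> = w (turn (n * N) s)" using that by (intro per) (simp add: turn)
    finally show ?case using Suc by simp
  qed (simp add: turn)
  have h_log: "h t = w (of_nat N * L)" if L: "exp L = t" "norm t < \<rho>" for t L
  proof -
    have t0: "t \<noteq> 0" using L by auto
    have "exp (Ln t) = exp L" using L t0 by simp
    then obtain k :: int where k: "Ln t = L + of_int (2 * k) * of_real pi * \<i>"
      unfolding exp_eq by auto
    have inH: "of_nat N * L \<in> hplane" "of_nat N * Ln t \<in> hplane"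
      using to_hplane[OF L] to_hplane[of "Ln t" t] L t0 by auto
    show ?thesis
    proof (cases "0 \<le> k")
      case True
      have "of_nat N * Ln t = turn (nat k * N) (of_nat N * L)"
        using True by (simp add: k turn_def algebra_simps)
      thus ?thesis using per_mult[OF inH(1)] by (simp add: h_def)
    next
      case False
      have "of_nat N * L = turn (nat (- k) * N) (of_nat N * Ln t)"
        using False by (simp add: k turn_def algebra_simps)
      thus ?thesis using per_mult[OF inH(2), of "nat (- k)"] by (simp add: h_def)
    qed
  qed
  have hol_w: "w holomorphic_on hplane" by (rule lift_holomorphic[OF cont w])
  have hol_h: "h holomorphic_on ball 0 \<rho> - {0}"
  proof -
    have "h field_differentiable at t" if t: "t \<in> ball 0 \<rho> - {0}" for t
    proof -
      \<comment> \<open>A branch of the logarithm that is holomorphic near \<open>t\<close>, also if \<open>t\<close> is negative.\<close>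
      define L where "L x = Ln (x / t) + Ln t" for x
      have t0: "t \<noteq> 0" using t by auto
      have expL: "exp (L x) = x" if "x \<noteq> 0" for x using that t0 by (simp add: L_def exp_add)
      have "w field_differentiable at (of_nat N * L t)"
        using hol_w hplane(2) to_hplane[of "L t" t] expL[of t] t
        by (auto simp: holomorphic_on_open field_differentiable_def)
      moreover have "(\<lambda>x. of_nat N * L x) field_differentiable at t"
        unfolding L_def using t0
        by (intro derivative_intros field_differentiable_at_Ln field_differentiable_compose[of "\<lambda>x. x / t" _ Ln, unfolded o_def]) auto
      ultimately have "(w \<circ> (\<lambda>x. of_nat N * L x)) field_differentiable at t"
        by (intro field_differentiable_compose)
      moreover have "eventually (\<lambda>x. (w \<circ> (\<lambda>x. of_nat N * L x)) x = h x) (nhds t)"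
      proof -
        have "eventually (\<lambda>x. x \<in> ball 0 \<rho> - {0}) (nhds t)"
          using t by (intro eventually_nhds_in_open) auto
        thus ?thesis
        proof eventually_elim
          case (elim x)
          thus ?case using h_log[of "L x" x] expL[of x] by simp
        qed
      qed
      ultimately show ?thesis
        unfolding field_differentiable_def using DERIV_cong_ev by blast
    qed
    thus ?thesis by (simp add: holomorphic_on_def field_differentiable_at_within)
  qed
  obtain m q where q: "lead_coeff R = [:0, 1:] ^ m * q" "poly q 0 \<noteq> 0"
  proof -
    have "lead_coeff R \<noteq> 0" using deg by auto
    from order_decomp[OF this, of 0] show ?thesis using that by (auto simp: dvd_iff_poly_eq_0)
  qed
  interpret hc: comm_ring_hom "ceval z" for z by (rule ceval_hom)
  have at_X: "ceval z [:0, 1:] = z" for z by (simp add: ceval_def)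
  have lc_eq: "ceval z (lead_coeff R) = z ^ m * ceval z q" for z
    by (simp add: q(1) hc.hom_mult hc.hom_power at_X)
  have q_nz: "ceval (t ^ N) q \<noteq> 0" if "t \<in> ball 0 \<rho>" for t
  proof (cases "t = 0")
    case True
    thus ?thesis using q(2) N ceval_of_real[of 0 q] by (simp add: power_0_left)
  next
    case False
    thus ?thesis using lc[of "t ^ N"] pow_less[of t] that unfolding lc_eq by auto
  qed
  define \<phi> where "\<phi> t = ceval (t ^ N) (lead_coeff R) * h t" for t
  have at_hol: "(\<lambda>t. ceval (t ^ N) c) holomorphic_on A" for c A
    unfolding ceval_def by (intro holomorphic_intros)
  have "\<phi> holomorphic_on ball 0 \<rho> - {0}" unfolding \<phi>_def by (intro holomorphic_intros at_hol hol_h)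
  moreover obtain K where K: "\<And>z w. z \<in> pdisc \<Longrightarrow> w \<in> rts z \<Longrightarrow> norm (ceval z (lead_coeff R) * w) \<le> K"
    using root_growth by blast
  have "norm (\<phi> t) \<le> K" if t: "t \<in> ball 0 \<rho> - {0}" for t
  proof -
    have "h t \<in> rts (t ^ N)" using w[OF to_hplane[of "Ln t" t]] t
      by (simp add: h_def exp_of_nat_mult)
    moreover have "t ^ N \<in> pdisc" using pow_less[of t] t by (simp add: pdisc_def)
    ultimately show ?thesis unfolding \<phi>_def by (intro K)
  qed
  hence "eventually (\<lambda>t. norm (\<phi> t) \<le> K) (at 0)"
    using \<rho>(1) unfolding eventually_at by (intro exI[of _ \<rho>]) (auto simp: dist_norm)
  ultimately obtain g where g: "g holomorphic_on ball 0 \<rho>" "\<And>z. z \<in> ball 0 \<rho> - {0} \<Longrightarrow> g z = \<phi> z"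
    using holomorphic_on_extend_bounded[of \<phi> "ball 0 \<rho>" 0] \<rho>(1) by auto
  show ?thesis
  proof (rule that[of "\<lambda>t. g t / ceval (t ^ N) q" "N * m"])
    show "(\<lambda>t. g t / ceval (t ^ N) q) holomorphic_on ball 0 (r powr (1 / real N))"
      using q_nz unfolding \<rho>_def[symmetric] by (intro holomorphic_intros g(1) at_hol) auto
    fix l :: real assume l: "0 < l" "l < r"
    define t where "t = complex_of_real (l powr (1 / real N))"
    have "l powr (1 / real N) < \<rho>" unfolding \<rho>_def using l N by (intro powr_less_mono2) auto
    hence t: "t \<in> ball 0 \<rho> - {0}" "t \<noteq> 0" using l by (auto simp: t_def)
    have "t = exp (of_real (ln l / real N))"
      using l by (simp add: t_def powr_def exp_of_real[symmetric])
    hence "h t = w (of_real (ln l))"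
      using h_log[of "of_real (ln l / real N)" t] t N by simp
    moreover have "g t = t ^ (N * m) * ceval (t ^ N) q * h t"
      using g(2)[OF t(1)] unfolding \<phi>_def lc_eq by (simp add: power_mult)
    ultimately show "w (of_real (ln l)) =
        g (of_real (l powr (1 / real N))) / ceval (of_real (l powr (1 / real N)) ^ N) q
          / of_real (l powr (1 / real N)) ^ (N * m)"
      unfolding t_def[symmetric] using q_nz[of t] t by simp
  qed
qed

end

lemma puiseux_onI:
  assumes hol: "\<psi> holomorphic_on ball 0 (r powr (1 / real N))" and N: "1 \<le> N"
    and f: "\<And>l. 0 < l \<Longrightarrow> l < r \<Longrightarrow>
      f l = \<psi> (of_real (l powr (1 / real N))) / of_real (l powr (1 / real N)) ^ M"
  shows "puiseux_on r f"
  unfolding puiseux_on_def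
proof (intro exI[of _ N] exI[of _ "- int M"] exI[of _ "\<lambda>n. (deriv ^^ n) \<psi> 0 / fact n"] conjI ballI N)
  fix l assume "l \<in> {0<..<r}"
  hence l: "0 < l" "l < r" by auto
  define t where "t = l powr (1 / real N)"
  have t0: "0 < t" using l by (simp add: t_def)
  have "t < r powr (1 / real N)" unfolding t_def using l N by (intro powr_less_mono2) auto
  hence "of_real t \<in> ball (0::complex) (r powr (1 / real N))" using t0 by simp
  hence "(\<lambda>n. (deriv ^^ n) \<psi> 0 / fact n * (of_real t - 0) ^ n) sums \<psi> (of_real t)"
    by (rule holomorphic_power_series[OF hol])
  hence "(\<lambda>n. (deriv ^^ n) \<psi> 0 / fact n * (of_real t) ^ n / of_real t ^ M) sums (\<psi> (of_real t) / of_real t ^ M)"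
    by (intro sums_divide) simp
  moreover have "l powr (real_of_int (- int M + int n) / real N) = t ^ n / t ^ M" for n
  proof -
    have "l powr (real_of_int (- int M + int n) / real N) = t powr (real n - real M)"
      by (simp add: t_def powr_powr)
    thus ?thesis using t0 by (simp add: powr_diff powr_realpow)
  qed
  ultimately show "(\<lambda>m. (deriv ^^ m) \<psi> 0 / fact m *
      of_real (l powr (real_of_int (- int M + int m) / real N))) sums f l"
    by (simp add: f[OF l] t_def)
qed

text \<open>Boundedness on the positive axis excludes a pole: the factors \<open>t\<close> of the denominator are
  cancelled one by one, \<open>\<psi>\<close> vanishing at \<open>0\<close> as long as one is left.\<close>
lemma bounded_quotient_limit:
  assumes \<rho>: "0 < \<rho>" and hol: "\<psi> holomorphic_on ball 0 \<rho>"
    and bdd: "\<And>t. 0 < t \<Longrightarrow> t < \<rho> \<Longrightarrow> norm (\<psi> (of_real t) / of_real t ^ M) \<le> B"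
  shows "\<exists>c C \<delta>. 0 < \<delta> \<and> (\<forall>t. 0 < t \<and> t < \<delta> \<longrightarrow> norm (\<psi> (of_real t) / of_real t ^ M - c) \<le> C * t)"
  using hol bdd
proof (induction M arbitrary: \<psi>)
  case 0
  obtain \<psi>' where \<psi>': "(\<psi> has_field_derivative \<psi>') (at 0)"
    using 0(1) \<rho> unfolding holomorphic_on_open[OF open_ball] by (meson centre_in_ball)
  hence "((\<lambda>t. norm ((\<psi> t - \<psi> 0) / t)) \<longlongrightarrow> norm \<psi>') (at 0)"
    by (intro tendsto_norm) (simp add: has_field_derivative_iff)
  hence "eventually (\<lambda>t. norm ((\<psi> t - \<psi> 0) / t) < norm \<psi>' + 1) (at 0)"
    by (rule order_tendstoD) simp
  then obtain \<delta> where \<delta>: "0 < \<delta>" "\<And>t. t \<noteq> 0 \<Longrightarrow> norm t < \<delta> \<Longrightarrow> norm ((\<psi> t - \<psi> 0) / t) < norm \<psi>' + 1"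
    unfolding eventually_at by (auto simp: dist_norm)
  show ?case
  proof (rule exI[of _ "\<psi> 0"], rule exI[of _ "norm \<psi>' + 1"], rule exI[of _ \<delta>], intro conjI allI impI \<delta>(1))
    fix t :: real assume t: "0 < t \<and> t < \<delta>"
    hence "norm (\<psi> (of_real t) - \<psi> 0) / t < norm \<psi>' + 1"
      using \<delta>(2)[of "of_real t"] by (simp add: norm_divide)
    thus "norm (\<psi> (of_real t) / of_real t ^ 0 - \<psi> 0) \<le> (norm \<psi>' + 1) * t"
      using t by (simp add: divide_less_eq)
  qed
next
  case (Suc M)
  have "isCont \<psi> 0" using Suc.prems(1) \<rho>
    by (meson centre_in_ball continuous_on_eq_continuous_at holomorphic_on_imp_continuous_on open_ball)
  hence "((\<lambda>t. \<psi> (of_real t)) \<longlongrightarrow> \<psi> (of_real 0)) (at_right 0)"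
    by (intro isCont_tendsto_compose[of _ \<psi>] tendsto_intros) simp
  moreover have "((\<lambda>t. \<psi> (of_real t)) \<longlongrightarrow> 0) (at_right 0)"
  proof (rule Lim_null_comparison)
    have "eventually (\<lambda>t. t \<in> {0<..<\<rho>}) (at_right (0::real))"
      using \<rho> by (rule eventually_at_right_real)
    thus "eventually (\<lambda>t. norm (\<psi> (of_real t)) \<le> B * t ^ Suc M) (at_right (0::real))"
    proof eventually_elim
      case (elim t)
      hence "norm (\<psi> (of_real t)) / t ^ Suc M \<le> B"
        using Suc.prems(2)[of t] by (simp add: norm_divide norm_mult norm_power)
      thus ?case using elim by (simp add: divide_le_eq)
    qed
    show "((\<lambda>t. B * t ^ Suc M) \<longlongrightarrow> 0) (at_right (0::real))"
      by (auto intro!: tendsto_eq_intros)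
  qed
  ultimately have "\<psi> 0 = 0" using tendsto_unique[of "at_right (0::real)"] by fastforce
  define g where "g z = (if z = 0 then deriv \<psi> 0 else (\<psi> z - \<psi> 0) / (z - 0))" for z
  have "g holomorphic_on ball 0 \<rho>" unfolding g_def
    using pole_lemma_open[OF Suc.prems(1), of 0] by simp
  moreover have g: "\<psi> (of_real t) / of_real t ^ Suc M = g (of_real t) / of_real t ^ M" if "0 < t" for t
    using that \<open>\<psi> 0 = 0\<close> by (simp add: g_def)
  ultimately obtain c C \<delta> where "0 < \<delta>"
    "\<forall>t. 0 < t \<and> t < \<delta> \<longrightarrow> norm (g (of_real t) / of_real t ^ M - c) \<le> C * t"
    using Suc.IH[of g] Suc.prems(2) by (metis (mono_tags))
  thus ?case using g by (metis (no_types, lifting))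
qed

lemma ceval_nonzero_near_0:
  assumes "c \<noteq> 0"
  shows "\<exists>r>0. \<forall>z. 0 < norm z \<and> norm z < r \<longrightarrow> ceval z c \<noteq> 0"
proof -
  have "map_poly complex_of_real c \<noteq> 0" using assms by (simp add: map_poly_eq_0_iff)
  hence "finite {z. ceval z c = 0}" unfolding ceval_def by (rule poly_roots_finite)
  from finite_set_avoid[OF this, of 0] obtain d where "0 < d" "\<And>z. ceval z c = 0 \<Longrightarrow> z \<noteq> 0 \<Longrightarrow> d \<le> dist 0 z"
    by auto
  thus ?thesis by (intro exI[of _ d]) (force simp: dist_norm)
qed

lemma common_radius:
  fixes T :: "real poly set"
  assumes "finite T" "0 \<notin> T"
  shows "\<exists>r>0. \<forall>c\<in>T. \<forall>z. 0 < norm z \<and> norm z < r \<longrightarrow> ceval z c \<noteq> 0"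
proof -
  have "\<Prod>T \<noteq> 0" using assms by auto
  from ceval_nonzero_near_0[OF this] obtain r where r: "0 < r"
    "\<And>z. 0 < norm z \<Longrightarrow> norm z < r \<Longrightarrow> ceval z (\<Prod>T) \<noteq> 0" by blast
  have "ceval z c \<noteq> 0" if "c \<in> T" "0 < norm z" "norm z < r" for c z
  proof -
    interpret h: comm_ring_hom "ceval z" by (rule ceval_hom)
    have "\<Prod>T = c * \<Prod>(T - {c})" using that(1) assms(1) by (simp add: prod.remove)
    thus ?thesis using r(2)[OF that(2,3)] by (auto simp: h.hom_mult)
  qed
  with r(1) show ?thesis by blast
qed

lemma eval2_altdef: "eval2 P l w = (\<Sum>i\<le>degree P. of_real (poly (coeff P i) l) * w ^ i)"
  unfolding eval2_def poly_altdef
  by (rule sum.mono_neutral_cong_left)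
    (auto simp: degree_map_poly_le coeff_map_poly intro: le_degree)

lemma eval2_beval: "eval2 P l w = beval P (of_real l) w"
  by (simp add: eval2_altdef beval_altdef ceval_of_real)

lemma eval2_real_beval: "eval2 P l (w :: real) = 0 \<longleftrightarrow> beval P (of_real l) (of_real w) = 0"
proof -
  have "complex_of_real (eval2 P l w) = beval P (of_real l) (of_real w)"
    by (simp add: eval2_altdef beval_altdef ceval_of_real)
  thus ?thesis by (metis of_real_eq_0_iff)
qed

text \<open>In \<open>l\<^bsup>1/N\<^esup>\<close> the series is a power series times a power; convergence at a larger point gives
  continuity.\<close>
lemma puiseux_on_continuous:
  assumes "puiseux_on \<epsilon> f"
  shows "continuous_on {0<..<\<epsilon>} f"
proof -
  from assms obtain N m0 b where N: "1 \<le> N"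
    and s: "\<And>l. l \<in> {0<..<\<epsilon>} \<Longrightarrow> (\<lambda>m. b m * of_real (l powr (real_of_int (m0 + int m) / real N))) sums f l"
    unfolding puiseux_on_def by blast
  define \<tau> where "\<tau> l = l powr (1 / real N)" for l
  have pw: "l powr (real_of_int (m0 + int m) / real N) = \<tau> l powr real_of_int m0 * \<tau> l ^ m" if "0 < l" for l m
    using that N by (simp add: \<tau>_def powr_powr powr_realpow[symmetric] powr_add[symmetric] add_divide_distrib)
  define g where "g z = (\<Sum>m. b m * z ^ m)" for z
  have sg: "(\<lambda>m. b m * of_real (\<tau> l) ^ m) sums (f l / of_real (\<tau> l powr real_of_int m0))" if l: "l \<in> {0<..<\<epsilon>}" for l
  proof -
    have nz: "\<tau> l powr real_of_int m0 \<noteq> 0" using l by (simp add: \<tau>_def)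
    have "(\<lambda>m. b m * of_real (l powr (real_of_int (m0 + int m) / real N)) / of_real (\<tau> l powr real_of_int m0))
        sums (f l / of_real (\<tau> l powr real_of_int m0))"
      by (intro sums_divide s l)
    moreover have "b m * of_real (l powr (real_of_int (m0 + int m) / real N)) / of_real (\<tau> l powr real_of_int m0)
        = b m * of_real (\<tau> l) ^ m" for m
      using pw[of l m] l nz by simp
    ultimately show ?thesis by simp
  qed
  have f: "f l = of_real (\<tau> l powr real_of_int m0) * g (of_real (\<tau> l))" if l: "l \<in> {0<..<\<epsilon>}" for l
  proof -
    have nz: "complex_of_real (\<tau> l powr real_of_int m0) \<noteq> 0" using l by (simp add: \<tau>_def)
    have "f l / of_real (\<tau> l powr real_of_int m0) = g (of_real (\<tau> l))"
      using sums_unique[OF sg[OF l]] by (simp only: g_def)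
    thus ?thesis using nz by (metis nonzero_divide_eq_eq mult.commute)
  qed
  have cont: "isCont g (of_real (\<tau> l))" if l: "l \<in> {0<..<\<epsilon>}" for l
  proof -
    define l' where "l' = (l + \<epsilon>) / 2"
    have l': "l' \<in> {0<..<\<epsilon>}" "l < l'" using l by (auto simp: l'_def)
    have "\<tau> l < \<tau> l'" unfolding \<tau>_def using l l' N by (intro powr_less_mono2) auto
    hence "norm (complex_of_real (\<tau> l)) < norm (complex_of_real (\<tau> l'))" by (simp add: \<tau>_def)
    thus ?thesis unfolding g_def using sums_summable[OF sg[OF l'(1)]] by (intro isCont_powser)
  qed
  have ct: "continuous_on {0<..<\<epsilon>} \<tau>" unfolding \<tau>_def by (intro continuous_intros) auto
  have "continuous_on {0<..<\<epsilon>} (\<lambda>l. g (of_real (\<tau> l)))"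
    by (rule continuous_on_compose2[of "(\<lambda>l. complex_of_real (\<tau> l)) ` {0<..<\<epsilon>}" g])
      (use cont in \<open>auto intro!: continuous_at_imp_continuous_on continuous_intros ct\<close>)
  moreover have "continuous_on {0<..<\<epsilon>} (\<lambda>l. complex_of_real (\<tau> l powr real_of_int m0))"
    by (intro continuous_intros ct) (auto simp: \<tau>_def)
  ultimately have "continuous_on {0<..<\<epsilon>} (\<lambda>l. of_real (\<tau> l powr real_of_int m0) * g (of_real (\<tau> l)))"
    by (intro continuous_on_mult)
  thus ?thesis by (rule continuous_on_eq[OF _ f[symmetric]])
qed

text \<open>Over the punctured disc, the Bezout identity divides the roots of \<open>R\<close> into those of \<open>P\<close> and
  those of \<open>S\<close>; all roots of \<open>P\<close> are among them, and the degree of \<open>P\<close> in \<open>w\<close> does not drop.\<close>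
definition separated_on :: "real \<Rightarrow> real poly poly \<Rightarrow> real poly poly \<Rightarrow> bool" where
  "separated_on r R P \<longleftrightarrow> (\<exists>D S A B c. R = D * S \<and> D dvd P \<and> A * P + B * S = [:c:] \<and>
     (\<forall>z. 0 < norm z \<and> norm z < r \<longrightarrow> ceval z c \<noteq> 0)) \<and>
     (\<forall>z. 0 < norm z \<and> norm z < r \<longrightarrow> ceval z (lead_coeff P) \<noteq> 0) \<and>
     (\<forall>z w. beval P z w = 0 \<longrightarrow> beval R z w = 0)"

lemma root_function_separated:
  fixes e u :: "'a::topological_space \<Rightarrow> complex"
  assumes sep: "separated_on r R P" and X: "connected X" and e: "continuous_on X e" and u: "continuous_on X u"
    and er: "\<And>x. x \<in> X \<Longrightarrow> 0 < norm (e x) \<and> norm (e x) < r"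
    and ru: "\<And>x. x \<in> X \<Longrightarrow> beval R (e x) (u x) = 0"
    and x0: "x0 \<in> X" "beval P (e x0) (u x0) = 0" and x: "x \<in> X"
  shows "beval P (e x) (u x) = 0"
proof -
  from sep obtain D S A B c where *: "R = D * S" "D dvd P" "A * P + B * S = [:c:]"
    "\<forall>z. 0 < norm z \<and> norm z < r \<longrightarrow> ceval z c \<noteq> 0" unfolding separated_on_def by blast
  show ?thesis
    by (rule root_function_dichotomy[OF X e u *(1-3) _ ru x0 x]) (use *(4) er in blast)
qed

lemma squarefree_family:
  fixes F :: "real poly poly set"
  assumes F: "finite F" "0 \<notin> F"
  shows "\<exists>R r. 0 < r \<and> r < 1 \<and> (\<forall>P\<in>F. separated_on r R P) \<and> (1 \<le> degree R \<longrightarrow> simple_root_family R r) \<and>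
    (degree R = 0 \<longrightarrow> (\<forall>z w. 0 < norm z \<and> norm z < r \<longrightarrow> beval R z w \<noteq> 0))"
proof -
  obtain R where R: "squarefree R" and FR: "\<And>P. P \<in> F \<Longrightarrow> \<exists>m. P dvd R ^ m"
    using common_squarefree_multiple[OF F] by blast
  have R0: "R \<noteq> 0" using R by (metis not_squarefree_0)
  obtain A0 B0 c0 where c0: "c0 \<noteq> 0" "A0 * R + B0 * pderiv R = [:c0:]"
    using squarefree_bezout_pderiv[OF R] by blast
  have "\<exists>D S A B c. D dvd P \<and> R = D * S \<and> c \<noteq> 0 \<and> A * P + B * S = [:c:]" for P
    by (rule squarefree_bezout_cofactor[OF R])
  then obtain D S A B c where c: "\<And>P. D P dvd P" "\<And>P. R = D P * S P" "\<And>P. c P \<noteq> 0"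
    "\<And>P. A P * P + B P * S P = [:c P:]" by metis
  define T where "T = {c0, lead_coeff R} \<union> c ` F \<union> lead_coeff ` F"
  have "finite T" using F by (simp add: T_def)
  moreover have "0 \<notin> T" using F c0(1) R0 c(3) by (auto simp: T_def)
  ultimately obtain r0 where r0: "0 < r0" "\<And>c z. c \<in> T \<Longrightarrow> 0 < norm z \<Longrightarrow> norm z < r0 \<Longrightarrow> ceval z c \<noteq> 0"
    using common_radius by meson
  define r where "r = min r0 (1 / 2)"
  have r: "0 < r" "r < 1" "r \<le> r0" using r0(1) by (auto simp: r_def)
  have nz: "ceval z c \<noteq> 0" if "c \<in> T" "0 < norm z" "norm z < r" for c z
    using r0(2) that r(3) by force
  have "separated_on r R P" if P: "P \<in> F" for P
    unfolding separated_on_def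
  proof (intro conjI allI impI)
    show "\<exists>D S A B c. R = D * S \<and> D dvd P \<and> A * P + B * S = [:c:] \<and>
     (\<forall>z. 0 < norm z \<and> norm z < r \<longrightarrow> ceval z c \<noteq> 0)"
      using c(1,2,4)[of P] nz[of "c P"] P
      by (intro exI[of _ "D P"] exI[of _ "S P"] exI[of _ "A P"] exI[of _ "B P"] exI[of _ "c P"]) (auto simp: T_def)
    show "ceval z (lead_coeff P) \<noteq> 0" if "0 < norm z \<and> norm z < r" for z
      using nz[of "lead_coeff P" z] that P by (auto simp: T_def)
    fix z w assume "beval P z w = 0"
    moreover obtain m Q where "R ^ m = P * Q" using FR[OF P] by (auto elim: dvdE)
    ultimately have "beval R z w ^ m = 0" by (metis beval_mult beval_power mult_zero_left)
    thus "beval R z w = 0" by (metis power_not_zero)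
  qed
  moreover have "simple_root_family R r" if "1 \<le> degree R"
  proof
    show "ceval z (lead_coeff R) \<noteq> 0" if "0 < norm z" "norm z < r" for z
      using nz[of "lead_coeff R" z] that by (auto simp: T_def)
    fix z w assume z: "0 < norm z" "norm z < r" and w: "beval R z w = 0"
    show "beval (pderiv R) z w \<noteq> 0"
    proof
      assume "beval (pderiv R) z w = 0"
      hence "ceval z c0 = 0" using w arg_cong[OF c0(2), of "\<lambda>P. beval P z w"]
        by (simp add: beval_add beval_mult beval_const)
      thus False using nz[of c0 z] z by (auto simp: T_def)
    qed
  qed (use that r in auto)
  moreover have "beval R z w \<noteq> 0" if "degree R = 0" "0 < norm z" "norm z < r" for z w
    using nz[of "lead_coeff R" z] that by (auto simp: beval_altdef T_def)
  ultimately show ?thesis using r by blast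
qed

context simple_root_family
begin

lemma real_root_unique:
  assumes "continuous_on {0<..<r} f" "continuous_on {0<..<r} g"
    and "\<And>l. l \<in> {0<..<r} \<Longrightarrow> beval R (of_real l) (f l) = 0" "\<And>l. l \<in> {0<..<r} \<Longrightarrow> beval R (of_real l) (g l) = 0"
    and "l0 \<in> {0<..<r}" "f l0 = g l0" and "l \<in> {0<..<r}"
  shows "f l = g l"
proof (rule root_function_unique[of "{0<..<r}" complex_of_real f g R l0])
  show "beval (pderiv R) (complex_of_real x) w \<noteq> 0"
    if "x \<in> {0<..<r}" "beval R (complex_of_real x) w = 0" for x w
    using that by (intro simple) auto
qed (use assms in \<open>auto intro!: continuous_intros\<close>)

text \<open>The lift through \<open>w0\<close> over \<open>ln l0\<close>, restricted to the real axis. If \<open>P\<close> vanishes at its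
  starting point, it vanishes on the whole half-plane by the dichotomy, so that the \<open>N\<close> distinct
  determinations over \<open>l0\<close> are roots of \<open>P(l0, \<cdot>)\<close>.\<close>
lemma puiseux_branch:
  assumes l0: "l0 \<in> {0<..<r}" and w0: "beval R (of_real l0) w0 = 0"
  shows "\<exists>f N \<psi> M. f l0 = w0 \<and> continuous_on {0<..<r} f \<and>
    (\<forall>l\<in>{0<..<r}. beval R (of_real l) (f l) = 0) \<and>
    1 \<le> N \<and> \<psi> holomorphic_on ball 0 (r powr (1 / real N)) \<and>
    (\<forall>l\<in>{0<..<r}. f l = \<psi> (of_real (l powr (1 / real N))) / of_real (l powr (1 / real N)) ^ M) \<and>
    (\<forall>P. separated_on r R P \<longrightarrow> beval P (of_real l0) w0 = 0 \<longrightarrow> N \<le> degree P)"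
proof -
  define s0 where "s0 = complex_of_real (ln l0)"
  have hp: "complex_of_real (ln l) \<in> hplane" "exp (complex_of_real (ln l)) = of_real l" if "l \<in> {0<..<r}" for l
    using that by (auto simp: hplane_def exp_of_real)
  have s0: "s0 \<in> hplane" "exp s0 = of_real l0" using hp[OF l0] by (simp_all add: s0_def)
  have "w0 \<in> rts (exp s0)" using w0 s0(2) by (simp add: rts_def)
  then obtain w where w: "continuous_on hplane w" "w s0 = w0" "\<And>s. s \<in> hplane \<Longrightarrow> w s \<in> rts (exp s)"
    using lift_exists[OF s0(1)] by blast
  obtain N :: nat where N: "1 \<le> N" "\<And>s. s \<in> hplane \<Longrightarrow> w (turn N s) = w s"
    "inj_on (\<lambda>j. w (turn j s0)) {..<N}"
    using period_exists[OF w(1,3) s0(1)] by blast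
  obtain \<psi> M where \<psi>: "\<psi> holomorphic_on ball 0 (r powr (1 / real N))"
    "\<And>l. 0 < l \<Longrightarrow> l < r \<Longrightarrow>
      w (of_real (ln l)) = \<psi> (of_real (l powr (1 / real N))) / of_real (l powr (1 / real N)) ^ M"
    using lift_meromorphic[OF w(1,3) N(1,2)] by blast
  show ?thesis
  proof (rule exI[of _ "\<lambda>l. w (of_real (ln l))"], rule exI[of _ N], rule exI[of _ \<psi>], rule exI[of _ M],
      intro conjI ballI allI impI)
    show "w (of_real (ln l0)) = w0" using w(2) by (simp add: s0_def)
    show "continuous_on {0<..<r} (\<lambda>l. w (of_real (ln l)))"
    proof (rule continuous_on_compose2[OF w(1)])
      show "continuous_on {0<..<r} (\<lambda>l. complex_of_real (ln l))" by (intro continuous_intros) auto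
    qed (use hp in auto)
    show "beval R (of_real l) (w (of_real (ln l))) = 0" if "l \<in> {0<..<r}" for l
      using w(3)[OF hp(1)[OF that]] hp(2)[OF that] by (simp add: rts_def)
    fix P assume sep: "separated_on r R P" and P0: "beval P (of_real l0) w0 = 0"
    let ?p = "map_poly (ceval (of_real l0)) P"
    interpret h: comm_ring_hom "ceval (of_real l0)" by (rule ceval_hom)
    have "coeff ?p (degree P) \<noteq> 0"
      using sep l0 unfolding separated_on_def by (auto simp: coeff_map_poly)
    hence p0: "?p \<noteq> 0" by (metis coeff_0)
    have "beval P (exp s) (w s) = 0" if "s \<in> hplane" for s
    proof (rule root_function_separated[OF sep convex_connected[OF hplane(1)] _ w(1) _ _ s0(1) _ that])
      show "continuous_on hplane (exp :: complex \<Rightarrow> complex)" by (intro continuous_intros)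
      show "beval P (exp s0) (w s0) = 0" using P0 s0(2) w(2) by simp
      show "0 < norm (exp x) \<and> norm (exp x) < r" if "x \<in> hplane" for x
        using exp_hplane[OF that] by (simp add: pdisc_def)
      show "beval R (exp x) (w x) = 0" if "x \<in> hplane" for x using w(3)[OF that] by (simp add: rts_def)
    qed
    from this[of "turn _ s0"] have "poly ?p (w (turn j s0)) = 0" for j
      using s0 by (simp add: turn beval_def)
    hence sub: "(\<lambda>j. w (turn j s0)) ` {..<N} \<subseteq> {x. poly ?p x = 0}" by auto
    have "N = card ((\<lambda>j. w (turn j s0)) ` {..<N})" using N(3) by (simp add: card_image)
    also have "\<dots> \<le> card {x. poly ?p x = 0}" by (rule card_mono[OF poly_roots_finite[OF p0] sub])
    also have "\<dots> \<le> degree ?p" by (rule card_poly_roots_bound[OF p0])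
    also have "\<dots> \<le> degree P" by (rule degree_map_poly_le)
    finally show "N \<le> degree P" .
  qed (use N \<psi> in auto)
qed

end

section \<open>The discounted value and the local games\<close>

lemma game_payoff_sum:
  assumes "x \<in> carrier_vec (dim_row A)" "y \<in> carrier_vec (dim_col A)"
  shows "game_payoff A x y = (\<Sum>i<dim_row A. \<Sum>j<dim_col A. x $ i * y $ j * A $$ (i, j))"
  using assms unfolding game_payoff_def
  by (simp add: scalar_prod_def lessThan_atLeast0 sum_distrib_left mult_ac)

lemma mixed_pmf:
  assumes "x \<in> mixed m"
  obtains p :: "nat pmf" where "set_pmf p \<subseteq> {..<m}" "\<And>i. i < m \<Longrightarrow> pmf p i = x $ i"
proof -
  define f where "f i = (if i < m then x $ i else 0)" for i
  have nn: "0 \<le> f i" for i using assms by (simp add: f_def mixed_def)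
  have "(\<integral>\<^sup>+ i. ennreal (f i) \<partial>count_space UNIV) = (\<integral>\<^sup>+ i. ennreal (f i) * indicator {..<m} i \<partial>count_space UNIV)"
    by (intro nn_integral_cong) (simp add: f_def indicator_def)
  also have "\<dots> = (\<Sum>i<m. ennreal (f i))"
    by (simp add: nn_integral_count_space_indicator[symmetric] nn_integral_count_space_finite)
  also have "\<dots> = ennreal (\<Sum>i<m. f i)" by (simp add: nn)
  also have "(\<Sum>i<m. f i) = 1" using assms by (simp add: f_def mixed_def)
  finally have int: "(\<integral>\<^sup>+ i. ennreal (f i) \<partial>count_space UNIV) = 1" by simp
  interpret pmf_as_function .
  have pmf: "pmf (embed_pmf f) i = f i" for i by (rule pmf_embed_pmf[OF nn int])
  show ?thesis
  proof (rule that[of "embed_pmf f"])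
    show "set_pmf (embed_pmf f) \<subseteq> {..<m}"
      by (auto simp: set_pmf_eq pmf f_def split: if_splits)
  qed (simp add: pmf f_def)
qed

lemma pmf_mixed:
  assumes "set_pmf p \<subseteq> {..<m}"
  shows "vec m (pmf p) \<in> mixed m"
  using assms sum_pmf_eq_1[of "{..<m}" p] by (simp add: mixed_def)

definition shift_strategy :: "strategy \<Rightarrow> nat \<times> nat \<times> nat \<Rightarrow> strategy" where
  "shift_strategy \<sigma> t = (\<lambda>h s. \<sigma> (h @ [t]) s)"

text \<open>The strategy that plays \<open>p\<close> at the first stage and then follows \<open>f t s\<close>, where \<open>t\<close> is the
  triple of the first stage and \<open>s\<close> the state reached. Histories have the latest triple first: \<open>t\<close>
  is the last entry, and \<open>s\<close> is recorded in the entry before it or, at the second stage, is the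
  current state.\<close>
definition combine :: "(nat \<Rightarrow> nat pmf) \<Rightarrow> (nat \<times> nat \<times> nat \<Rightarrow> nat \<Rightarrow> strategy) \<Rightarrow> strategy" where
  "combine p f = (\<lambda>h s. if h = [] then p s else
     f (last h) (if butlast h = [] then s else fst (last (butlast h))) (butlast h) s)"

lemma shift_combine:
  "shift_strategy (combine p f) t = (\<lambda>h s. f t (if h = [] then s else fst (last h)) h s)"
  by (simp add: shift_strategy_def combine_def fun_eq_iff)

text \<open>Decomposition by the first stage, where the definition splits off the last one: it is the
  step of dynamic programming.\<close>
lemma play_first:
  "play G k \<sigma> \<tau> (Suc m) = bind_pmf (\<sigma> [] k) (\<lambda>i. bind_pmf (\<tau> [] k) (\<lambda>j.
     bind_pmf (trans_pmf G k i j) (\<lambda>l. map_pmf (\<lambda>(h, s). (h @ [(k, i, j)], s))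
       (play G l (shift_strategy \<sigma> (k, i, j)) (shift_strategy \<tau> (k, i, j)) m))))"
proof (induction m)
  case 0
  show ?case by (simp add: bind_return_pmf map_pmf_def)
next
  case (Suc m)
  have "play G k \<sigma> \<tau> (Suc (Suc m)) = bind_pmf (play G k \<sigma> \<tau> (Suc m)) (\<lambda>(h, k).
       bind_pmf (\<sigma> h k) (\<lambda>i. bind_pmf (\<tau> h k) (\<lambda>j. map_pmf (\<lambda>l. ((k, i, j) # h, l)) (trans_pmf G k i j))))"
    by (rule play.simps)
  also have "\<dots> = bind_pmf (\<sigma> [] k) (\<lambda>i. bind_pmf (\<tau> [] k) (\<lambda>j.
     bind_pmf (trans_pmf G k i j) (\<lambda>l. map_pmf (\<lambda>(h, s). (h @ [(k, i, j)], s))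
       (play G l (shift_strategy \<sigma> (k, i, j)) (shift_strategy \<tau> (k, i, j)) (Suc m)))))"
    unfolding Suc.IH
    by (simp add: bind_assoc_pmf bind_map_pmf map_bind_pmf shift_strategy_def case_prod_beta
        pmf.map_comp o_def cong: bind_pmf_cong)
  finally show ?case .
qed

definition starts_at :: "nat \<Rightarrow> (nat \<times> nat \<times> nat) list \<Rightarrow> nat \<Rightarrow> bool" where
  "starts_at k h s \<longleftrightarrow> (if h = [] then s else fst (last h)) = k"

lemma play_starts_at: "(h, s) \<in> set_pmf (play G k \<sigma> \<tau> m) \<Longrightarrow> starts_at k h s"
proof (induction m arbitrary: h s)
  case (Suc m)
  then obtain h' k' i j where h': "(h', k') \<in> set_pmf (play G k \<sigma> \<tau> m)" "h = (k', i, j) # h'"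
    by auto
  from Suc.IH[OF h'(1)] show ?case by (auto simp: starts_at_def h'(2))
qed (auto simp: starts_at_def)

lemma play_cong:
  assumes "\<And>h s. starts_at k h s \<Longrightarrow> \<sigma> h s = \<sigma>' h s" "\<And>h s. starts_at k h s \<Longrightarrow> \<tau> h s = \<tau>' h s"
  shows "play G k \<sigma> \<tau> m = play G k \<sigma>' \<tau>' m"
proof (induction m)
  case (Suc m)
  show ?case unfolding play.simps Suc.IH
    by (rule bind_pmf_cong) (auto dest!: play_starts_at simp: assms)
qed simp

text \<open>Every history met by a play from \<open>k\<close> starts at \<open>k\<close>, and on such histories the continuation
  of the combined strategy is \<open>f t k\<close>.\<close>
lemma disc_payoff_combine:
  "disc_payoff G l k (shift_strategy (combine p f) t) \<tau> = disc_payoff G l k (f t k) \<tau>"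
  "disc_payoff G l k \<sigma> (shift_strategy (combine p f) t) = disc_payoff G l k \<sigma> (f t k)"
proof -
  have "play G k (shift_strategy (combine p f) t) \<tau> m = play G k (f t k) \<tau> m"
    "play G k \<sigma> (shift_strategy (combine p f) t) m = play G k \<sigma> (f t k) m" for m
    unfolding shift_combine by (rule play_cong; simp add: starts_at_def)+
  thus "disc_payoff G l k (shift_strategy (combine p f) t) \<tau> = disc_payoff G l k (f t k) \<tau>"
    "disc_payoff G l k \<sigma> (shift_strategy (combine p f) t) = disc_payoff G l k \<sigma> (f t k)"
    unfolding disc_payoff_def stage_payoff_def by presburger+
qed

lemma dim_local_game [simp]: "dim_row (local_game G k l z) = acts1 G k" "dim_col (local_game G k l z) = acts2 G k"
  by (simp_all add: local_game_def)

locale finite_stochastic_game =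
  fixes G :: sgame
  assumes G: "stochastic_game G"
begin

abbreviation "K \<equiv> {1..states G}"
abbreviation "S1 \<equiv> strategies (states G) (acts1 G)"
abbreviation "S2 \<equiv> strategies (states G) (acts2 G)"

lemma trans_K: "k \<in> K \<Longrightarrow> i < acts1 G k \<Longrightarrow> j < acts2 G k \<Longrightarrow> set_pmf (trans_pmf G k i j) \<subseteq> K"
  using G unfolding stochastic_game_def by blast

lemma acts_pos: "k \<in> K \<Longrightarrow> 0 < acts1 G k" "k \<in> K \<Longrightarrow> 0 < acts2 G k"
  using G unfolding stochastic_game_def by (auto simp: Suc_le_eq)

lemma strat1: "\<sigma> \<in> S1 \<Longrightarrow> k \<in> K \<Longrightarrow> set_pmf (\<sigma> h k) \<subseteq> {..<acts1 G k}"
  and strat2: "\<tau> \<in> S2 \<Longrightarrow> k \<in> K \<Longrightarrow> set_pmf (\<tau> h k) \<subseteq> {..<acts2 G k}"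
  unfolding strategies_def by blast+

lemma strategies_nonempty: "S1 \<noteq> {}" "S2 \<noteq> {}"
  using acts_pos by (auto simp: strategies_def intro!: exI[of _ "\<lambda>_ _. return_pmf 0"])

lemma shift_in: "\<sigma> \<in> strategies n acts \<Longrightarrow> shift_strategy \<sigma> t \<in> strategies n acts"
  by (simp add: strategies_def shift_strategy_def)

lemma play_support:
  assumes "\<sigma> \<in> S1" "\<tau> \<in> S2" "k \<in> K"
  shows "finite (set_pmf (play G k \<sigma> \<tau> m)) \<and> set_pmf (play G k \<sigma> \<tau> m) \<subseteq> {(h, s). s \<in> K \<and> length h = m}"
  using assms
proof (induction m arbitrary: k \<sigma> \<tau>)
  case (Suc m)
  have IH: "finite (set_pmf (play G l (shift_strategy \<sigma> t) (shift_strategy \<tau> t) m))"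
    "set_pmf (play G l (shift_strategy \<sigma> t) (shift_strategy \<tau> t) m) \<subseteq> {(h, s). s \<in> K \<and> length h = m}"
    if "l \<in> K" for l t using Suc.IH[OF shift_in[OF Suc.prems(1)] shift_in[OF Suc.prems(2)] that] by auto
  have sub: "set_pmf (\<sigma> [] k) \<subseteq> {..<acts1 G k}" "set_pmf (\<tau> [] k) \<subseteq> {..<acts2 G k}"
    using strat1 strat2 Suc.prems by auto
  have tr: "set_pmf (trans_pmf G k i j) \<subseteq> K" if "i \<in> set_pmf (\<sigma> [] k)" "j \<in> set_pmf (\<tau> [] k)" for i j
    using trans_K[OF Suc.prems(3)] that sub by blast
  have "finite (set_pmf (\<sigma> [] k))" "finite (set_pmf (\<tau> [] k))" using sub finite_subset by blast+
  moreover have "finite (set_pmf (trans_pmf G k i j))" if "i \<in> set_pmf (\<sigma> [] k)" "j \<in> set_pmf (\<tau> [] k)" for i j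
    using tr[OF that] finite_subset by blast
  ultimately have "finite (set_pmf (play G k \<sigma> \<tau> (Suc m)))"
    unfolding play_first set_bind_pmf set_map_pmf
    by (intro finite_UN_I finite_imageI IH(1)) (use tr in blast)+
  moreover have "set_pmf (play G k \<sigma> \<tau> (Suc m)) \<subseteq> {(h, s). s \<in> K \<and> length h = Suc m}"
    unfolding play_first set_bind_pmf set_map_pmf using IH(2) tr by fastforce
  ultimately show ?case ..
qed auto

lemma expectation_first:
  fixes f :: "_ \<Rightarrow> real"
  assumes "\<sigma> \<in> S1" "\<tau> \<in> S2" "k \<in> K"
  shows "measure_pmf.expectation (play G k \<sigma> \<tau> (Suc m)) f =
    (\<Sum>i<acts1 G k. \<Sum>j<acts2 G k. pmf (\<sigma> [] k) i * pmf (\<tau> [] k) j *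
      (\<Sum>l\<in>K. pmf (trans_pmf G k i j) l * measure_pmf.expectation
        (play G l (shift_strategy \<sigma> (k, i, j)) (shift_strategy \<tau> (k, i, j)) m) (\<lambda>(h, s). f (h @ [(k, i, j)], s))))"
proof -
  let ?p = "\<lambda>i j l. map_pmf (\<lambda>(h, s). (h @ [(k, i, j)], s))
       (play G l (shift_strategy \<sigma> (k, i, j)) (shift_strategy \<tau> (k, i, j)) m)"
  have fin: "finite (set_pmf (?p i j l))" if "l \<in> K" for i j l
    using play_support[OF shift_in[OF assms(1)] shift_in[OF assms(2)] that] by simp
  have fin3: "finite (set_pmf (bind_pmf (trans_pmf G k i j) (?p i j)))"
    if "i < acts1 G k" "j < acts2 G k" for i j
    unfolding set_bind_pmf[of "trans_pmf G k i j"]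
    by (intro finite_UN_I finite_subset[OF trans_K[OF assms(3) that]] fin)
      (use trans_K[OF assms(3) that] in auto)
  have e3: "measure_pmf.expectation (bind_pmf (trans_pmf G k i j) (?p i j)) f =
      (\<Sum>l\<in>K. pmf (trans_pmf G k i j) l * measure_pmf.expectation (?p i j l) f)"
    if "i < acts1 G k" "j < acts2 G k" for i j
    using trans_K[OF assms(3) that] fin by (subst pmf_expectation_bind[of K]) auto
  let ?p2 = "\<lambda>i. bind_pmf (\<tau> [] k) (\<lambda>j. bind_pmf (trans_pmf G k i j) (?p i j))"
  have fin2: "finite (set_pmf (?p2 i))" if "i < acts1 G k" for i
    unfolding set_bind_pmf[of "\<tau> [] k"]
    by (intro finite_UN_I finite_subset[OF strat2[OF assms(2,3)]] fin3[OF that])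
      (use strat2[OF assms(2,3)] in auto)
  have e2: "measure_pmf.expectation (?p2 i) f = (\<Sum>j<acts2 G k. pmf (\<tau> [] k) j *
      (\<Sum>l\<in>K. pmf (trans_pmf G k i j) l * measure_pmf.expectation (?p i j l) f))" if "i < acts1 G k" for i
    using strat2[OF assms(2,3)] fin3[OF that] e3[OF that]
    by (subst pmf_expectation_bind[of "{..<acts2 G k}"]) auto
  have "measure_pmf.expectation (play G k \<sigma> \<tau> (Suc m)) f =
      (\<Sum>i<acts1 G k. pmf (\<sigma> [] k) i * measure_pmf.expectation (?p2 i) f)"
    unfolding play_first using strat1[OF assms(1,3)] fin2
    by (subst pmf_expectation_bind[of "{..<acts1 G k}"]) auto
  also have "\<dots> = (\<Sum>i<acts1 G k. pmf (\<sigma> [] k) i * (\<Sum>j<acts2 G k. pmf (\<tau> [] k) j *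
      (\<Sum>l\<in>K. pmf (trans_pmf G k i j) l * measure_pmf.expectation (?p i j l) f)))"
    using e2 by (intro sum.cong) auto
  finally show ?thesis by (simp add: sum_distrib_left mult_ac case_prod_unfold del: play.simps)
qed

definition avg :: "nat \<Rightarrow> strategy \<Rightarrow> strategy \<Rightarrow> (nat \<Rightarrow> nat \<Rightarrow> real) \<Rightarrow> real" where
  "avg k \<sigma> \<tau> a = (\<Sum>i<acts1 G k. \<Sum>j<acts2 G k. pmf (\<sigma> [] k) i * pmf (\<tau> [] k) j * a i j)"

definition trans_avg :: "nat \<Rightarrow> nat \<Rightarrow> nat \<Rightarrow> (nat \<Rightarrow> real) \<Rightarrow> real" where
  "trans_avg k i j f = (\<Sum>l\<in>K. pmf (trans_pmf G k i j) l * f l)"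

lemma trans_avg_const: "k \<in> K \<Longrightarrow> i < acts1 G k \<Longrightarrow> j < acts2 G k \<Longrightarrow> trans_avg k i j (\<lambda>_. c) = c"
  using sum_pmf_eq_1[OF finite_atLeastAtMost trans_K]
  by (simp add: trans_avg_def sum_distrib_right[symmetric])

lemma avg_const: "\<sigma> \<in> S1 \<Longrightarrow> \<tau> \<in> S2 \<Longrightarrow> k \<in> K \<Longrightarrow> avg k \<sigma> \<tau> (\<lambda>_ _. c) = c"
  using sum_pmf_eq_1[OF finite_lessThan strat1, of \<sigma> k "[]"] sum_pmf_eq_1[OF finite_lessThan strat2, of \<tau> k "[]"]
  by (simp add: avg_def sum_distrib_left[symmetric] sum_distrib_right[symmetric])

lemma avg_mono:
  "(\<And>i j. i < acts1 G k \<Longrightarrow> j < acts2 G k \<Longrightarrow> a i j \<le> b i j) \<Longrightarrow> avg k \<sigma> \<tau> a \<le> avg k \<sigma> \<tau> b"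
  unfolding avg_def by (intro sum_mono mult_left_mono) auto

lemma trans_avg_mono: "(\<And>l. l \<in> K \<Longrightarrow> f l \<le> g l) \<Longrightarrow> trans_avg k i j f \<le> trans_avg k i j g"
  unfolding trans_avg_def by (intro sum_mono mult_left_mono) auto

lemma avg_add: "avg k \<sigma> \<tau> a + avg k \<sigma> \<tau> b = avg k \<sigma> \<tau> (\<lambda>i j. a i j + b i j)"
  by (simp only: avg_def sum.distrib distrib_left)

lemma avg_cmult: "c * avg k \<sigma> \<tau> a = avg k \<sigma> \<tau> (\<lambda>i j. c * a i j)"
  by (simp add: avg_def sum_distrib_left mult_ac)

lemma trans_avg_cmult: "c * trans_avg k i j f = trans_avg k i j (\<lambda>s. c * f s)"
  by (simp add: trans_avg_def sum_distrib_left mult_ac)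

lemma stage_payoff_0:
  assumes "\<sigma> \<in> S1" "\<tau> \<in> S2" "k \<in> K"
  shows "stage_payoff G k \<sigma> \<tau> 0 = avg k \<sigma> \<tau> (stage G k)"
proof -
  have "stage_payoff G k \<sigma> \<tau> 0 = avg k \<sigma> \<tau> (\<lambda>i j. trans_avg k i j (\<lambda>_. stage G k i j))"
    unfolding stage_payoff_def expectation_first[OF assms] avg_def trans_avg_def by simp
  also have "\<dots> = avg k \<sigma> \<tau> (stage G k)"
    unfolding avg_def using assms(3) by (intro sum.cong refl) (simp add: trans_avg_const)
  finally show ?thesis .
qed

lemma stage_payoff_Suc:
  assumes "\<sigma> \<in> S1" "\<tau> \<in> S2" "k \<in> K"
  shows "stage_payoff G k \<sigma> \<tau> (Suc m) = avg k \<sigma> \<tau> (\<lambda>i j. trans_avg k i j (\<lambda>l.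
    stage_payoff G l (shift_strategy \<sigma> (k, i, j)) (shift_strategy \<tau> (k, i, j)) m))"
proof -
  have "measure_pmf.expectation (play G l (shift_strategy \<sigma> t) (shift_strategy \<tau> t) (Suc m))
          (\<lambda>(h, s). case hd (h @ [t]) of (k, i, j) \<Rightarrow> stage G k i j) =
        stage_payoff G l (shift_strategy \<sigma> t) (shift_strategy \<tau> t) m" if "l \<in> K" for l t
    unfolding stage_payoff_def
  proof (rule integral_cong_AE)
    show "AE x in measure_pmf (play G l (shift_strategy \<sigma> t) (shift_strategy \<tau> t) (Suc m)).
        (case x of (h, s) \<Rightarrow> case hd (h @ [t]) of (k, i, j) \<Rightarrow> stage G k i j) =
        (case x of (h, _) \<Rightarrow> case hd h of (k, i, j) \<Rightarrow> stage G k i j)"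
    proof (rule AE_pmfI)
      fix x assume "x \<in> set_pmf (play G l (shift_strategy \<sigma> t) (shift_strategy \<tau> t) (Suc m))"
      hence "length (fst x) = Suc m"
        using play_support[OF shift_in[OF assms(1)] shift_in[OF assms(2)] that, of t t "Suc m"] by auto
      thus "(case x of (h, s) \<Rightarrow> case hd (h @ [t]) of (k, i, j) \<Rightarrow> stage G k i j) =
        (case x of (h, _) \<Rightarrow> case hd h of (k, i, j) \<Rightarrow> stage G k i j)"
        by (cases "fst x") (auto simp: case_prod_beta)
    qed
  qed auto
  note this[of _ "(k, _, _)"]
  thus ?thesis
    unfolding stage_payoff_def[of G k] expectation_first[OF assms] avg_def trans_avg_def
    by (intro sum.cong refl arg_cong2[where f = "(*)"]) auto
qed

lemma stage_bound: obtains C where "0 \<le> C" "\<And>k i j. k \<in> K \<Longrightarrow> i < acts1 G k \<Longrightarrow> j < acts2 G k \<Longrightarrow> \<bar>stage G k i j\<bar> \<le> C"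
proof -
  define X where "X = (\<Union>k\<in>K. \<Union>i<acts1 G k. \<Union>j<acts2 G k. {\<bar>stage G k i j\<bar>})"
  have "finite X" by (simp add: X_def)
  moreover have "\<bar>stage G k i j\<bar> \<in> X" if "k \<in> K" "i < acts1 G k" "j < acts2 G k" for k i j
    using that unfolding X_def by blast
  ultimately show ?thesis
    by (intro that[of "Max (insert 0 X)"] Max_ge) auto
qed

context
  fixes C :: real
  assumes C: "0 \<le> C" "\<And>k i j. k \<in> K \<Longrightarrow> i < acts1 G k \<Longrightarrow> j < acts2 G k \<Longrightarrow> \<bar>stage G k i j\<bar> \<le> C"
begin

lemma avg_bounds:
  assumes "\<sigma> \<in> S1" "\<tau> \<in> S2" "k \<in> K" "\<And>i j. i < acts1 G k \<Longrightarrow> j < acts2 G k \<Longrightarrow> \<bar>a i j\<bar> \<le> C"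
  shows "\<bar>avg k \<sigma> \<tau> a\<bar> \<le> C"
proof -
  have "avg k \<sigma> \<tau> a \<le> avg k \<sigma> \<tau> (\<lambda>_ _. C)" "avg k \<sigma> \<tau> (\<lambda>_ _. - C) \<le> avg k \<sigma> \<tau> a"
    using assms(4) by (intro avg_mono; force)+
  thus ?thesis unfolding avg_const[OF assms(1-3)] by linarith
qed

lemma trans_avg_bounds:
  assumes "k \<in> K" "i < acts1 G k" "j < acts2 G k" "\<And>l. l \<in> K \<Longrightarrow> \<bar>f l\<bar> \<le> C"
  shows "\<bar>trans_avg k i j f\<bar> \<le> C"
proof -
  have "trans_avg k i j f \<le> trans_avg k i j (\<lambda>_. C)" "trans_avg k i j (\<lambda>_. - C) \<le> trans_avg k i j f"
    using assms(4) by (intro trans_avg_mono; force)+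
  thus ?thesis unfolding trans_avg_const[OF assms(1-3)] by linarith
qed

lemma stage_payoff_bound: "\<sigma> \<in> S1 \<Longrightarrow> \<tau> \<in> S2 \<Longrightarrow> k \<in> K \<Longrightarrow> \<bar>stage_payoff G k \<sigma> \<tau> m\<bar> \<le> C"
proof (induction m arbitrary: k \<sigma> \<tau>)
  case 0
  thus ?case unfolding stage_payoff_0[OF 0] by (intro avg_bounds C(2))
next
  case (Suc m)
  show ?case unfolding stage_payoff_Suc[OF Suc.prems]
    using Suc by (intro avg_bounds trans_avg_bounds Suc.IH shift_in)
qed

context
  fixes l :: real
  assumes l: "0 < l" "l \<le> 1"
begin

lemma disc_term_bound:
  assumes "\<sigma> \<in> S1" "\<tau> \<in> S2" "k \<in> K"
  shows "norm (l * (1 - l) ^ m * stage_payoff G k \<sigma> \<tau> m) \<le> l * (1 - l) ^ m * C"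
  using l stage_payoff_bound[OF assms, of m] by (simp add: abs_mult mult_left_mono)

lemma disc_weight_sums: "(\<lambda>m. l * (1 - l) ^ m * C) sums C"
proof -
  have "(\<lambda>m. (1 - l) ^ m) sums (1 / (1 - (1 - l)))" using l by (intro geometric_sums) auto
  hence "(\<lambda>m. l * C * (1 - l) ^ m) sums (l * C * (1 / (1 - (1 - l))))" by (rule sums_mult)
  thus ?thesis using l by (simp add: mult_ac)
qed

lemma disc_summable:
  assumes "\<sigma> \<in> S1" "\<tau> \<in> S2" "k \<in> K"
  shows "summable (\<lambda>m. l * (1 - l) ^ m * stage_payoff G k \<sigma> \<tau> m)"
  by (rule summable_comparison_test'[OF sums_summable[OF disc_weight_sums], of 0])
    (rule disc_term_bound[OF assms])

lemma disc_payoff_bound: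
  assumes "\<sigma> \<in> S1" "\<tau> \<in> S2" "k \<in> K"
  shows "\<bar>disc_payoff G l k \<sigma> \<tau>\<bar> \<le> C"
proof -
  have "norm (suminf (\<lambda>m. l * (1 - l) ^ m * stage_payoff G k \<sigma> \<tau> m)) \<le> suminf (\<lambda>m. l * (1 - l) ^ m * C)"
    using disc_term_bound[OF assms] sums_summable[OF disc_weight_sums] by (rule norm_suminf_le)
  thus ?thesis using sums_unique[OF disc_weight_sums] by (simp add: disc_payoff_def)
qed

lemma disc_payoff_first:
  assumes "\<sigma> \<in> S1" "\<tau> \<in> S2" "k \<in> K"
  shows "disc_payoff G l k \<sigma> \<tau> = avg k \<sigma> \<tau> (\<lambda>i j. l * stage G k i j + (1 - l) * trans_avg k i j (\<lambda>s.
    disc_payoff G l s (shift_strategy \<sigma> (k, i, j)) (shift_strategy \<tau> (k, i, j))))"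
proof -
  let ?s = "\<lambda>i j s m. stage_payoff G s (shift_strategy \<sigma> (k, i, j)) (shift_strategy \<tau> (k, i, j)) m"
  have sum: "(\<lambda>m. l * (1 - l) ^ m * ?s i j s m) sums
      disc_payoff G l s (shift_strategy \<sigma> (k, i, j)) (shift_strategy \<tau> (k, i, j))" if "s \<in> K" for i j s
    unfolding disc_payoff_def using disc_summable shift_in assms that by (intro summable_sums) auto
  have "(\<lambda>m. l * (1 - l) ^ Suc m * stage_payoff G k \<sigma> \<tau> (Suc m)) sums
      avg k \<sigma> \<tau> (\<lambda>i j. trans_avg k i j (\<lambda>s. (1 - l) * disc_payoff G l s (shift_strategy \<sigma> (k, i, j)) (shift_strategy \<tau> (k, i, j))))"
  proof -
    have "(\<lambda>m. avg k \<sigma> \<tau> (\<lambda>i j. trans_avg k i j (\<lambda>s. (1 - l) * (l * (1 - l) ^ m * ?s i j s m)))) sums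
      avg k \<sigma> \<tau> (\<lambda>i j. trans_avg k i j (\<lambda>s. (1 - l) * disc_payoff G l s (shift_strategy \<sigma> (k, i, j)) (shift_strategy \<tau> (k, i, j))))"
      unfolding avg_def trans_avg_def by (intro sums_sum sums_mult sum) auto
    moreover have "avg k \<sigma> \<tau> (\<lambda>i j. trans_avg k i j (\<lambda>s. (1 - l) * (l * (1 - l) ^ m * ?s i j s m))) =
        l * (1 - l) ^ Suc m * stage_payoff G k \<sigma> \<tau> (Suc m)" for m
      unfolding stage_payoff_Suc[OF assms] avg_def trans_avg_def
      by (simp add: sum_distrib_left mult_ac)
    ultimately show ?thesis by simp
  qed
  hence "(\<lambda>m. l * (1 - l) ^ m * stage_payoff G k \<sigma> \<tau> m) sums
      (avg k \<sigma> \<tau> (\<lambda>i j. trans_avg k i j (\<lambda>s. (1 - l) * disc_payoff G l s (shift_strategy \<sigma> (k, i, j)) (shift_strategy \<tau> (k, i, j))))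
       + l * (1 - l) ^ 0 * stage_payoff G k \<sigma> \<tau> 0)"
    by (rule sums_Suc)
  hence "disc_payoff G l k \<sigma> \<tau> = \<dots>" unfolding disc_payoff_def by (rule sums_unique[symmetric])
  also have "\<dots> = avg k \<sigma> \<tau> (\<lambda>i j. (1 - l) * trans_avg k i j (\<lambda>s. disc_payoff G l s
        (shift_strategy \<sigma> (k, i, j)) (shift_strategy \<tau> (k, i, j)))) + l * avg k \<sigma> \<tau> (stage G k)"
    unfolding stage_payoff_0[OF assms] trans_avg_cmult by simp
  finally show ?thesis unfolding avg_cmult avg_add by (simp only: add.commute)
qed

lemma disc_value_facts:
  assumes k: "k \<in> K"
  shows "\<bar>disc_value G l k\<bar> \<le> C"
    and "\<sigma> \<in> S1 \<Longrightarrow> 0 < e \<Longrightarrow> \<exists>\<tau>\<in>S2. disc_payoff G l k \<sigma> \<tau> \<le> disc_value G l k + e"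
    and "0 < e \<Longrightarrow> \<exists>\<sigma>\<in>S1. \<forall>\<tau>\<in>S2. disc_value G l k - e \<le> disc_payoff G l k \<sigma> \<tau>"
proof -
  let ?I = "\<lambda>\<sigma>. INF \<tau>\<in>S2. disc_payoff G l k \<sigma> \<tau>"
  have v: "disc_value G l k = (SUP \<sigma>\<in>S1. ?I \<sigma>)" by (simp add: disc_value_def)
  have b: "- C \<le> disc_payoff G l k \<sigma> \<tau>" "disc_payoff G l k \<sigma> \<tau> \<le> C" if "\<sigma> \<in> S1" "\<tau> \<in> S2" for \<sigma> \<tau>
    using disc_payoff_bound[OF that k] by auto
  have bb: "bdd_below (disc_payoff G l k \<sigma> ` S2)" if "\<sigma> \<in> S1" for \<sigma>
    using b(1)[OF that] by (auto intro!: bdd_belowI2)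
  obtain \<tau>0 where \<tau>0: "\<tau>0 \<in> S2" using strategies_nonempty by blast
  obtain \<sigma>0 where \<sigma>0: "\<sigma>0 \<in> S1" using strategies_nonempty by blast
  have I_le: "?I \<sigma> \<le> disc_payoff G l k \<sigma> \<tau>" if "\<sigma> \<in> S1" "\<tau> \<in> S2" for \<sigma> \<tau>
    by (rule cINF_lower[OF bb[OF that(1)] that(2)])
  have I: "- C \<le> ?I \<sigma>" "?I \<sigma> \<le> C" if "\<sigma> \<in> S1" for \<sigma>
  proof -
    show "- C \<le> ?I \<sigma>" by (rule cINF_greatest[OF strategies_nonempty(2) b(1)[OF that]])
    show "?I \<sigma> \<le> C" using I_le[OF that \<tau>0] b(2)[OF that \<tau>0] by linarith
  qed
  have ba: "bdd_above (?I ` S1)" using I(2) by (auto intro!: bdd_aboveI2)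
  show "\<bar>disc_value G l k\<bar> \<le> C"
  proof -
    have "disc_value G l k \<le> C" unfolding v by (rule cSUP_least[OF strategies_nonempty(1) I(2)])
    moreover have "?I \<sigma>0 \<le> disc_value G l k" unfolding v by (rule cSUP_upper[OF \<sigma>0 ba])
    ultimately show ?thesis using I(1)[OF \<sigma>0] by linarith
  qed
  show "\<exists>\<tau>\<in>S2. disc_payoff G l k \<sigma> \<tau> \<le> disc_value G l k + e" if "\<sigma> \<in> S1" "0 < e"
  proof -
    have "?I \<sigma> \<le> disc_value G l k" unfolding v by (rule cSUP_upper[OF that(1) ba])
    hence "?I \<sigma> < disc_value G l k + e" using that(2) by linarith
    then obtain \<tau> where "\<tau> \<in> S2" "disc_payoff G l k \<sigma> \<tau> < disc_value G l k + e"
      using cINF_less_iff[OF strategies_nonempty(2) bb[OF \<open>\<sigma> \<in> S1\<close>]] by blast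
    thus ?thesis by (intro bexI[of _ \<tau>]) auto
  qed
  show "\<exists>\<sigma>\<in>S1. \<forall>\<tau>\<in>S2. disc_value G l k - e \<le> disc_payoff G l k \<sigma> \<tau>" if "0 < e"
  proof -
    have "disc_value G l k - e < (SUP \<sigma>\<in>S1. ?I \<sigma>)" using that unfolding v by simp
    then obtain \<sigma> where "\<sigma> \<in> S1" "disc_value G l k - e < ?I \<sigma>"
      using less_cSUP_iff[OF strategies_nonempty(1) ba] by blast
    thus ?thesis using I_le by (meson less_imp_le order_trans)
  qed
qed

lemma disc_value_lowerI:
  assumes "k \<in> K" "\<sigma> \<in> S1" "\<And>\<tau>. \<tau> \<in> S2 \<Longrightarrow> c \<le> disc_payoff G l k \<sigma> \<tau>"
  shows "c \<le> disc_value G l k"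
proof (rule field_le_epsilon)
  fix e :: real assume "0 < e"
  from disc_value_facts(2)[OF assms(1,2) this] show "c \<le> disc_value G l k + e"
    using assms(3) by force
qed

lemma disc_value_upperI:
  assumes "k \<in> K" "\<And>\<sigma>. \<sigma> \<in> S1 \<Longrightarrow> \<exists>\<tau>\<in>S2. disc_payoff G l k \<sigma> \<tau> \<le> c"
  shows "disc_value G l k \<le> c"
proof (rule field_le_epsilon)
  fix e :: real assume "0 < e"
  from disc_value_facts(3)[OF assms(1) this] show "disc_value G l k \<le> c + e"
    using assms(2) by force
qed

lemma combine_in:
  assumes "\<And>s. s \<in> {1..n} \<Longrightarrow> set_pmf (p s) \<subseteq> {..<acts s}" "\<And>t s. f t s \<in> strategies n acts"
  shows "combine p f \<in> strategies n acts"
  using assms by (auto simp: strategies_def combine_def split: if_splits)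

lemma payoff_local_game:
  assumes "x \<in> mixed (acts1 G k)" "y \<in> mixed (acts2 G k)"
    and "\<And>i. i < acts1 G k \<Longrightarrow> pmf (\<sigma> [] k) i = x $ i" "\<And>j. j < acts2 G k \<Longrightarrow> pmf (\<tau> [] k) j = y $ j"
  shows "game_payoff (local_game G k l z) x y = avg k \<sigma> \<tau> (\<lambda>i j. l * stage G k i j + (1 - l) * trans_avg k i j z)"
  using assms by (subst game_payoff_sum) (auto simp: mixed_def avg_def trans_avg_def local_game_def)

text \<open>Player 1 plays \<open>x\<close> once and then continues with an \<open>e\<close>-optimal strategy for the state reached.\<close>
lemma value_ge_local:
  assumes k: "k \<in> K" and x: "x \<in> mixed (acts1 G k)"
    and opt: "\<And>y. y \<in> mixed (acts2 G k) \<Longrightarrow> u \<le> game_payoff (local_game G k l (disc_value G l)) x y"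
  shows "u \<le> disc_value G l k"
proof (rule field_le_epsilon)
  fix e :: real assume e: "0 < e"
  obtain \<sigma>0 where \<sigma>0: "\<sigma>0 \<in> S1" using strategies_nonempty by blast
  have "\<exists>\<sigma>. \<sigma> \<in> S1 \<and> (s \<in> K \<longrightarrow> (\<forall>\<tau>\<in>S2. disc_value G l s - e \<le> disc_payoff G l s \<sigma> \<tau>))" for s
    using disc_value_facts(3)[OF _ e, of s] \<sigma>0 by (cases "s \<in> K") blast+
  then obtain F where F: "\<And>s. F s \<in> S1"
    "\<And>s \<tau>. s \<in> K \<Longrightarrow> \<tau> \<in> S2 \<Longrightarrow> disc_value G l s - e \<le> disc_payoff G l s (F s) \<tau>" by metis
  obtain p where p: "set_pmf p \<subseteq> {..<acts1 G k}" "\<And>i. i < acts1 G k \<Longrightarrow> pmf p i = x $ i"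
    using mixed_pmf[OF x] by blast
  define \<sigma> where "\<sigma> = combine (\<lambda>s. if s = k then p else return_pmf 0) (\<lambda>t. F)"
  have \<sigma>: "\<sigma> \<in> S1" unfolding \<sigma>_def using p(1) F(1) acts_pos by (intro combine_in) auto
  have \<sigma>k: "\<sigma> [] k = p" by (simp add: \<sigma>_def combine_def)
  have "u - e \<le> disc_value G l k"
  proof (rule disc_value_lowerI[OF k \<sigma>])
    fix \<tau> assume \<tau>: "\<tau> \<in> S2"
    define y where "y = vec (acts2 G k) (pmf (\<tau> [] k))"
    have y: "y \<in> mixed (acts2 G k)" unfolding y_def by (intro pmf_mixed strat2 \<tau> k)
    have "u - e \<le> avg k \<sigma> \<tau> (\<lambda>i j. l * stage G k i j + (1 - l) * trans_avg k i j (disc_value G l)) - e"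
      using opt[OF y] payoff_local_game[OF x y, of \<sigma> \<tau>] p(2) \<sigma>k by (simp add: y_def)
    also have "\<dots> = avg k \<sigma> \<tau> (\<lambda>i j. l * stage G k i j + (1 - l) * trans_avg k i j (disc_value G l)) - avg k \<sigma> \<tau> (\<lambda>_ _. e)"
      using \<sigma> \<tau> k by (simp add: avg_const)
    also have "\<dots> = avg k \<sigma> \<tau> (\<lambda>i j. l * stage G k i j + (1 - l) * trans_avg k i j (disc_value G l) - e)"
      by (simp only: avg_def sum_subtractf right_diff_distrib)
    also have "\<dots> \<le> disc_payoff G l k \<sigma> \<tau>"
      unfolding disc_payoff_first[OF \<sigma> \<tau> k]
    proof (rule avg_mono)
      fix i j assume ij: "i < acts1 G k" "j < acts2 G k"
      have "trans_avg k i j (disc_value G l) - e = trans_avg k i j (disc_value G l) - trans_avg k i j (\<lambda>_. e)"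
        using trans_avg_const k ij by simp
      also have "\<dots> = trans_avg k i j (\<lambda>s. disc_value G l s - e)"
        by (simp only: trans_avg_def sum_subtractf right_diff_distrib)
      also have "\<dots> \<le> trans_avg k i j (\<lambda>s.
          disc_payoff G l s (shift_strategy \<sigma> (k, i, j)) (shift_strategy \<tau> (k, i, j)))" (is "_ \<le> ?t")
        unfolding \<sigma>_def disc_payoff_combine using F(2) shift_in \<tau> by (intro trans_avg_mono) auto
      finally have "(1 - l) * (trans_avg k i j (disc_value G l) - e) \<le> (1 - l) * ?t"
        using l by (intro mult_left_mono) auto
      moreover have "0 \<le> l * e" using l e by simp
      ultimately show "l * stage G k i j + (1 - l) * trans_avg k i j (disc_value G l) - e \<le>
          l * stage G k i j + (1 - l) * ?t" by (simp add: algebra_simps)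
    qed
    finally show "u - e \<le> disc_payoff G l k \<sigma> \<tau>" .
  qed
  thus "u \<le> disc_value G l k + e" by simp
qed

text \<open>Player 2 answers a given strategy by \<open>y\<close> at the first stage and then, knowing what happened,
  by an \<open>e\<close>-best reply to the rest of that strategy.\<close>
lemma value_le_local:
  assumes k: "k \<in> K" and y: "y \<in> mixed (acts2 G k)"
    and opt: "\<And>x. x \<in> mixed (acts1 G k) \<Longrightarrow> game_payoff (local_game G k l (disc_value G l)) x y \<le> u"
  shows "disc_value G l k \<le> u"
proof (rule field_le_epsilon)
  fix e :: real assume e: "0 < e"
  obtain \<tau>0 where \<tau>0: "\<tau>0 \<in> S2" using strategies_nonempty by blast
  obtain p where p: "set_pmf p \<subseteq> {..<acts2 G k}" "\<And>i. i < acts2 G k \<Longrightarrow> pmf p i = y $ i"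
    using mixed_pmf[OF y] by blast
  show "disc_value G l k \<le> u + e"
  proof (rule disc_value_upperI[OF k])
    fix \<sigma> assume \<sigma>: "\<sigma> \<in> S1"
    let ?reply = "\<lambda>t s \<tau>. \<tau> \<in> S2 \<and>
      (s \<in> K \<longrightarrow> disc_payoff G l s (shift_strategy \<sigma> t) \<tau> \<le> disc_value G l s + e)"
    have ex: "\<exists>\<tau>. ?reply t s \<tau>" for s t
      using disc_value_facts(2)[OF _ shift_in[OF \<sigma>] e, of s t] \<tau>0 by (cases "s \<in> K") blast+
    define F where "F t s = (SOME \<tau>. ?reply t s \<tau>)" for t s
    have "?reply t s (F t s)" for t s unfolding F_def by (rule someI_ex[OF ex])
    hence F: "F t s \<in> S2" "s \<in> K \<Longrightarrow> disc_payoff G l s (shift_strategy \<sigma> t) (F t s) \<le> disc_value G l s + e"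
      for t s by auto
    define \<tau> where "\<tau> = combine (\<lambda>s. if s = k then p else return_pmf 0) F"
    have \<tau>: "\<tau> \<in> S2" unfolding \<tau>_def using p(1) F(1) acts_pos by (intro combine_in) auto
    have \<tau>k: "\<tau> [] k = p" by (simp add: \<tau>_def combine_def)
    define x where "x = vec (acts1 G k) (pmf (\<sigma> [] k))"
    have x: "x \<in> mixed (acts1 G k)" unfolding x_def by (intro pmf_mixed strat1 \<sigma> k)
    have "disc_payoff G l k \<sigma> \<tau> \<le>
        avg k \<sigma> \<tau> (\<lambda>i j. l * stage G k i j + (1 - l) * trans_avg k i j (disc_value G l) + e)"
      unfolding disc_payoff_first[OF \<sigma> \<tau> k]
    proof (rule avg_mono)
      fix i j assume ij: "i < acts1 G k" "j < acts2 G k"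
      have "trans_avg k i j (\<lambda>s. disc_payoff G l s (shift_strategy \<sigma> (k, i, j)) (shift_strategy \<tau> (k, i, j)))
          \<le> trans_avg k i j (\<lambda>s. disc_value G l s + e)" (is "?t \<le> _")
        unfolding \<tau>_def disc_payoff_combine using F(2) by (intro trans_avg_mono) auto
      also have "\<dots> = trans_avg k i j (disc_value G l) + trans_avg k i j (\<lambda>_. e)"
        by (simp only: trans_avg_def sum.distrib distrib_left)
      also have "\<dots> = trans_avg k i j (disc_value G l) + e"
        using trans_avg_const k ij by simp
      finally have "(1 - l) * ?t \<le> (1 - l) * (trans_avg k i j (disc_value G l) + e)"
        using l by (intro mult_left_mono) auto
      moreover have "0 \<le> l * e" using l e by simp
      ultimately show "l * stage G k i j + (1 - l) * ?t \<le>
          l * stage G k i j + (1 - l) * trans_avg k i j (disc_value G l) + e" by (simp add: algebra_simps)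
    qed
    also have "\<dots> = avg k \<sigma> \<tau> (\<lambda>i j. l * stage G k i j + (1 - l) * trans_avg k i j (disc_value G l)) + avg k \<sigma> \<tau> (\<lambda>_ _. e)"
      by (simp only: avg_def sum.distrib distrib_left)
    also have "\<dots> \<le> u + e"
      using opt[OF x] payoff_local_game[OF x y, of \<sigma> \<tau>] p(2) \<tau>k \<sigma> \<tau> k by (simp add: x_def avg_const)
    finally show "\<exists>\<tau>\<in>S2. disc_payoff G l k \<sigma> \<tau> \<le> u + e" using \<tau> by blast
  qed
qed

end
end

lemma disc_value_bounded:
  obtains C where "0 \<le> C" "\<And>k i j. k \<in> K \<Longrightarrow> i < acts1 G k \<Longrightarrow> j < acts2 G k \<Longrightarrow> \<bar>stage G k i j\<bar> \<le> C"
    "\<And>l k. 0 < l \<Longrightarrow> l \<le> 1 \<Longrightarrow> k \<in> K \<Longrightarrow> \<bar>disc_value G l k\<bar> \<le> C"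
  using stage_bound disc_value_facts(1) by metis

lemma disc_value_eq_local:
  assumes "0 < l" "l \<le> 1" and "k \<in> K"
    and x: "x \<in> mixed (acts1 G k)" and y: "y \<in> mixed (acts2 G k)"
    and "\<And>y. y \<in> mixed (acts2 G k) \<Longrightarrow> u \<le> game_payoff (local_game G k l (disc_value G l)) x y"
    and "\<And>x. x \<in> mixed (acts1 G k) \<Longrightarrow> game_payoff (local_game G k l (disc_value G l)) x y \<le> u"
  shows "disc_value G l k = u"
  using stage_bound assms by (metis value_ge_local value_le_local order_antisym)

lemma mixed_payoff_mono:
  assumes x: "x \<in> mixed (acts1 G k)" and y: "y \<in> mixed (acts2 G k)"
    and d: "\<And>i j. i < acts1 G k \<Longrightarrow> j < acts2 G k \<Longrightarrow>
      local_game G k l z $$ (i, j) \<le> local_game G k m z' $$ (i, j) + d"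
  shows "game_payoff (local_game G k l z) x y \<le> game_payoff (local_game G k m z') x y + d"
proof -
  have "game_payoff (local_game G k l z) x y \<le>
      (\<Sum>i<acts1 G k. \<Sum>j<acts2 G k. x $ i * y $ j * (local_game G k m z' $$ (i, j) + d))"
    using x y d by (subst game_payoff_sum) (auto simp: mixed_def intro!: sum_mono mult_left_mono)
  also have "\<dots> = game_payoff (local_game G k m z') x y + (\<Sum>i<acts1 G k. \<Sum>j<acts2 G k. x $ i * y $ j * d)"
    using x y by (subst game_payoff_sum) (auto simp: mixed_def sum.distrib distrib_left)
  also have "(\<Sum>i<acts1 G k. \<Sum>j<acts2 G k. x $ i * y $ j * d) = (\<Sum>i<acts1 G k. x $ i) * (\<Sum>j<acts2 G k. y $ j) * d"
    by (subst sum_product) (simp only: sum_distrib_right)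
  also have "(\<Sum>i<acts1 G k. x $ i) * (\<Sum>j<acts2 G k. y $ j) * d = d" using x y by (simp add: mixed_def)
  finally show ?thesis .
qed

definition optimal_at :: "real \<Rightarrow> bool" where
  "optimal_at l \<longleftrightarrow> (\<forall>k\<in>K. \<exists>x\<in>mixed (acts1 G k). \<exists>y\<in>mixed (acts2 G k).
     (\<forall>y'\<in>mixed (acts2 G k). disc_value G l k \<le> game_payoff (local_game G k l (disc_value G l)) x y') \<and>
     (\<forall>x'\<in>mixed (acts1 G k). game_payoff (local_game G k l (disc_value G l)) x' y \<le> disc_value G l k))"

text \<open>The optimal strategies at \<open>l\<close> and \<open>m\<close>, played against each other, bound the difference of the
  values by that of the two local games. The part of the latter that comes from the continuation
  values is contracted by \<open>1 - l\<close> and can be absorbed.\<close>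
lemma disc_value_lipschitz:
  assumes l: "0 < l" "l \<le> 1" and m: "0 < m" "m \<le> 1" and ol: "optimal_at l" and om: "optimal_at m"
    and k: "k \<in> K" and C0: "0 \<le> C"
    and C: "\<And>k i j. k \<in> K \<Longrightarrow> i < acts1 G k \<Longrightarrow> j < acts2 G k \<Longrightarrow> \<bar>stage G k i j\<bar> \<le> C"
      "\<And>l k. 0 < l \<Longrightarrow> l \<le> 1 \<Longrightarrow> k \<in> K \<Longrightarrow> \<bar>disc_value G l k\<bar> \<le> C"
  shows "l * \<bar>disc_value G l k - disc_value G m k\<bar> \<le> 2 * C * \<bar>l - m\<bar>"
proof -
  define v where "v = disc_value G l"
  define w where "w = disc_value G m"
  define \<Delta> where "\<Delta> = Max ((\<lambda>k. \<bar>v k - w k\<bar>) ` K)"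
  have \<Delta>: "\<bar>v s - w s\<bar> \<le> \<Delta>" if "s \<in> K" for s
    unfolding \<Delta>_def using that by (intro Max_ge) auto
  define d where "d = 2 * C * \<bar>l - m\<bar> + (1 - l) * \<Delta>"
  have close: "\<bar>local_game G k l v $$ (i, j) - local_game G k m w $$ (i, j)\<bar> \<le> d"
    if k: "k \<in> K" and ij: "i < acts1 G k" "j < acts2 G k" for k i j
  proof -
    have e: "local_game G k l' z $$ (i, j) = l' * stage G k i j + (1 - l') * trans_avg k i j z" for l' z
      using ij by (simp add: local_game_def trans_avg_def)
    have tw: "\<bar>trans_avg k i j w\<bar> \<le> C"
      using C(2)[OF m] by (intro trans_avg_bounds[OF C0 C(1)] k ij) (auto simp: w_def)
    have "trans_avg k i j v - trans_avg k i j w = trans_avg k i j (\<lambda>s. v s - w s)"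
      by (simp only: trans_avg_def sum_subtractf right_diff_distrib)
    moreover have "trans_avg k i j (\<lambda>s. v s - w s) \<le> trans_avg k i j (\<lambda>_. \<Delta>)"
      "trans_avg k i j (\<lambda>_. - \<Delta>) \<le> trans_avg k i j (\<lambda>s. v s - w s)"
      using \<Delta> by (intro trans_avg_mono; force)+
    ultimately have t: "\<bar>trans_avg k i j v - trans_avg k i j w\<bar> \<le> \<Delta>"
      using trans_avg_const[OF k ij] by auto
    have "local_game G k l v $$ (i, j) - local_game G k m w $$ (i, j) =
        (l - m) * (stage G k i j - trans_avg k i j w) + (1 - l) * (trans_avg k i j v - trans_avg k i j w)"
      unfolding e by (simp add: algebra_simps)
    also have "\<bar>\<dots>\<bar> \<le> \<bar>l - m\<bar> * \<bar>stage G k i j - trans_avg k i j w\<bar> + (1 - l) * \<bar>trans_avg k i j v - trans_avg k i j w\<bar>"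
      using abs_triangle_ineq l by (metis abs_mult abs_of_nonneg diff_ge_0_iff_ge)
    also have "\<dots> \<le> \<bar>l - m\<bar> * (2 * C) + (1 - l) * \<Delta>"
      using C(1)[OF k ij] tw t l by (intro add_mono mult_left_mono) auto
    finally show ?thesis by (simp add: d_def mult_ac)
  qed
  have "\<bar>v k - w k\<bar> \<le> d" if k: "k \<in> K" for k
  proof -
    obtain x y where x: "x \<in> mixed (acts1 G k)" and y: "y \<in> mixed (acts2 G k)"
      and xy: "\<And>y'. y' \<in> mixed (acts2 G k) \<Longrightarrow> v k \<le> game_payoff (local_game G k l v) x y'"
        "\<And>x'. x' \<in> mixed (acts1 G k) \<Longrightarrow> game_payoff (local_game G k l v) x' y \<le> v k"
      using ol k unfolding optimal_at_def v_def by meson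
    obtain x' y' where x': "x' \<in> mixed (acts1 G k)" and y': "y' \<in> mixed (acts2 G k)"
      and xy': "\<And>y. y \<in> mixed (acts2 G k) \<Longrightarrow> w k \<le> game_payoff (local_game G k m w) x' y"
        "\<And>x. x \<in> mixed (acts1 G k) \<Longrightarrow> game_payoff (local_game G k m w) x y' \<le> w k"
      using om k unfolding optimal_at_def w_def by meson
    have "v k \<le> game_payoff (local_game G k l v) x y'" by (rule xy(1)[OF y'])
    also have "\<dots> \<le> game_payoff (local_game G k m w) x y' + d"
      using close[OF k] by (intro mixed_payoff_mono x y') (smt (verit))
    also have "\<dots> \<le> w k + d" using xy'(2)[OF x] by simp
    finally have 1: "v k \<le> w k + d" .
    have "w k \<le> game_payoff (local_game G k m w) x' y" by (rule xy'(1)[OF y])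
    also have "\<dots> \<le> game_payoff (local_game G k l v) x' y + d"
      using close[OF k] by (intro mixed_payoff_mono x' y) (smt (verit))
    also have "\<dots> \<le> v k + d" using xy(2)[OF x'] by simp
    finally show ?thesis using 1 by auto
  qed
  hence "\<Delta> \<le> d" unfolding \<Delta>_def using k by (intro Max.boundedI) auto
  hence "l * \<Delta> \<le> 2 * C * \<bar>l - m\<bar>" by (simp add: d_def algebra_simps)
  moreover have "l * \<bar>v k - w k\<bar> \<le> l * \<Delta>" using \<Delta>[OF k] l by (intro mult_left_mono) auto
  ultimately show ?thesis by (simp add: v_def w_def)
qed

lemma disc_value_continuous:
  assumes opt: "\<And>l. 0 < l \<Longrightarrow> l \<le> 1 \<Longrightarrow> optimal_at l" and k: "k \<in> K"
  shows "continuous_on {0<..<1} (\<lambda>l. disc_value G l k)"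
proof -
  obtain C where C: "0 \<le> C" "\<And>k i j. k \<in> K \<Longrightarrow> i < acts1 G k \<Longrightarrow> j < acts2 G k \<Longrightarrow> \<bar>stage G k i j\<bar> \<le> C"
    "\<And>l k. 0 < l \<Longrightarrow> l \<le> 1 \<Longrightarrow> k \<in> K \<Longrightarrow> \<bar>disc_value G l k\<bar> \<le> C"
    using disc_value_bounded by blast
  have "isCont (\<lambda>l. disc_value G l k) l" if l: "l \<in> {0<..<1}" for l
    unfolding isCont_def
  proof (rule LIM_zero_cancel, rule Lim_null_comparison)
    have "eventually (\<lambda>m. m \<in> {0<..<1}) (at l)"
      using l by (intro eventually_at_in_open') auto
    thus "eventually (\<lambda>m. norm (disc_value G m k - disc_value G l k) \<le> 2 * C * \<bar>l - m\<bar> / l) (at l)"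
    proof eventually_elim
      case (elim m)
      have "l * \<bar>disc_value G l k - disc_value G m k\<bar> \<le> 2 * C * \<bar>l - m\<bar>"
        using l elim by (intro disc_value_lipschitz opt k C) auto
      thus ?case using l by (simp add: field_simps abs_minus_commute)
    qed
    have "((\<lambda>m. 2 * C * \<bar>l - m\<bar> / l) \<longlongrightarrow> 2 * C * \<bar>l - l\<bar> / l) (at l)"
      using l by (intro tendsto_intros) auto
    thus "((\<lambda>m. 2 * C * \<bar>l - m\<bar> / l) \<longlongrightarrow> 0) (at l)" by simp
  qed
  thus ?thesis by (simp add: continuous_at_imp_continuous_on)
qed

end

section \<open>Kronecker determinants\<close>

text \<open>The digits of \<open>i\<close> in the mixed radix system with sizes \<open>d k\<close>, \<open>k\<close> in \<open>ks\<close>: they are the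
  indices, in each factor, of the entry with index \<open>i\<close> of a Kronecker product.\<close>
fun digits :: "(nat \<Rightarrow> nat) \<Rightarrow> nat list \<Rightarrow> nat \<Rightarrow> nat \<Rightarrow> nat" where
  "digits d [] i = (\<lambda>_. 0)"
| "digits d (k # ks) i =
     (digits d ks (i mod prod_list (map d ks)))(k := i div prod_list (map d ks))"

lemma div_mod_digit: "(e :: nat) < P \<Longrightarrow> (q * P + e) div P = q \<and> (q * P + e) mod P = e"
  by simp

lemma kron_index:
  assumes "A \<in> carrier_mat n m" "B \<in> carrier_mat n' m'"
  shows "kron A B \<in> carrier_mat (n * n') (m * m')"
    and "i < n * n' \<Longrightarrow> j < m * m' \<Longrightarrow>
      kron A B $$ (i, j) = A $$ (i div n', j div m') * B $$ (i mod n', j mod m')"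
  using assms by (auto simp: kron_def)

lemma digits_less:
  assumes "distinct ks" "i < prod_list (map d ks)" "k \<in> set ks"
  shows "digits d ks i k < d k"
  using assms
proof (induction ks arbitrary: i)
  case (Cons k' ks)
  let ?P = "prod_list (map d ks)"
  have "0 < ?P" using Cons.prems(2) by (cases "?P = 0") auto
  thus ?case using Cons by (auto simp: less_mult_imp_div_less mult.commute)
qed simp

lemma sum_digits:
  fixes f :: "nat \<Rightarrow> nat \<Rightarrow> 'a::comm_ring_1"
  assumes "distinct ks"
  shows "(\<Sum>i<prod_list (map d ks). \<Prod>k\<leftarrow>ks. f k (digits d ks i k)) = (\<Prod>k\<leftarrow>ks. \<Sum>b<d k. f k b)"
  using assms
proof (induction ks)
  case (Cons k ks)
  let ?P = "prod_list (map d ks)"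
  have eq: "(\<Prod>k'\<leftarrow>ks. f k' (digits d (k # ks) i k')) = (\<Prod>k'\<leftarrow>ks. f k' (digits d ks (i mod ?P) k'))" for i
    using Cons.prems by (intro arg_cong[of _ _ prod_list] map_cong) auto
  have "(\<Sum>i<d k * ?P. \<Prod>k'\<leftarrow>k # ks. f k' (digits d (k # ks) i k')) =
      (\<Sum>i<d k * ?P. f k (i div ?P) * (\<Prod>k'\<leftarrow>ks. f k' (digits d ks (i mod ?P) k')))"
    using eq by simp
  also have "\<dots> = (\<Sum>a<d k. \<Sum>b<?P. f k a * (\<Prod>k'\<leftarrow>ks. f k' (digits d ks b k')))"
  proof (cases "?P = 0")
    case False
    hence Ppos: "0 < ?P" by (rule neq0_conv[THEN iffD1])
    have lt: "a * ?P + b < d k * ?P" if "a < d k" "b < ?P" for a b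
    proof -
      have "Suc a * ?P \<le> d k * ?P" using that(1) by (intro mult_right_mono) auto
      thus ?thesis using that(2) by simp
    qed
    have "(\<Sum>i<d k * ?P. f k (i div ?P) * (\<Prod>k'\<leftarrow>ks. f k' (digits d ks (i mod ?P) k'))) =
      (\<Sum>(a, b)\<in>{..<d k} \<times> {..<?P}. f k a * (\<Prod>k'\<leftarrow>ks. f k' (digits d ks b k')))"
      by (rule sum.reindex_bij_witness[where i = "\<lambda>(a, b). a * ?P + b" and j = "\<lambda>i. (i div ?P, i mod ?P)"])
        (use False lt in \<open>auto simp: less_mult_imp_div_less mod_less_divisor[OF Ppos]\<close>)
    thus ?thesis by (simp add: sum.cartesian_product)
  next
    case True
    show ?thesis unfolding True by simp
  qed
  also have "\<dots> = (\<Prod>k'\<leftarrow>k # ks. \<Sum>b<d k'. f k' b)"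
    using Cons by (simp add: sum_product[symmetric])
  finally show ?case by simp
qed simp

lemma foldr_kron_index:
  assumes "distinct ks" "\<And>k. k \<in> set ks \<Longrightarrow> B k \<in> carrier_mat (r k) (c k)"
  shows "foldr kron (map B ks) (1\<^sub>m 1) \<in> carrier_mat (prod_list (map r ks)) (prod_list (map c ks)) \<and>
    (\<forall>i<prod_list (map r ks). \<forall>j<prod_list (map c ks).
      foldr kron (map B ks) (1\<^sub>m 1) $$ (i, j) = (\<Prod>k\<leftarrow>ks. B k $$ (digits r ks i k, digits c ks j k)))"
  using assms
proof (induction ks)
  case (Cons k ks)
  let ?R = "prod_list (map r ks)" and ?C = "prod_list (map c ks)"
  let ?K = "foldr kron (map B ks) (1\<^sub>m 1)"
  have IH: "?K \<in> carrier_mat ?R ?C"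
    "\<And>i j. i < ?R \<Longrightarrow> j < ?C \<Longrightarrow> ?K $$ (i, j) = (\<Prod>k\<leftarrow>ks. B k $$ (digits r ks i k, digits c ks j k))"
    using Cons by auto
  have Bk: "B k \<in> carrier_mat (r k) (c k)" using Cons.prems by simp
  have "kron (B k) ?K $$ (i, j) = (\<Prod>k'\<leftarrow>k # ks. B k' $$ (digits r (k # ks) i k', digits c (k # ks) j k'))"
    if ij: "i < r k * ?R" "j < c k * ?C" for i j
  proof -
    have pos: "0 < ?R" "0 < ?C" using ij by (auto intro: Nat.gr0I)
    have "(\<Prod>k'\<leftarrow>ks. B k' $$ (digits r ks (i mod ?R) k', digits c ks (j mod ?C) k')) =
        (\<Prod>k'\<leftarrow>ks. B k' $$ (digits r (k # ks) i k', digits c (k # ks) j k'))"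
      using Cons.prems(1) by (intro arg_cong[of _ _ prod_list] map_cong) auto
    moreover have "kron (B k) ?K $$ (i, j) = B k $$ (i div ?R, j div ?C) * ?K $$ (i mod ?R, j mod ?C)"
      by (rule kron_index(2)[OF Bk IH(1) ij])
    ultimately show ?thesis using IH(2)[of "i mod ?R" "j mod ?C"] pos by simp
  qed
  moreover have "kron (B k) ?K \<in> carrier_mat (r k * ?R) (c k * ?C)"
    by (rule kron_index(1)[OF Bk IH(1)])
  ultimately show ?case by simp
qed auto

text \<open>Renumbering of the columns \<open>1, \<dots>, n\<close> that remain once column \<open>c\<close> of \<open>0, \<dots>, n\<close> is removed.\<close>
definition skip :: "nat \<Rightarrow> nat \<Rightarrow> nat" where "skip c j = (if j \<le> c then j - 1 else j)"

text \<open>The auxiliary matrices of an array of scalars. By \<open>aux_matrix_index\<close>, every entry of an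
  auxiliary matrix is of this form.\<close>
definition array_minor :: "nat \<Rightarrow> (nat \<Rightarrow> nat \<Rightarrow> 'a::comm_ring_1) \<Rightarrow> nat \<Rightarrow> 'a" where
  "array_minor n a c = (- 1) ^ c *
     (\<Sum>\<sigma> | \<sigma> permutes {1..n}. signof \<sigma> * (\<Prod>k\<in>{1..n}. a k (skip c (\<sigma> k))))"

lemma array_minor_cong:
  "(\<And>k c. k \<in> {1..n} \<Longrightarrow> c \<le> n \<Longrightarrow> a k c = b k c) \<Longrightarrow> array_minor n a l = array_minor n b l"
  unfolding array_minor_def
proof (intro arg_cong2[where f = "(*)"] sum.cong prod.cong refl)
  fix \<sigma> k assume eq: "\<And>k c. k \<in> {1..n} \<Longrightarrow> c \<le> n \<Longrightarrow> a k c = b k c"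
    and "\<sigma> \<in> {\<sigma>. \<sigma> permutes {1..n}}" and k: "k \<in> {1..n}"
  hence "\<sigma> k \<in> {1..n}" using permutes_in_image[of \<sigma>] by blast
  thus "a k (skip l (\<sigma> k)) = b k (skip l (\<sigma> k))" using k by (intro eq) (auto simp: skip_def)
qed

lemma array_minor_det:
  "array_minor n a l = (- 1) ^ l * det (mat n n (\<lambda>(i, j). a (Suc i) (skip l (Suc j))))"
proof -
  let ?M = "mat n n (\<lambda>(i, j). a (Suc i) (skip l (Suc j)))"
  have bij: "bij_betw Suc {0..<n} {1..n}"
    by (rule bij_betw_byWitness[of _ "\<lambda>x. x - 1"]) auto
  have "(\<Sum>\<sigma> | \<sigma> permutes {1..n}. signof \<sigma> * (\<Prod>k\<in>{1..n}. a k (skip l (\<sigma> k)))) =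
      (\<Sum>p | p permutes {0..<n}. signof p * (\<Prod>i = 0..<n. ?M $$ (i, p i)))"
  proof (rule sum.reindex_bij_witness[symmetric, where
        i = "\<lambda>\<sigma>. map_permutation {1..n} (\<lambda>x. x - 1) \<sigma>" and j = "map_permutation {0..<n} Suc"])
    fix p assume p: "p \<in> {p. p permutes {0..<n}}"
    show "map_permutation {0..<n} Suc p \<in> {\<sigma>. \<sigma> permutes {1..n}}"
      using map_permutation_permutes[OF bij] p by blast
    show "map_permutation {1..n} (\<lambda>x. x - 1) (map_permutation {0..<n} Suc p) = p"
      using p by (intro map_permutation_compose_inv[OF bij]) auto
    have "signof (map_permutation {0..<n} Suc p) = (signof p :: 'a)"
      using p by (simp add: sign_map_permutation)
    moreover have "(\<Prod>k\<in>{1..n}. a k (skip l (map_permutation {0..<n} Suc p k))) =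
        (\<Prod>i = 0..<n. ?M $$ (i, p i))"
    proof (rule prod.reindex_bij_betw[OF bij, symmetric, THEN trans])
      show "(\<Prod>i = 0..<n. a (Suc i) (skip l (map_permutation {0..<n} Suc p (Suc i)))) =
        (\<Prod>i = 0..<n. ?M $$ (i, p i))"
        using p permutes_in_image[of p "{0..<n}"]
        by (intro prod.cong refl) (auto simp: map_permutation_apply)
    qed
    ultimately show "signof (map_permutation {0..<n} Suc p) * (\<Prod>k\<in>{1..n}. a k (skip l (map_permutation {0..<n} Suc p k)))
        = signof p * (\<Prod>i = 0..<n. ?M $$ (i, p i))" by simp
  next
    fix \<sigma> assume \<sigma>: "\<sigma> \<in> {\<sigma>. \<sigma> permutes {1..n}}"
    have bij': "bij_betw (\<lambda>x. x - 1) {1..n} {0..<n}"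
      by (rule bij_betw_byWitness[of _ Suc]) auto
    show "map_permutation {1..n} (\<lambda>x. x - 1) \<sigma> \<in> {p. p permutes {0..<n}}"
      using map_permutation_permutes[OF bij'] \<sigma> by blast
    show "map_permutation {0..<n} Suc (map_permutation {1..n} (\<lambda>x. x - 1) \<sigma>) = \<sigma>"
      using \<sigma> by (intro map_permutation_compose_inv[OF bij']) auto
  qed
  thus ?thesis unfolding array_minor_def by (simp add: det_def)
qed

text \<open>Put the row \<open>(z\<^sub>l, 0, \<dots>, -1, \<dots>, 0)\<close>, with \<open>-1\<close> in column \<open>l\<close>, on top of the array. The
  resulting square matrix annihilates \<open>z\<close>, and the expansion of its determinant along this row is
  the claim.\<close>
lemma array_minor_cramer:
  fixes a :: "nat \<Rightarrow> nat \<Rightarrow> 'a::field"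
  assumes z: "\<And>k. k \<in> {1..n} \<Longrightarrow> (\<Sum>c\<le>n. z c * a k c) = 0" and z0: "z 0 = 1" and l: "l \<le> n"
  shows "array_minor n a l = z l * array_minor n a 0"
proof (cases "l = 0")
  case False
  define row0 :: "nat \<Rightarrow> 'a" where "row0 c = (if c = 0 then z l else if c = l then - 1 else 0)" for c
  define W where "W = mat (Suc n) (Suc n) (\<lambda>(i, j). if i = 0 then row0 j else a i j)"
  have W: "W \<in> carrier_mat (Suc n) (Suc n)" by (simp add: W_def)
  define v where "v = vec (Suc n) z"
  have "W *\<^sub>v v = 0\<^sub>v (Suc n)"
  proof (rule eq_vecI)
    fix i assume "i < dim_vec (0\<^sub>v (Suc n))"
    hence i: "i < Suc n" by simp
    have "(W *\<^sub>v v) $ i = (\<Sum>c\<le>n. z c * (if i = 0 then row0 c else a i c))"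
      using i by (simp add: W_def v_def scalar_prod_def lessThan_atLeast0[symmetric] lessThan_Suc_atMost mult.commute)
    also have "\<dots> = 0"
    proof (cases "i = 0")
      case True
      have "(\<Sum>c\<le>n. z c * row0 c) = (\<Sum>c\<in>{0, l}. z c * row0 c)"
        using l by (intro sum.mono_neutral_right) (auto simp: row0_def)
      thus ?thesis using True False z0 by (simp add: row0_def)
    next
      case False
      thus ?thesis using z[of i] i by simp
    qed
    finally show "(W *\<^sub>v v) $ i = 0\<^sub>v (Suc n) $ i" using i by simp
  qed (simp add: W_def)
  moreover have "v \<noteq> 0\<^sub>v (Suc n)"
  proof
    assume "v = 0\<^sub>v (Suc n)"
    hence "v $ 0 = 0" by simp
    thus False using z0 by (simp add: v_def)
  qed
  moreover have "v \<in> carrier_vec (Suc n)" by (simp add: v_def)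
  ultimately have "det W = 0" using det_0_iff_vec_prod_zero[OF W] by blast
  moreover have cof: "cofactor W 0 c = array_minor n a c" if "c \<le> n" for c
  proof -
    have "mat_delete W 0 c = mat n n (\<lambda>(i, j). a (Suc i) (skip c (Suc j)))"
      using that by (intro eq_matI) (auto simp: mat_delete_def W_def skip_def)
    thus ?thesis by (simp add: cofactor_def array_minor_det)
  qed
  have W0: "W $$ (0, c) = row0 c" if "c \<le> n" for c using that by (simp add: W_def)
  have "det W = (\<Sum>c<Suc n. W $$ (0, c) * cofactor W 0 c)"
    by (rule laplace_expansion_row[OF W]) simp
  also have "\<dots> = (\<Sum>c\<le>n. row0 c * array_minor n a c)"
    unfolding lessThan_Suc_atMost by (intro sum.cong) (simp_all add: W0 cof)
  also have "\<dots> = (\<Sum>c\<in>{0, l}. row0 c * array_minor n a c)"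
    using l by (intro sum.mono_neutral_right) (auto simp: row0_def)
  also have "\<dots> = z l * array_minor n a 0 - array_minor n a l" using False by (simp add: row0_def)
  finally show ?thesis using \<open>det W = 0\<close> by simp
qed (simp add: z0)

lemma array_minor_0_nonzero:
  fixes a :: "nat \<Rightarrow> nat \<Rightarrow> 'a::field"
  assumes "\<And>z. (\<And>k. k \<in> {1..n} \<Longrightarrow> (\<Sum>c\<in>{1..n}. z c * a k c) = 0) \<Longrightarrow> (\<forall>c\<in>{1..n}. z c = 0)"
  shows "array_minor n a 0 \<noteq> 0"
proof
  assume "array_minor n a 0 = 0"
  hence "det (mat n n (\<lambda>(i, j). a (Suc i) (Suc j))) = 0" (is "det ?M = 0")
    by (simp add: array_minor_det skip_def)
  then obtain v where v: "v \<in> carrier_vec n" "v \<noteq> 0\<^sub>v n" "?M *\<^sub>v v = 0\<^sub>v n"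
    using det_0_iff_vec_prod_zero[of ?M n] by auto
  define z where "z c = v $ (c - 1)" for c
  have "(\<Sum>c\<in>{1..n}. z c * a k c) = 0" if k: "k \<in> {1..n}" for k
  proof -
    have "(\<Sum>c\<in>{1..n}. z c * a k c) = (\<Sum>j = 0..<n. v $ j * a k (Suc j))"
      by (rule sum.reindex_bij_witness[of _ Suc "\<lambda>c. c - 1"]) (auto simp: z_def)
    also have "\<dots> = (?M *\<^sub>v v) $ (k - 1)"
      using k v(1) by (auto simp: scalar_prod_def mult.commute intro!: sum.cong)
    also have "\<dots> = 0" unfolding v(3) by (rule index_zero_vec) (use k in auto)
    finally show ?thesis .
  qed
  hence "\<forall>c\<in>{1..n}. z c = 0" using assms by blast
  hence "v $ i = 0" if "i < n" for i using that by (auto simp: z_def dest!: bspec[of _ _ "Suc i"])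
  hence "v = 0\<^sub>v n" using v(1) by (intro eq_vecI) auto
  with v(2) show False by blast
qed

lemma prod_list_upt: "prod_list (map f [1..<Suc n]) = (\<Prod>k\<in>{1..n}. f k)"
  using prod.distinct_set_conv_list[of "[1..<Suc n]" f] by (simp add: atLeastLessThanSuc_atLeastAtMost del: upt_Suc)

abbreviation dg :: "(nat \<Rightarrow> nat) \<Rightarrow> nat \<Rightarrow> nat \<Rightarrow> nat \<Rightarrow> nat" where
  "dg d n \<equiv> digits d [1..<Suc n]"

lemma aux_matrix_index:
  assumes n: "1 \<le> n" and D: "\<And>k c. k \<in> {1..n} \<Longrightarrow> c \<le> n \<Longrightarrow> D k c \<in> carrier_mat (r k) (s k)"
  shows "aux_matrix n D c \<in> carrier_mat (\<Prod>k\<in>{1..n}. r k) (\<Prod>k\<in>{1..n}. s k)"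
    and "c \<le> n \<Longrightarrow> i < (\<Prod>k\<in>{1..n}. r k) \<Longrightarrow> j < (\<Prod>k\<in>{1..n}. s k) \<Longrightarrow>
      aux_matrix n D c $$ (i, j) = array_minor n (\<lambda>k l. D k l $$ (dg r n i k, dg s n j k)) c"
proof -
  have dims: "dim_row (D k (skip c 1)) = r k" "dim_col (D k (skip c 1)) = s k" if "k \<in> {1..n}" for k
    using D[OF that, of "skip c 1"] n by (auto simp: skip_def)
  have dimR: "(\<Prod>k = 1..n. dim_row (D k (skip c 1))) = (\<Prod>k\<in>{1..n}. r k)"
    and dimC: "(\<Prod>k = 1..n. dim_col (D k (skip c 1))) = (\<Prod>k\<in>{1..n}. s k)"
    by (rule prod.cong[OF refl dims(1)], assumption, rule prod.cong[OF refl dims(2)], assumption)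
  have aux: "aux_matrix n D c = (- 1) ^ c \<cdot>\<^sub>m kron_det n (\<lambda>k j. D k (skip c j))"
    by (simp add: aux_matrix_def skip_def)
  show "aux_matrix n D c \<in> carrier_mat (\<Prod>k\<in>{1..n}. r k) (\<Prod>k\<in>{1..n}. s k)"
    unfolding aux kron_det_def dimR dimC by simp
  assume c: "c \<le> n" and ij: "i < (\<Prod>k\<in>{1..n}. r k)" "j < (\<Prod>k\<in>{1..n}. s k)"
  have "foldr kron (map (\<lambda>k. D k (skip c (\<sigma> k))) [1..<Suc n]) (1\<^sub>m 1) $$ (i, j) =
      (\<Prod>k\<in>{1..n}. D k (skip c (\<sigma> k)) $$ (dg r n i k, dg s n j k))" if \<sigma>: "\<sigma> permutes {1..n}" for \<sigma>
  proof -
    have "D k (skip c (\<sigma> k)) \<in> carrier_mat (r k) (s k)" if "k \<in> set [1..<Suc n]" for k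
    proof -
      have k: "k \<in> {1..n}" using that by auto
      hence "\<sigma> k \<in> {1..n}" using permutes_in_image[OF \<sigma>] by blast
      thus ?thesis using k c by (intro D) (auto simp: skip_def)
    qed
    from foldr_kron_index[OF distinct_upt this] show ?thesis
      unfolding prod_list_upt using ij by (simp only: prod_list_upt)
  qed
  hence "kron_det n (\<lambda>k j. D k (skip c j)) $$ (i, j) =
      (\<Sum>\<sigma> | \<sigma> permutes {1..n}. signof \<sigma> * (\<Prod>k\<in>{1..n}. D k (skip c (\<sigma> k)) $$ (dg r n i k, dg s n j k)))"
    unfolding kron_det_def dimR dimC using ij by (subst index_mat(1)) (auto simp del: upt_Suc One_nat_def intro!: sum.cong)
  moreover have "kron_det n (\<lambda>k j. D k (skip c j)) \<in> carrier_mat (\<Prod>k\<in>{1..n}. r k) (\<Prod>k\<in>{1..n}. s k)"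
    unfolding kron_det_def dimR dimC by simp
  ultimately show "aux_matrix n D c $$ (i, j) = array_minor n (\<lambda>k l. D k l $$ (dg r n i k, dg s n j k)) c"
    unfolding aux array_minor_def using ij by simp
qed

lemma sum_dg:
  fixes f :: "nat \<Rightarrow> nat \<Rightarrow> 'a::comm_ring_1"
  shows "(\<Sum>i<(\<Prod>k\<in>{1..n}. d k). \<Prod>k\<in>{1..n}. f k (dg d n i k)) = (\<Prod>k\<in>{1..n}. \<Sum>b<d k. f k b)"
  using sum_digits[OF distinct_upt[of 1 "Suc n"], where d = d and f = f] unfolding prod_list_upt .

lemma dg_less: "i < (\<Prod>k\<in>{1..n}. d k) \<Longrightarrow> k \<in> {1..n} \<Longrightarrow> dg d n i k < d k"
  using digits_less[OF distinct_upt[of 1 "Suc n"], of i d k] unfolding prod_list_upt by (auto simp del: upt_Suc)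

text \<open>Kronecker products multiply factor by factor: summing against a product vector amounts to
  applying its factors within the entries of the array.\<close>
lemma array_minor_contract:
  fixes a :: "nat \<Rightarrow> nat \<Rightarrow> nat \<Rightarrow> 'a::comm_ring_1"
  shows "(\<Sum>j<(\<Prod>k\<in>{1..n}. d k). array_minor n (\<lambda>k c. a k c (dg d n j k)) l * (\<Prod>k\<in>{1..n}. y k (dg d n j k)))
    = array_minor n (\<lambda>k c. \<Sum>b<d k. a k c b * y k b) l"
proof -
  have "(\<Sum>j<(\<Prod>k\<in>{1..n}. d k). array_minor n (\<lambda>k c. a k c (dg d n j k)) l * (\<Prod>k\<in>{1..n}. y k (dg d n j k))) =
    (- 1) ^ l * (\<Sum>j<(\<Prod>k\<in>{1..n}. d k). \<Sum>\<sigma> | \<sigma> permutes {1..n}. signof \<sigma> *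
      (\<Prod>k\<in>{1..n}. a k (skip l (\<sigma> k)) (dg d n j k) * y k (dg d n j k)))"
    unfolding array_minor_def prod.distrib
    by (simp only: sum_distrib_left sum_distrib_right mult.assoc)
  also have "\<dots> = (- 1) ^ l * (\<Sum>\<sigma> | \<sigma> permutes {1..n}. signof \<sigma> * (\<Sum>j<(\<Prod>k\<in>{1..n}. d k).
      (\<Prod>k\<in>{1..n}. a k (skip l (\<sigma> k)) (dg d n j k) * y k (dg d n j k))))"
    by (subst sum.swap) (simp only: sum_distrib_left)
  also have "\<dots> = array_minor n (\<lambda>k c. \<Sum>b<d k. a k c b * y k b) l"
    unfolding array_minor_def
    by (intro arg_cong2[where f = "(*)"] sum.cong refl sum_dg)
  finally show ?thesis .
qed

text \<open>The position, among the indices with digits below \<open>d\<close>, of the index whose digits are the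
  images under \<open>f\<close> of the digits of \<open>i\<close>. It is increasing if each \<open>f k\<close> is, so that submatrices of
  the factors yield a genuine submatrix of the Kronecker product, with no permutation of the rows.\<close>
fun embed :: "(nat \<Rightarrow> nat) \<Rightarrow> (nat \<Rightarrow> nat) \<Rightarrow> (nat \<Rightarrow> nat \<Rightarrow> nat) \<Rightarrow> nat list \<Rightarrow> nat \<Rightarrow> nat" where
  "embed d' d f [] i = 0"
| "embed d' d f (k # ks) i = f k (i div prod_list (map d' ks)) * prod_list (map d ks)
     + embed d' d f ks (i mod prod_list (map d' ks))"

lemma embed:
  assumes "distinct ks"
    and "\<And>k i. k \<in> set ks \<Longrightarrow> i < d' k \<Longrightarrow> f k i < d k"
    and "\<And>k i i'. k \<in> set ks \<Longrightarrow> i < i' \<Longrightarrow> i' < d' k \<Longrightarrow> f k i < f k i'"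
  shows "i < prod_list (map d' ks) \<Longrightarrow> embed d' d f ks i < prod_list (map d ks)"
    and "i < prod_list (map d' ks) \<Longrightarrow> k \<in> set ks \<Longrightarrow> digits d ks (embed d' d f ks i) k = f k (digits d' ks i k)"
    and "i < i' \<Longrightarrow> i' < prod_list (map d' ks) \<Longrightarrow> embed d' d f ks i < embed d' d f ks i'"
proof -
  have "(\<forall>i<prod_list (map d' ks). embed d' d f ks i < prod_list (map d ks)) \<and>
    (\<forall>i<prod_list (map d' ks). \<forall>k\<in>set ks. digits d ks (embed d' d f ks i) k = f k (digits d' ks i k)) \<and>
    (\<forall>i'<prod_list (map d' ks). \<forall>i<i'. embed d' d f ks i < embed d' d f ks i')"
    using assms
  proof (induction ks)
    case (Cons k ks)
    let ?P = "prod_list (map d ks)" and ?P' = "prod_list (map d' ks)"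
    have IH: "\<And>i. i < ?P' \<Longrightarrow> embed d' d f ks i < ?P"
      "\<And>i k. i < ?P' \<Longrightarrow> k \<in> set ks \<Longrightarrow> digits d ks (embed d' d f ks i) k = f k (digits d' ks i k)"
      "\<And>i i'. i' < ?P' \<Longrightarrow> i < i' \<Longrightarrow> embed d' d f ks i < embed d' d f ks i'"
      using Cons by auto
    have pos: "0 < ?P'" if "i < d' k * ?P'" for i using that by (cases "?P' = 0") auto
    have div: "i div ?P' < d' k" if "i < d' k * ?P'" for i using that by (simp add: less_mult_imp_div_less)
    have low: "embed d' d f ks (i mod ?P') < ?P" if "i < d' k * ?P'" for i using IH(1) pos[OF that] by simp
    have 1: "embed d' d f (k # ks) i < d k * ?P" if i: "i < d' k * ?P'" for i
    proof -
      have "f k (i div ?P') < d k" using Cons.prems(2) div[OF i] by simp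
      hence "Suc (f k (i div ?P')) * ?P \<le> d k * ?P" by (intro mult_right_mono) auto
      thus ?thesis using low[OF i] by simp
    qed
    have 2: "digits d (k # ks) (embed d' d f (k # ks) i) k0 = f k0 (digits d' (k # ks) i k0)"
      if i: "i < d' k * ?P'" and k0: "k0 \<in> set (k # ks)" for i k0
    proof -
      let ?e = "embed d' d f ks (i mod ?P')"
      have "(f k (i div ?P') * ?P + ?e) div ?P = f k (i div ?P')"
        "(f k (i div ?P') * ?P + ?e) mod ?P = ?e"
        using div_mod_digit[OF low[OF i]] by blast+
      thus ?thesis using IH(2)[of "i mod ?P'" k0] pos[OF i] k0 Cons.prems(1) by auto
    qed
    have 3: "embed d' d f (k # ks) i < embed d' d f (k # ks) i'" if i': "i' < d' k * ?P'" and ii: "i < i'" for i i'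
    proof (cases "i div ?P' = i' div ?P'")
      case True
      hence "i mod ?P' < i' mod ?P'" using ii
        by (metis add_less_cancel_left mult_div_mod_eq)
      thus ?thesis using True IH(3)[of "i' mod ?P'" "i mod ?P'"] pos[OF i'] by simp
    next
      case False
      hence "i div ?P' < i' div ?P'" using ii div_le_mono[of i i' ?P'] by simp
      hence "f k (i div ?P') < f k (i' div ?P')" using Cons.prems(3) div[OF i'] by simp
      hence "Suc (f k (i div ?P')) * ?P \<le> f k (i' div ?P') * ?P" by (intro mult_right_mono) auto
      thus ?thesis using low[of i] ii i' by simp
    qed
    show ?case using 1 2 3 by (simp del: embed.simps digits.simps)
  qed simp
  thus "i < prod_list (map d' ks) \<Longrightarrow> embed d' d f ks i < prod_list (map d ks)"
    "i < prod_list (map d' ks) \<Longrightarrow> k \<in> set ks \<Longrightarrow> digits d ks (embed d' d f ks i) k = f k (digits d' ks i k)"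
    "i < i' \<Longrightarrow> i' < prod_list (map d' ks) \<Longrightarrow> embed d' d f ks i < embed d' d f ks i'"
    by blast+
qed

lemma pick_image:
  assumes mono: "\<And>i i'. i < i' \<Longrightarrow> i' < N \<Longrightarrow> \<phi> i < (\<phi> i' :: nat)" and R: "R \<subseteq> {..<N}" and i: "i < card R"
  shows "pick (\<phi> ` R) i = \<phi> (pick R i)"
proof -
  have p: "pick R i \<in> R" by (rule pick_in_set) (use i in simp)
  have iff: "\<phi> x < \<phi> y \<longleftrightarrow> x < y" if "x \<in> R" "y \<in> R" for x y
    using mono[of x y] mono[of y x] that R by (metis lessThan_iff linorder_neqE_nat not_less_iff_gr_or_eq subsetD)
  have inj: "inj_on \<phi> R" by (rule inj_onI) (metis iff less_irrefl linorder_neqE_nat)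
  have "{a \<in> \<phi> ` R. a < \<phi> (pick R i)} = \<phi> ` {a \<in> R. a < pick R i}" using iff p by auto
  hence "card {a \<in> \<phi> ` R. a < \<phi> (pick R i)} = card {a \<in> R. a < pick R i}"
    using inj by (metis (no_types, lifting) card_image inj_on_subset mem_Collect_eq subsetI)
  also have "\<dots> = i" by (rule card_pick) (use i in simp)
  finally have "card {a \<in> \<phi> ` R. a < \<phi> (pick R i)} = i" .
  with pick_card_in_set[of "\<phi> (pick R i)" "\<phi> ` R"] p show ?thesis by simp
qed

lemma submatrix_image:
  assumes A': "A' \<in> carrier_mat N M" and A: "A \<in> carrier_mat N' M'"
    and \<phi>: "\<And>i i'. i < i' \<Longrightarrow> i' < N \<Longrightarrow> \<phi> i < \<phi> i'" "\<And>i. i < N \<Longrightarrow> \<phi> i < N'"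
    and \<psi>: "\<And>i i'. i < i' \<Longrightarrow> i' < M \<Longrightarrow> \<psi> i < \<psi> i'" "\<And>i. i < M \<Longrightarrow> \<psi> i < M'"
    and e: "\<And>i j. i < N \<Longrightarrow> j < M \<Longrightarrow> A' $$ (i, j) = A $$ (\<phi> i, \<psi> j)"
    and R: "R \<subseteq> {..<N}" and C: "C \<subseteq> {..<M}"
  shows "submatrix A' R C = submatrix A (\<phi> ` R) (\<psi> ` C)" "card (\<phi> ` R) = card R" "card (\<psi> ` C) = card C"
proof -
  have inj: "inj_on f R" if mono: "\<And>i i'. i < i' \<Longrightarrow> i' < N \<Longrightarrow> f i < f i'" and sub: "R \<subseteq> {..<N}"
    for f :: "nat \<Rightarrow> nat" and R N
  proof (rule linorder_inj_onI)
    fix x y assume "x < y" "y \<in> R"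
    thus "f x \<noteq> f y" using mono[of x y] sub by auto
  qed auto
  show cR: "card (\<phi> ` R) = card R" using inj[OF \<phi>(1) R] by (rule card_image)
  show cC: "card (\<psi> ` C) = card C" using inj[OF \<psi>(1) C] by (rule card_image)
  have rows: "{i. i < dim_row A' \<and> i \<in> R} = R" "{j. j < dim_col A' \<and> j \<in> C} = C"
    "{i. i < dim_row A \<and> i \<in> \<phi> ` R} = \<phi> ` R" "{j. j < dim_col A \<and> j \<in> \<psi> ` C} = \<psi> ` C"
    using A A' R C \<phi>(2) \<psi>(2) by auto
  show "submatrix A' R C = submatrix A (\<phi> ` R) (\<psi> ` C)"
    unfolding submatrix_def rows cR cC
  proof (rule cong_mat[OF refl refl])
    fix i j assume ij: "i < card R" "j < card C"
    have "pick R i \<in> R" "pick C j \<in> C" using ij by (auto intro: pick_in_set)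
    hence "A' $$ (pick R i, pick C j) = A $$ (\<phi> (pick R i), \<psi> (pick C j))" using e R C by blast
    thus "(case (i, j) of (i, j) \<Rightarrow> A' $$ (pick R i, pick C j)) =
        (case (i, j) of (i, j) \<Rightarrow> A $$ (pick (\<phi> ` R) i, pick (\<psi> ` C) j))"
      using pick_image[OF \<phi>(1) R ij(1)] pick_image[OF \<psi>(1) C ij(2)] by simp
  qed
qed

section \<open>Minors of matrix pencils\<close>

lemma submatrix_carrier:
  assumes "A \<in> carrier_mat N M" "R \<subseteq> {..<N}" "C \<subseteq> {..<M}"
  shows "submatrix A R C \<in> carrier_mat (card R) (card C)"
    and "i < card R \<Longrightarrow> j < card C \<Longrightarrow> submatrix A R C $$ (i, j) = A $$ (pick R i, pick C j)"
proof -
  have "{i. i < dim_row A \<and> i \<in> R} = R" "{j. j < dim_col A \<and> j \<in> C} = C" using assms by auto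
  thus "submatrix A R C \<in> carrier_mat (card R) (card C)"
    "i < card R \<Longrightarrow> j < card C \<Longrightarrow> submatrix A R C $$ (i, j) = A $$ (pick R i, pick C j)"
    by (simp_all add: submatrix_def)
qed

lemma pick_bij: "finite S \<Longrightarrow> bij_betw (pick S) {..<card S} S"
proof -
  assume S: "finite S"
  have inj: "inj_on (pick S) {..<card S}"
  proof (rule linorder_inj_onI)
    fix x y assume "x < y" "y \<in> {..<card S}"
    thus "pick S x \<noteq> pick S y" using pick_mono[of y S x] by auto
  qed auto
  moreover have "pick S ` {..<card S} \<subseteq> S" by (auto intro: pick_in_set)
  ultimately have "pick S ` {..<card S} = S"
    using S by (intro card_subset_eq) (auto simp: card_image)
  with inj show ?thesis by (simp add: bij_betw_def)
qed

text \<open>A weak form of the Cauchy-Binet formula. The determinant of \<open>X W\<close> expands multilinearly into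
  determinants of matrices made of rows of \<open>W\<close>; one of them is not zero, so its rows are distinct,
  and sorting them only changes the sign.\<close>
lemma nonsingular_product_rows:
  fixes X W :: "'a::idom mat"
  assumes X: "X \<in> carrier_mat s N" and W: "W \<in> carrier_mat N s" and d: "det (X * W) \<noteq> 0"
  shows "\<exists>R\<subseteq>{..<N}. card R = s \<and> det (submatrix W R {..<s}) \<noteq> 0"
proof -
  have XW: "X * W = mat\<^sub>r s s (\<lambda>i. finsum_vec TYPE('a) s (\<lambda>j. X $$ (i, j) \<cdot>\<^sub>v row W j) {..<N})"
  proof (rule eq_matI)
    fix i j assume "i < dim_row (mat\<^sub>r s s (\<lambda>i. finsum_vec TYPE('a) s (\<lambda>j. X $$ (i, j) \<cdot>\<^sub>v row W j) {..<N}))"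
      "j < dim_col (mat\<^sub>r s s (\<lambda>i. finsum_vec TYPE('a) s (\<lambda>j. X $$ (i, j) \<cdot>\<^sub>v row W j) {..<N}))"
    hence ij: "i < s" "j < s" by auto
    have "finsum_vec TYPE('a) s (\<lambda>j. X $$ (i, j) \<cdot>\<^sub>v row W j) {..<N} $ j = (\<Sum>k<N. X $$ (i, k) * W $$ (k, j))"
      using W ij by (subst index_finsum_vec) (auto intro!: sum.cong)
    thus "(X * W) $$ (i, j) = mat\<^sub>r s s (\<lambda>i. finsum_vec TYPE('a) s (\<lambda>j. X $$ (i, j) \<cdot>\<^sub>v row W j) {..<N}) $$ (i, j)"
      using ij X W by (auto simp: scalar_prod_def lessThan_atLeast0 intro!: sum.cong)
  qed (use X W in auto)
  have "det (X * W) = (\<Sum>f | (\<forall>i\<in>{0..<s}. f i \<in> {..<N}) \<and> (\<forall>i. i \<notin> {0..<s} \<longrightarrow> f i = i).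
      det (mat\<^sub>r s s (\<lambda>i. X $$ (i, f i) \<cdot>\<^sub>v row W (f i))))"
    unfolding XW using W by (intro det_linear_rows_sum) auto
  with d have "(\<Sum>f | (\<forall>i\<in>{0..<s}. f i \<in> {..<N}) \<and> (\<forall>i. i \<notin> {0..<s} \<longrightarrow> f i = i).
      det (mat\<^sub>r s s (\<lambda>i. X $$ (i, f i) \<cdot>\<^sub>v row W (f i)))) \<noteq> 0" by simp
  then obtain f where f: "\<forall>i\<in>{0..<s}. f i \<in> {..<N}"
    and df: "det (mat\<^sub>r s s (\<lambda>i. X $$ (i, f i) \<cdot>\<^sub>v row W (f i))) \<noteq> 0"
    by (rule sum.not_neutral_contains_not_neutral) blast
  have "det (mat\<^sub>r s s (\<lambda>i. X $$ (i, f i) \<cdot>\<^sub>v row W (f i))) =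
      prod (\<lambda>i. X $$ (i, f i)) {0..<s} * det (mat\<^sub>r s s (\<lambda>i. row W (f i)))"
    using W f by (intro det_rows_mul) auto
  with df have df': "det (mat\<^sub>r s s (\<lambda>i. row W (f i))) \<noteq> 0" by auto
  have inj: "inj_on f {..<s}"
  proof (rule inj_onI, rule ccontr)
    fix i j assume ij: "i \<in> {..<s}" "j \<in> {..<s}" "f i = f j" "i \<noteq> j"
    have "det (mat\<^sub>r s s (\<lambda>i. row W (f i))) = 0"
      by (rule det_identical_rows[of _ s i j]) (use ij W in auto)
    with df' show False by simp
  qed
  define R where "R = f ` {..<s}"
  have R: "R \<subseteq> {..<N}" "card R = s" "finite R" using f inj by (auto simp: R_def card_image)
  have "det (submatrix W R {..<s}) \<noteq> 0"
  proof
    assume "det (submatrix W R {..<s}) = 0"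
    note sub = submatrix_carrier[OF W R(1) subset_refl]
    have S: "submatrix W R {..<s} \<in> carrier_mat s s" using sub(1) R(2) by simp
    define p where "p i = (if i < s then inv_into {..<s} (pick R) (f i) else i)" for i
    have bp: "bij_betw (pick R) {..<s} R" using pick_bij[OF R(3)] R(2) by simp
    have bf: "bij_betw f {..<s} R" using inj by (simp add: R_def bij_betw_def)
    have "bij_betw (inv_into {..<s} (pick R) \<circ> f) {..<s} {..<s}"
      by (rule bij_betw_trans[OF bf bij_betw_inv_into[OF bp]])
    hence "bij_betw p {..<s} {..<s}" by (rule bij_betw_cong[THEN iffD1, rotated]) (simp add: p_def)
    hence p: "p permutes {0..<s}"
      unfolding lessThan_atLeast0 by (rule bij_imp_permutes) (simp add: p_def)
    have pf: "pick R (p i) = f i" if "i < s" for i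
      using that bp by (simp add: p_def R_def f_inv_into_f bij_betw_def)
    have "mat\<^sub>r s s (\<lambda>i. row W (f i)) = mat s s (\<lambda>(i, j). submatrix W R {..<s} $$ (p i, j))"
    proof (rule eq_matI)
      fix i j assume "i < dim_row (mat s s (\<lambda>(i, j). submatrix W R {..<s} $$ (p i, j)))"
        "j < dim_col (mat s s (\<lambda>(i, j). submatrix W R {..<s} $$ (p i, j)))"
      hence ij: "i < s" "j < s" by auto
      have "p i < s" using permutes_in_image[OF p] ij(1) by auto
      moreover have "pick {..<s} j = j" using pick_reduce_set[of j s UNIV] ij(2) by (simp add: pick_UNIV lessThan_def)
      ultimately have "submatrix W R {..<s} $$ (p i, j) = W $$ (f i, j)"
        using sub(2)[of "p i" j] R(2) ij pf by simp
      thus "mat\<^sub>r s s (\<lambda>i. row W (f i)) $$ (i, j) = mat s s (\<lambda>(i, j). submatrix W R {..<s} $$ (p i, j)) $$ (i, j)"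
        using ij W f by simp
    qed auto
    also have "det \<dots> = signof p * det (submatrix W R {..<s})"
      by (rule det_permute_rows[OF S p])
    finally show False using df' \<open>det (submatrix W R {..<s}) = 0\<close> by simp
  qed
  with R show ?thesis by blast
qed

lemma submatrix_transpose:
  "submatrix (transpose_mat A) R C = transpose_mat (submatrix A C R)"
  by (rule eq_matI) (auto simp: submatrix_def pick_le)

lemma nonsingular_product_minor:
  fixes X M Y :: "'a::idom mat"
  assumes X: "X \<in> carrier_mat s N" and M: "M \<in> carrier_mat N N'" and Y: "Y \<in> carrier_mat N' s"
    and d: "det (X * M * Y) \<noteq> 0"
  shows "\<exists>R\<subseteq>{..<N}. \<exists>C\<subseteq>{..<N'}. card R = s \<and> card C = s \<and> det (submatrix M R C) \<noteq> 0"
proof -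
  have "det (X * (M * Y)) \<noteq> 0" using d assoc_mult_mat[OF X M Y] by simp
  then obtain R where R: "R \<subseteq> {..<N}" "card R = s" "det (submatrix (M * Y) R {..<s}) \<noteq> 0"
    using nonsingular_product_rows[OF X, of "M * Y"] M Y by auto
  let ?M = "submatrix M R {..<N'}"
  note subM = submatrix_carrier[OF M R(1) subset_refl]
  have M': "?M \<in> carrier_mat s N'" using subM(1) R(2) by simp
  have pickn: "pick {..<m} j = j" if "j < m" for j m
    using pick_reduce_set[of j m UNIV] that by (simp add: pick_UNIV lessThan_def)
  have "submatrix (M * Y) R {..<s} = ?M * Y"
  proof (rule eq_matI)
    note sub = submatrix_carrier[of "M * Y" N s R "{..<s}"]
    have MY: "M * Y \<in> carrier_mat N s" using M Y by simp
    show "dim_row (submatrix (M * Y) R {..<s}) = dim_row (?M * Y)"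
      "dim_col (submatrix (M * Y) R {..<s}) = dim_col (?M * Y)"
      using sub(1)[OF MY R(1)] M' Y R(2) by auto
    fix i j assume "i < dim_row (?M * Y)" "j < dim_col (?M * Y)"
    hence ij: "i < s" "j < s" using M' Y by auto
    have pR: "pick R i < N" using pick_in_set[of i R] ij R by auto
    have "submatrix (M * Y) R {..<s} $$ (i, j) = (M * Y) $$ (pick R i, j)"
      using sub(2)[OF MY R(1), of i j] ij R(2) by (simp add: pickn)
    also have "\<dots> = (\<Sum>k<N'. M $$ (pick R i, k) * Y $$ (k, j))"
      using pR ij M Y by (auto simp: scalar_prod_def lessThan_atLeast0 intro!: sum.cong)
    also have "\<dots> = (\<Sum>k<N'. ?M $$ (i, k) * Y $$ (k, j))"
      using subM(2)[of i] ij R(2) by (intro sum.cong) (auto simp: pickn)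
    also have "\<dots> = (?M * Y) $$ (i, j)"
      using ij M' Y by (auto simp: scalar_prod_def lessThan_atLeast0 intro!: sum.cong)
    finally show "submatrix (M * Y) R {..<s} $$ (i, j) = (?M * Y) $$ (i, j)" .
  qed
  hence "det (?M * Y) \<noteq> 0" using R(3) by simp
  hence "det (transpose_mat (?M * Y)) \<noteq> 0" using M' Y by (subst det_transpose) auto
  hence "det (transpose_mat Y * transpose_mat ?M) \<noteq> 0" using transpose_mult[OF M' Y] by simp
  then obtain C where C: "C \<subseteq> {..<N'}" "card C = s" "det (submatrix (transpose_mat ?M) C {..<s}) \<noteq> 0"
    using nonsingular_product_rows[of "transpose_mat Y" s N' "transpose_mat ?M"] M' Y by auto
  have S: "submatrix ?M {..<s} C \<in> carrier_mat s s"
    using submatrix_carrier(1)[OF M' subset_refl C(1)] C(2) by simp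
  have "det (submatrix ?M {..<s} C) \<noteq> 0"
    using C(3) unfolding submatrix_transpose using det_transpose[OF S] by simp
  moreover have "submatrix ?M {..<s} C = submatrix M R C"
  proof (rule eq_matI)
    note sub = submatrix_carrier[OF M R(1) C(1)] and sub' = submatrix_carrier[OF M' subset_refl C(1)]
    show "dim_row (submatrix ?M {..<s} C) = dim_row (submatrix M R C)"
      "dim_col (submatrix ?M {..<s} C) = dim_col (submatrix M R C)"
      using sub(1) sub'(1) R(2) by auto
    fix i j assume "i < dim_row (submatrix M R C)" "j < dim_col (submatrix M R C)"
    hence ij: "i < s" "j < s" using sub(1) R(2) C(2) by auto
    have "pick C j < N'" using pick_in_set[of j C] ij C by auto
    thus "submatrix ?M {..<s} C $$ (i, j) = submatrix M R C $$ (i, j)"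
      using sub(2)[of i j] sub'(2)[of i j] subM(2)[of i "pick C j"] ij R(2) C(2) by (simp add: pickn)
  qed
  ultimately show ?thesis using R(1,2) C(1,2)
    by (intro exI[of _ R] exI[of _ C] conjI) auto
qed

lemma continuous_det:
  fixes e :: "real \<Rightarrow> nat \<Rightarrow> nat \<Rightarrow> real"
  assumes "\<And>i j. isCont (\<lambda>t. e t i j) t0"
  shows "isCont (\<lambda>t. det (mat s s (\<lambda>(i, j). e t i j))) t0"
proof -
  have "det (mat s s (\<lambda>(i, j). e t i j)) =
      (\<Sum>p | p permutes {0..<s}. signof p * (\<Prod>i = 0..<s. e t i (p i)))" for t
  proof -
    have "(\<Prod>i = 0..<s. mat s s (\<lambda>(i, j). e t i j) $$ (i, p i)) = (\<Prod>i = 0..<s. e t i (p i))"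
      if "p permutes {0..<s}" for p
      using permutes_in_image[OF that] by (intro prod.cong) auto
    thus ?thesis by (auto simp: det_def intro!: sum.cong)
  qed
  thus ?thesis using assms by (auto intro!: continuous_intros)
qed

text \<open>Let \<open>r\<close> be the largest size of a nonvanishing minor of \<open>A\<close>. Border it with \<open>x\<close> and \<open>y\<close>: by the
  assumptions on \<open>A\<close>, the last row of the bordered matrix of \<open>A - t B\<close> is divisible by \<open>t\<close>, and
  after division it is block triangular at \<open>t = 0\<close> with corner \<open>- x B y\<close>, hence nonsingular for
  small \<open>t\<close>. So \<open>A - t B\<close> has a nonvanishing minor of size \<open>r + 1\<close>, while the same minor of \<open>A\<close>
  vanishes by maximality.\<close>
lemma bordered_minor:
  fixes A B :: "real mat"
  assumes A: "A \<in> carrier_mat N N"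
    and Ay: "\<And>i. i < N \<Longrightarrow> (\<Sum>j<N. A $$ (i, j) * y j) = 0"
    and xA: "\<And>j. j < N \<Longrightarrow> (\<Sum>i<N. x i * A $$ (i, j)) = 0"
    and xBy: "(\<Sum>i<N. \<Sum>j<N. x i * B $$ (i, j) * y j) \<noteq> 0"
  shows "\<exists>R C t. R \<subseteq> {..<N} \<and> C \<subseteq> {..<N} \<and> R \<noteq> {} \<and> card R = card C \<and> det (submatrix A R C) = 0 \<and>
    det (submatrix (mat N N (\<lambda>(i, j). A $$ (i, j) - t * B $$ (i, j))) R C) \<noteq> 0"
proof -
  define good where "good s \<longleftrightarrow> (\<exists>R C. R \<subseteq> {..<N} \<and> C \<subseteq> {..<N} \<and> card R = s \<and> card C = s
    \<and> det (submatrix A R C) \<noteq> 0)" for s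
  have "good 0" unfolding good_def
    using submatrix_carrier(1)[OF A, of "{}" "{}"] by (intro exI[of _ "{}"]) (auto simp: det_dim_zero)
  moreover have bound: "s \<le> N" if "good s" for s
  proof -
    from that obtain R where "R \<subseteq> {..<N}" "card R = s" unfolding good_def by blast
    thus ?thesis using card_mono[of "{..<N}" R] by simp
  qed
  define r where "r = Max {s. good s}"
  have fin: "finite {s. good s}" by (rule finite_subset[of _ "{..N}"]) (auto dest: bound)
  have "good r" unfolding r_def using Max_in[OF fin] \<open>good 0\<close> by blast
  then obtain R0 C0 where R0: "R0 \<subseteq> {..<N}" "card R0 = r" and C0: "C0 \<subseteq> {..<N}" "card C0 = r"
    and d0: "det (submatrix A R0 C0) \<noteq> 0" unfolding good_def by blast
  have pR: "pick R0 i < N" if "i < r" for i using pick_in_set[of i R0] that R0 by auto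
  have pC: "pick C0 i < N" if "i < r" for i using pick_in_set[of i C0] that C0 by auto
  define M where "M t = mat N N (\<lambda>(i, j). A $$ (i, j) - t * B $$ (i, j))" for t
  define X where "X = mat (Suc r) N (\<lambda>(i, k). if i < r then (if k = pick R0 i then 1 else 0) else x k)"
  define Y where "Y = mat N (Suc r) (\<lambda>(k, j). if j < r then (if k = pick C0 j then 1 else 0) else y k)"
  define Yv where "Yv j = (\<lambda>k. Y $$ (k, j))" for j
  define \<beta> where "\<beta> = (\<Sum>k<N. \<Sum>l<N. x k * B $$ (k, l) * y l)"
  have XMY: "(X * M t * Y) $$ (i, j) = (\<Sum>k<N. \<Sum>l<N. X $$ (i, k) * M t $$ (k, l) * Y $$ (l, j))"
    if "i < Suc r" "j < Suc r" for i j t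
  proof -
    have "(X * M t * Y) $$ (i, j) = (X * (M t * Y)) $$ (i, j)"
      by (subst assoc_mult_mat[of X "Suc r" N "M t" N Y "Suc r"]) (auto simp: X_def Y_def M_def)
    also have "\<dots> = (\<Sum>k<N. X $$ (i, k) * (M t * Y) $$ (k, j))"
      using that by (simp add: scalar_prod_def lessThan_atLeast0 X_def Y_def M_def)
    also have "\<dots> = (\<Sum>k<N. X $$ (i, k) * (\<Sum>l<N. M t $$ (k, l) * Y $$ (l, j)))"
      using that by (intro sum.cong arg_cong2[where f = "(*)"] refl) (simp add: scalar_prod_def lessThan_atLeast0 X_def Y_def M_def)
    finally show ?thesis by (simp add: sum_distrib_left mult.assoc)
  qed
  define f where "f t i j = (if i < r then (\<Sum>l<N. A $$ (pick R0 i, l) * Y $$ (l, j)) - t * (\<Sum>l<N. B $$ (pick R0 i, l) * Y $$ (l, j))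
     else - (\<Sum>k<N. \<Sum>l<N. x k * B $$ (k, l) * Y $$ (l, j)))" for t i j
  have entry: "(X * M t * Y) $$ (i, j) = (if i < r then f t i j else t * f t i j)"
    if ij: "i < Suc r" "j < Suc r" for i j t
  proof (cases "i < r")
    case True
    have "(X * M t * Y) $$ (i, j) = (\<Sum>k<N. if k = pick R0 i then \<Sum>l<N. M t $$ (k, l) * Y $$ (l, j) else 0)"
      unfolding XMY[OF ij] using True by (intro sum.cong refl) (auto simp: X_def)
    also have "\<dots> = (\<Sum>l<N. M t $$ (pick R0 i, l) * Y $$ (l, j))" using pR[OF True] by simp
    also have "\<dots> = f t i j" using True pR[OF True]
      by (simp add: f_def M_def left_diff_distrib sum_subtractf sum_distrib_left mult.assoc)
    finally show ?thesis using True by simp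
  next
    case False
    have "(X * M t * Y) $$ (i, j) = (\<Sum>k<N. \<Sum>l<N. (x k * A $$ (k, l)) * Y $$ (l, j) - t * (x k * B $$ (k, l) * Y $$ (l, j)))"
      unfolding XMY[OF ij] using False ij(1) by (intro sum.cong refl) (auto simp: X_def M_def algebra_simps)
    also have "\<dots> = (\<Sum>k<N. \<Sum>l<N. x k * A $$ (k, l) * Y $$ (l, j)) - t * (\<Sum>k<N. \<Sum>l<N. x k * B $$ (k, l) * Y $$ (l, j))"
      by (simp only: sum_subtractf sum_distrib_left)
    also have "(\<Sum>k<N. \<Sum>l<N. x k * A $$ (k, l) * Y $$ (l, j)) = (\<Sum>l<N. (\<Sum>k<N. x k * A $$ (k, l)) * Y $$ (l, j))"
      by (subst sum.swap) (simp only: sum_distrib_right)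
    also have "\<dots> = 0" using xA by simp
    finally show ?thesis using False by (simp add: f_def)
  qed
  let ?F = "\<lambda>t. mat (Suc r) (Suc r) (\<lambda>(i, j). f t i j)"
  have "X * M t * Y = multrow r t (?F t)" for t
    by (rule eq_matI) (auto simp: entry mat_multrow_def simp del: index_mult_mat(1), auto simp: X_def Y_def)
  hence det_t: "det (X * M t * Y) = t * det (?F t)" for t
    by (simp add: det_multrow[of r "Suc r"])
  have "det (?F 0) \<noteq> 0"
  proof -
    have sub0: "submatrix A R0 C0 \<in> carrier_mat r r" using submatrix_carrier(1)[OF A R0(1) C0(1)] R0 C0 by simp
    have "?F 0 = four_block_mat (submatrix A R0 C0) (0\<^sub>m r 1) (mat 1 r (\<lambda>(i, j). f 0 r j)) (mat 1 1 (\<lambda>_. - \<beta>))"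
    proof (rule eq_matI)
      fix i j assume "i < dim_row (four_block_mat (submatrix A R0 C0) (0\<^sub>m r 1) (mat 1 r (\<lambda>(i, j). f 0 r j)) (mat 1 1 (\<lambda>_. - \<beta>)))"
        "j < dim_col (four_block_mat (submatrix A R0 C0) (0\<^sub>m r 1) (mat 1 r (\<lambda>(i, j). f 0 r j)) (mat 1 1 (\<lambda>_. - \<beta>)))"
      hence ij: "i < Suc r" "j < Suc r" using sub0 by auto
      have a: "f 0 i j = A $$ (pick R0 i, pick C0 j)" if "i < r" "j < r"
      proof -
        have "f 0 i j = (\<Sum>l<N. if l = pick C0 j then A $$ (pick R0 i, l) else 0)"
        proof -
          have "f 0 i j = (\<Sum>l<N. A $$ (pick R0 i, l) * (if l = pick C0 j then 1 else 0))"
            using that by (auto simp: f_def Y_def intro!: sum.cong)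
          also have "\<dots> = (\<Sum>l<N. if l = pick C0 j then A $$ (pick R0 i, l) else 0)"
            by (rule sum.cong) auto
          finally show ?thesis .
        qed
        thus ?thesis using pC[OF that(2)] by simp
      qed
      have b: "f 0 i j = 0" if "i < r" "j = r"
        using that Ay[OF pR[OF that(1)]] by (simp add: f_def Y_def)
      have c: "f 0 i j = - \<beta>" if "i = r" "j = r"
        using that by (simp add: f_def Y_def \<beta>_def)
      show "?F 0 $$ (i, j) = four_block_mat (submatrix A R0 C0) (0\<^sub>m r 1) (mat 1 r (\<lambda>(i, j). f 0 r j)) (mat 1 1 (\<lambda>_. - \<beta>)) $$ (i, j)"
        using ij sub0 a b c submatrix_carrier(2)[OF A R0(1) C0(1), of i j] R0 C0
        by (auto simp: less_Suc_eq)
    qed (use sub0 in auto)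
    also have "det \<dots> = det (submatrix A R0 C0) * det (mat 1 1 (\<lambda>_. - \<beta>))"
      using sub0 by (intro det_four_block_mat_upper_right_zero) auto
    also have "\<dots> = det (submatrix A R0 C0) * - \<beta>" by (subst det_single) auto
    finally show ?thesis using d0 xBy by (simp add: \<beta>_def)
  qed
  moreover have "isCont (\<lambda>t. det (?F t)) 0"
  proof (rule continuous_det)
    show "isCont (\<lambda>t. f t i j) 0" for i j
      unfolding f_def by (cases "i < r") (auto intro!: continuous_intros)
  qed
  ultimately have "eventually (\<lambda>t. det (?F t) \<noteq> 0) (at 0)"
    unfolding isCont_def by (intro tendsto_imp_eventually_ne)
  moreover have "eventually (\<lambda>t. t \<noteq> 0) (at (0::real))" by (simp add: eventually_at_filter)
  ultimately have "eventually (\<lambda>t. det (?F t) \<noteq> 0 \<and> t \<noteq> 0) (at (0::real))" by eventually_elim simp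
  then obtain t where t: "det (?F t) \<noteq> 0" "t \<noteq> 0"
    using eventually_happens'[OF at_neq_bot] by blast
  hence "det (X * M t * Y) \<noteq> 0" unfolding det_t by simp
  then obtain R C where RC: "R \<subseteq> {..<N}" "C \<subseteq> {..<N}" "card R = Suc r" "card C = Suc r"
    "det (submatrix (M t) R C) \<noteq> 0"
    using nonsingular_product_minor[of X "Suc r" N "M t" N Y] by (auto simp: X_def Y_def M_def)
  have "\<not> good (Suc r)" using Max_ge[OF fin, of "Suc r"] unfolding r_def[symmetric] by auto
  hence "det (submatrix A R C) = 0" using RC unfolding good_def by blast
  moreover have "R \<noteq> {}" using RC(3) by auto
  moreover have "card R = card C" using RC(3,4) by simp
  ultimately show ?thesis using RC(1,2,5) unfolding M_def
    by (intro exI[of _ R] exI[of _ C] exI[of _ t] conjI)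
qed

text \<open>The determinant of \<open>\<alpha> - w X Y\<close> is that of the block matrix with rows \<open>(1, Y)\<close> and
  \<open>(w X, \<alpha>)\<close>, in which only the first \<open>r\<close> columns involve \<open>w\<close>.\<close>
lemma degree_det_pencil:
  fixes \<alpha> \<beta> :: "nat \<Rightarrow> nat \<Rightarrow> 'a::idom"
  assumes "\<And>i j. i < s \<Longrightarrow> j < s \<Longrightarrow> \<beta> i j = (\<Sum>e<r. X i e * Y e j)"
  shows "degree (det (mat s s (\<lambda>(i, j). [:\<alpha> i j, - \<beta> i j:]))) \<le> r"
proof -
  define X' where "X' = mat s r (\<lambda>(i, e). [:0, X i e:])"
  define nX where "nX = mat s r (\<lambda>(i, e). [:0, - X i e:])"
  define Y' where "Y' = mat r s (\<lambda>(e, j). [:Y e j:])"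
  define A' where "A' = mat s s (\<lambda>(i, j). [:\<alpha> i j:])"
  define Z where "Z = four_block_mat (1\<^sub>m r) Y' X' A'"
  have c: "X' \<in> carrier_mat s r" "nX \<in> carrier_mat s r" "Y' \<in> carrier_mat r s" "A' \<in> carrier_mat s s"
    by (auto simp: X'_def nX_def Y'_def A'_def)
  let ?P = "mat s s (\<lambda>(i, j). [:\<alpha> i j, - \<beta> i j:])"
  let ?L = "four_block_mat (1\<^sub>m r) (0\<^sub>m r s) nX (1\<^sub>m s)"
  have "?L * Z = four_block_mat (1\<^sub>m r * 1\<^sub>m r + 0\<^sub>m r s * X') (1\<^sub>m r * Y' + 0\<^sub>m r s * A')
      (nX * 1\<^sub>m r + 1\<^sub>m s * X') (nX * Y' + 1\<^sub>m s * A')"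
    unfolding Z_def using c by (intro mult_four_block_mat) auto
  also have "1\<^sub>m r * 1\<^sub>m r + 0\<^sub>m r s * X' = (1\<^sub>m r :: 'a poly mat)" using c by simp
  also have "1\<^sub>m r * Y' + 0\<^sub>m r s * A' = Y'" using c by simp
  also have "nX * 1\<^sub>m r + 1\<^sub>m s * X' = 0\<^sub>m s r"
    using c by (intro eq_matI) (auto simp: nX_def X'_def)
  also have "nX * Y' + 1\<^sub>m s * A' = ?P"
  proof (rule eq_matI)
    fix i j assume "i < dim_row ?P" "j < dim_col ?P"
    hence ij: "i < s" "j < s" by auto
    have "(nX * Y' + 1\<^sub>m s * A') $$ (i, j) = (\<Sum>e<r. [:0, - X i e:] * [:Y e j:]) + [:\<alpha> i j:]"
      using ij c by (simp add: scalar_prod_def lessThan_atLeast0) (simp add: nX_def Y'_def A'_def)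
    also have "(\<Sum>e<r. [:0, - X i e:] * [:Y e j:]) = [:0, - \<beta> i j:]"
    proof -
      have "(\<Sum>e<n. [:0, - X i e:] * [:Y e j:]) = [:0, - (\<Sum>e<n. X i e * Y e j):]" for n
        by (induction n) (auto simp: mult.commute)
      thus ?thesis using assms[OF ij] by simp
    qed
    finally show "(nX * Y' + 1\<^sub>m s * A') $$ (i, j) = ?P $$ (i, j)" using ij by simp
  qed (use c in auto)
  finally have LZ: "?L * Z = four_block_mat (1\<^sub>m r) Y' (0\<^sub>m s r) ?P" .
  have Zc: "Z \<in> carrier_mat (r + s) (r + s)" unfolding Z_def using c by auto
  have "det (?L * Z) = det ?L * det Z"
    by (rule det_mult[of _ "r + s"]) (use c Zc in auto)
  also have "det ?L = det (1\<^sub>m r) * det (1\<^sub>m s)"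
    using c by (intro det_four_block_mat_upper_right_zero) auto
  also have "det (?L * Z) = det (1\<^sub>m r) * det ?P"
    unfolding LZ using c by (intro det_four_block_mat_lower_left_zero) auto
  finally have eq: "det ?P = det Z" by simp
  have degZ: "degree (Z $$ (i, j)) \<le> (if j < r then 1 else 0)" if "i < r + s" "j < r + s" for i j
    using that c unfolding Z_def
    by (auto simp: X'_def Y'_def A'_def)
  have "degree (det Z) \<le> r"
    unfolding det_def'[OF Zc]
  proof (rule degree_sum_le)
    show "finite {p. p permutes {0..<r + s}}" by (rule finite_permutations) simp
    fix p assume "p \<in> {p. p permutes {0..<r + s}}"
    hence p: "p permutes {0..<r + s}" by simp
    have "degree (signof p * (\<Prod>i = 0..<r + s. Z $$ (i, p i))) \<le> degree (\<Prod>i = 0..<r + s. Z $$ (i, p i))"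
      by (simp add: sign_def)
    also have "\<dots> \<le> (\<Sum>i = 0..<r + s. degree (Z $$ (i, p i)))"
      using degree_prod_sum_le[of "{0..<r + s}" "\<lambda>i. Z $$ (i, p i)"] by (simp add: o_def)
    also have "\<dots> \<le> (\<Sum>i = 0..<r + s. if p i < r then 1 else 0)"
      using permutes_in_image[OF p] by (intro sum_mono degZ) auto
    also have "\<dots> = (\<Sum>i = 0..<r + s. if i < r then 1 else 0)"
      using sum.permute[OF p, of "\<lambda>i. if i < r then 1 else (0 :: nat)"] unfolding o_def by (rule sym)
    also have "\<dots> = (\<Sum>i = 0..<r. 1)" by (rule sum.mono_neutral_cong_right) auto
    also have "\<dots> = r" by simp
    finally show "degree (signof p * (\<Prod>i = 0..<r + s. Z $$ (i, p i))) \<le> r" .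
  qed
  thus ?thesis using eq by simp
qed

lemma rank_factorization:
  assumes B: "(B :: real mat) \<in> carrier_mat N M"
  shows "\<exists>X Y. \<forall>i<N. \<forall>j<M. B $$ (i, j) = (\<Sum>e<vec_space.rank N B. X i e * Y e j)"
proof -
  interpret vec_space "TYPE(real)" N .
  let ?P = "\<lambda>T. T \<subseteq> set (cols B) \<and> lin_indpt T"
  have cols: "set (cols B) \<subseteq> carrier_vec N" using cols_dim[of B] B by auto
  have "?P {}" by (simp add: lin_dep_def)
  then obtain S where S: "finite S" "maximal S ?P"
    using maximal_exists_superset[of "set (cols B)" ?P "{}"] by blast
  have rank: "rank B = card S" by (rule rank_card_indpt[OF B S(2)])
  have SP: "S \<subseteq> set (cols B)" "lin_indpt S" using S(2) by (auto simp: maximal_def)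
  have Sc: "S \<subseteq> carrier_vec N" using SP(1) cols by blast
  have "\<exists>a. lincomb a S = v" if v: "v \<in> set (cols B)" for v
  proof -
    have vc: "v \<in> carrier_vec N" using v cols by blast
    have "v \<in> span S"
    proof (cases "v \<in> S")
      case True
      thus ?thesis using in_own_span[OF Sc] by blast
    next
      case False
      show ?thesis
      proof (rule ccontr)
        assume "v \<notin> span S"
        hence "lin_indpt (S \<union> {v})" using lin_dep_iff_in_span[OF Sc SP(2) vc False] by blast
        hence "?P (S \<union> {v})" using SP(1) v by blast
        moreover have "S \<subseteq> S \<union> {v}" by blast
        ultimately have "S \<union> {v} = S" using S(2) unfolding maximal_def by blast
        with False show False by blast
      qed
    qed
    thus ?thesis using finite_in_span[OF S(1) Sc] by blast
  qed
  then obtain a where a: "\<And>v. v \<in> set (cols B) \<Longrightarrow> lincomb (a v) S = v" by metis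
  obtain b where b: "bij_betw b {..<card S} S"
    using ex_bij_betw_nat_finite[OF S(1)] by (metis atLeast0LessThan)
  have "B $$ (i, j) = (\<Sum>e<rank B. b e $ i * a (col B j) (b e))" if ij: "i < N" "j < M" for i j
  proof -
    have cj: "col B j \<in> set (cols B)" using ij B by (auto simp: cols_def)
    have "B $$ (i, j) = lincomb (a (col B j)) S $ i" using ij B a[OF cj] by simp
    also have "\<dots> = (\<Sum>x\<in>S. a (col B j) x * x $ i)" by (rule lincomb_index[OF ij(1) Sc])
    also have "\<dots> = (\<Sum>e<card S. a (col B j) (b e) * b e $ i)"
      by (rule sum.reindex_bij_betw[OF b, symmetric])
    finally show ?thesis by (simp add: rank mult.commute)
  qed
  thus ?thesis
    by (intro exI[of _ "\<lambda>i e. b e $ i"] exI[of _ "\<lambda>e j. a (col B j) (b e)"]) simp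
qed

section \<open>Minors that vanish at the value\<close>

context finite_stochastic_game
begin

lemma kernel_optimal:
  assumes ker: "shapley_snow_kernel (local_game G s l (disc_value G l)) I J" and s: "s \<in> K" and l: "0 < l" "l \<le> 1"
  shows "game_val (local_game G s l (disc_value G l)) = disc_value G l s"
    and "\<exists>x\<in>mixed (acts1 G s). \<exists>y\<in>mixed (acts2 G s).
     (\<forall>y'\<in>mixed (acts2 G s). disc_value G l s \<le> game_payoff (local_game G s l (disc_value G l)) x y') \<and>
     (\<forall>x'\<in>mixed (acts1 G s). game_payoff (local_game G s l (disc_value G l)) x' y \<le> disc_value G l s)"
proof -
  let ?L = "local_game G s l (disc_value G l)"
  have "\<exists>x y. basic_solution ?L x y" using ker unfolding shapley_snow_kernel_def by blast
  then obtain x y where "(x, y) \<in> optimal_pairs ?L" unfolding basic_solution_def by blast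
  hence xy: "x \<in> mixed (acts1 G s)" "y \<in> mixed (acts2 G s)"
    "\<And>y'. y' \<in> mixed (acts2 G s) \<Longrightarrow> game_val ?L \<le> game_payoff ?L x y'"
    "\<And>x'. x' \<in> mixed (acts1 G s) \<Longrightarrow> game_payoff ?L x' y \<le> game_val ?L"
    by (auto simp: optimal_pairs_def)
  have "disc_value G l s = game_val ?L" by (rule disc_value_eq_local[OF l s xy])
  thus "game_val ?L = disc_value G l s" by simp
  thus "\<exists>x\<in>mixed (acts1 G s). \<exists>y\<in>mixed (acts2 G s).
     (\<forall>y'\<in>mixed (acts2 G s). disc_value G l s \<le> game_payoff ?L x y') \<and>
     (\<forall>x'\<in>mixed (acts1 G s). game_payoff ?L x' y \<le> disc_value G l s)"
    using xy by metis
qed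

lemma kernel_equalizers:
  assumes ker: "shapley_snow_kernel (local_game G s l (disc_value G l)) I J" and s: "s \<in> K" and l: "0 < l" "l \<le> 1"
  shows "I \<subseteq> {..<acts1 G s}" "J \<subseteq> {..<acts2 G s}" "card J = card I"
    and "\<exists>x y. (\<forall>i<card I. 0 \<le> x i) \<and> (\<Sum>i<card I. x i) = 1 \<and> (\<forall>j<card I. 0 \<le> y j) \<and> (\<Sum>j<card I. y j) = 1 \<and>
      (\<forall>i<card I. (\<Sum>b<card I. local_game G s l (disc_value G l) $$ (pick I i, pick J b) * y b) = disc_value G l s) \<and>
      (\<forall>j<card I. (\<Sum>a<card I. x a * local_game G s l (disc_value G l) $$ (pick I a, pick J j)) = disc_value G l s)"
proof -
  let ?L = "local_game G s l (disc_value G l)"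
  let ?m = "card I"
  show IJ: "I \<subseteq> {..<acts1 G s}" "J \<subseteq> {..<acts2 G s}" "card J = card I"
    using ker by (auto simp: shapley_snow_kernel_def)
  define Gd where "Gd = submatrix ?L I J"
  define C where "C = cofactor_mat Gd"
  define S where "S = entry_sum C"
  from ker obtain x y where bs: "basic_solution ?L x y"
    and *: "S \<noteq> 0" "restrict_vec x I = (1 / S) \<cdot>\<^sub>v (C *\<^sub>v ones ?m)"
    "restrict_vec y J = (1 / S) \<cdot>\<^sub>v (transpose_mat C *\<^sub>v ones ?m)"
    "transpose_mat Gd *\<^sub>v restrict_vec x I = game_val ?L \<cdot>\<^sub>v ones ?m"
    "Gd *\<^sub>v restrict_vec y J = game_val ?L \<cdot>\<^sub>v ones ?m"
    unfolding shapley_snow_kernel_def Let_def Gd_def C_def S_def by blast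
  from bs have mx: "x \<in> mixed (acts1 G s)" "y \<in> mixed (acts2 G s)"
    by (auto simp: basic_solution_def optimal_pairs_def)
  have Lc: "?L \<in> carrier_mat (acts1 G s) (acts2 G s)" by (simp add: local_game_def)
  have Gd: "Gd \<in> carrier_mat ?m ?m"
    "\<And>i j. i < ?m \<Longrightarrow> j < ?m \<Longrightarrow> Gd $$ (i, j) = ?L $$ (pick I i, pick J j)"
    using submatrix_carrier[OF Lc IJ(1,2)] IJ(3) by (simp_all add: Gd_def)
  have Cc: "C \<in> carrier_mat ?m ?m" using Gd(1) by (simp add: C_def cofactor_mat_def)
  have Ssum: "S = (\<Sum>i<?m. \<Sum>j<?m. C $$ (i, j))" using Cc by (simp add: S_def entry_sum_def)
  define xd where "xd i = x $ pick I i" for i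
  define yd where "yd j = y $ pick J j" for j
  have rx: "restrict_vec x I = vec ?m xd" "restrict_vec y J = vec ?m yd"
    by (auto simp: restrict_vec_def xd_def[abs_def] yd_def[abs_def] IJ(3))
  have xd: "xd i = (1 / S) * (\<Sum>j<?m. C $$ (i, j))" if "i < ?m" for i
  proof -
    have "xd i = restrict_vec x I $ i" using that by (simp add: rx)
    also have "\<dots> = (1 / S) * (\<Sum>j<?m. C $$ (i, j))"
      unfolding *(2) using that Cc by (simp add: scalar_prod_def ones_def lessThan_atLeast0)
    finally show ?thesis .
  qed
  have yd: "yd j = (1 / S) * (\<Sum>i<?m. C $$ (i, j))" if "j < ?m" for j
  proof -
    have "yd j = restrict_vec y J $ j" using that by (simp add: rx)
    also have "\<dots> = (1 / S) * (\<Sum>i<?m. C $$ (i, j))"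
      unfolding *(3) using that Cc by (simp add: scalar_prod_def ones_def lessThan_atLeast0)
    finally show ?thesis .
  qed
  have "(\<Sum>i<?m. xd i) = (1 / S) * (\<Sum>i<?m. \<Sum>j<?m. C $$ (i, j))"
    unfolding sum_distrib_left[of "1 / S"] by (rule sum.cong) (use xd in \<open>auto simp: sum_distrib_left\<close>)
  hence sx: "(\<Sum>i<?m. xd i) = 1" using *(1) Ssum by simp
  have "(\<Sum>j<?m. yd j) = (1 / S) * (\<Sum>j<?m. \<Sum>i<?m. C $$ (i, j))"
    unfolding sum_distrib_left[of "1 / S"] by (rule sum.cong) (use yd in \<open>auto simp: sum_distrib_left\<close>)
  also have "(\<Sum>j<?m. \<Sum>i<?m. C $$ (i, j)) = S" unfolding Ssum by (rule sum.swap)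
  finally have sy: "(\<Sum>j<?m. yd j) = 1" using *(1) by simp
  have nx: "0 \<le> xd i" if "i < ?m" for i
  proof -
    have "pick I i \<in> I" by (rule pick_in_set) (use that in simp)
    thus ?thesis using mx(1) IJ(1) by (auto simp: xd_def mixed_def)
  qed
  have ny: "0 \<le> yd j" if "j < ?m" for j
  proof -
    have "pick J j \<in> J" by (rule pick_in_set) (use that IJ(3) in simp)
    thus ?thesis using mx(2) IJ(2) by (auto simp: yd_def mixed_def)
  qed
  note val = kernel_optimal(1)[OF ker s l]
  have ey: "(\<Sum>b<?m. ?L $$ (pick I i, pick J b) * yd b) = disc_value G l s" if i: "i < ?m" for i
  proof -
    have "(\<Sum>b<?m. ?L $$ (pick I i, pick J b) * yd b) = (Gd *\<^sub>v restrict_vec y J) $ i"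
      unfolding rx using i Gd by (auto simp: scalar_prod_def lessThan_atLeast0 intro!: sum.cong)
    thus ?thesis unfolding *(5) using i val by (simp add: ones_def)
  qed
  have ex: "(\<Sum>a<?m. xd a * ?L $$ (pick I a, pick J j)) = disc_value G l s" if j: "j < ?m" for j
  proof -
    have "(\<Sum>a<?m. xd a * ?L $$ (pick I a, pick J j)) = (transpose_mat Gd *\<^sub>v restrict_vec x I) $ j"
      unfolding rx using j Gd by (auto simp: scalar_prod_def lessThan_atLeast0 mult.commute intro!: sum.cong)
    thus ?thesis unfolding *(4) using j val by (simp add: ones_def)
  qed
  show "\<exists>x y. (\<forall>i<card I. 0 \<le> x i) \<and> (\<Sum>i<card I. x i) = 1 \<and> (\<forall>j<card I. 0 \<le> y j) \<and> (\<Sum>j<card I. y j) = 1 \<and>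
      (\<forall>i<card I. (\<Sum>b<card I. ?L $$ (pick I i, pick J b) * y b) = disc_value G l s) \<and>
      (\<forall>j<card I. (\<Sum>a<card I. x a * ?L $$ (pick I a, pick J j)) = disc_value G l s)"
    by (rule exI[of _ xd], rule exI[of _ yd]) (intro conjI allI impI nx ny sx sy ex ey)
qed

end

lemma eval_hom: "comm_ring_hom (\<lambda>c :: real poly. poly c l)"
  by unfold_locales auto

lemma poly_array_minor:
  fixes l :: real
  shows "poly (array_minor n a c) l = array_minor n (\<lambda>k c. poly (a k c) l) c"
proof -
  have "poly (signof \<sigma> :: real poly) l = signof \<sigma>" for \<sigma> :: "nat \<Rightarrow> nat" by (simp add: sign_def)
  thus ?thesis by (simp add: array_minor_def poly_sum poly_prod)
qed

definition eval_inner :: "real \<Rightarrow> real poly poly \<Rightarrow> real poly" where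
  "eval_inner l P = map_poly (\<lambda>c. poly c l) P"

lemma eval_inner_hom: "comm_ring_hom (eval_inner l)"
proof -
  interpret h: comm_ring_hom "\<lambda>c :: real poly. poly c l" by (rule eval_hom)
  interpret mp: map_poly_comm_ring_hom "\<lambda>c :: real poly. poly c l" ..
  show ?thesis unfolding eval_inner_def[abs_def] by (rule mp.comm_ring_hom_axioms)
qed

lemma eval2_eval_inner: "eval2 P l (w :: real) = poly (eval_inner l P) w"
  by (simp add: eval2_def eval_inner_def)

text \<open>At an index where \<open>\<bar>z\<bar>\<close> is largest, the average \<open>Q z\<close> is not larger, and the factor
  \<open>1 - l\<close> is less than one.\<close>
lemma dominant_nonsingular:
  fixes Q :: "nat \<Rightarrow> nat \<Rightarrow> real"
  assumes l: "0 < l" "l \<le> 1" and Q: "\<And>k c. k \<in> {1..n} \<Longrightarrow> c \<in> {1..n} \<Longrightarrow> 0 \<le> Q k c" "\<And>k. k \<in> {1..n} \<Longrightarrow> (\<Sum>c\<in>{1..n}. Q k c) = 1"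
    and z: "\<And>k. k \<in> {1..n} \<Longrightarrow> (\<Sum>c\<in>{1..n}. z c * ((1 - l) * Q k c - (if c = k then 1 else 0))) = 0"
  shows "\<forall>c\<in>{1..n}. z c = 0"
proof (cases "n = 0")
  case False
  define \<mu> where "\<mu> = Max ((\<lambda>c. \<bar>z c\<bar>) ` {1..n})"
  have le: "\<bar>z c\<bar> \<le> \<mu>" if "c \<in> {1..n}" for c unfolding \<mu>_def using that by (intro Max_ge) auto
  have "\<mu> \<in> (\<lambda>c. \<bar>z c\<bar>) ` {1..n}" unfolding \<mu>_def using False by (intro Max_in) auto
  then obtain k where k: "k \<in> {1..n}" "\<mu> = \<bar>z k\<bar>" by blast
  have "(\<Sum>c\<in>{1..n}. z c * ((1 - l) * Q k c - (if c = k then 1 else 0))) =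
      (1 - l) * (\<Sum>c\<in>{1..n}. Q k c * z c) - (\<Sum>c\<in>{1..n}. if c = k then z c else 0)"
    unfolding sum_distrib_left sum_subtractf[symmetric] by (intro sum.cong) (auto simp: algebra_simps)
  also have "(\<Sum>c\<in>{1..n}. if c = k then z c else 0) = z k" using k(1) by simp
  finally have zk: "z k = (1 - l) * (\<Sum>c\<in>{1..n}. Q k c * z c)" using z[OF k(1)] by simp
  have "\<bar>\<Sum>c\<in>{1..n}. Q k c * z c\<bar> \<le> (\<Sum>c\<in>{1..n}. Q k c * \<mu>)"
  proof (rule order_trans[OF sum_abs], rule sum_mono)
    fix c assume c: "c \<in> {1..n}"
    show "\<bar>Q k c * z c\<bar> \<le> Q k c * \<mu>" using Q(1)[OF k(1) c] le[OF c] by (simp add: abs_mult mult_left_mono)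
  qed
  also have "\<dots> = \<mu>" using Q(2)[OF k(1)] by (simp add: sum_distrib_right[symmetric])
  finally have "\<mu> \<le> (1 - l) * \<mu>"
    using l unfolding k(2) by (subst zk) (simp add: abs_mult mult_left_mono)
  hence "l * \<mu> \<le> 0" by (simp add: algebra_simps)
  hence "\<mu> \<le> 0" using l(1) by (simp add: mult_le_0_iff)
  thus ?thesis using le by fastforce
qed simp

context finite_stochastic_game
begin

lemma n_pos: "1 \<le> states G" using G by (simp add: stochastic_game_def)

definition data_entry :: "real \<Rightarrow> nat \<Rightarrow> nat \<Rightarrow> nat \<Rightarrow> nat \<Rightarrow> real" where
  "data_entry l s c i j = poly (data_array G s c $$ (i, j)) l"

text \<open>This is what the data array is made for: weighted by \<open>1\<close> and the continuation values, its
  columns add up to the local game minus the value of its own state.\<close>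
lemma data_entry_sum:
  assumes s: "s \<in> K" and ij: "i < acts1 G s" "j < acts2 G s"
  shows "(\<Sum>c\<le>states G. (if c = 0 then 1 else v c) * data_entry l s c i j) = local_game G s l v $$ (i, j) - v s"
proof -
  have "(\<Sum>c\<le>states G. (if c = 0 then 1 else v c) * data_entry l s c i j) =
      data_entry l s 0 i j + (\<Sum>c\<in>K. v c * data_entry l s c i j)"
  proof -
    have "{..states G} = insert 0 K" by auto
    thus ?thesis by simp
  qed
  also have "data_entry l s 0 i j = l * stage G s i j" using ij by (simp add: data_entry_def data_array_def)
  also have "(\<Sum>c\<in>K. v c * data_entry l s c i j) = (\<Sum>c\<in>K. (1 - l) * (pmf (trans_pmf G s i j) c * v c) - (if c = s then v c else 0))"
    using ij by (intro sum.cong refl) (auto simp: data_entry_def data_array_def algebra_simps)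
  also have "\<dots> = (1 - l) * (\<Sum>c\<in>K. pmf (trans_pmf G s i j) c * v c) - v s"
    using s by (simp add: sum_subtractf sum_distrib_left)
  finally show ?thesis using ij by (simp add: local_game_def)
qed

text \<open>The kernel strategies are equalizing, so by \<open>data_entry_sum\<close> they annihilate the weighted sum
  of the columns of the reduced array, from either side. Cramer's rule turns this into the
  assumptions of \<open>bordered_minor\<close> for \<open>A = \<Delta>\<^sup>k - v\<^sub>k \<Delta>\<^sup>0\<close> and \<open>B = \<Delta>\<^sup>0\<close>, whose minors are
  minors of the full pencil by \<open>submatrix_image\<close>.\<close>
lemma local_minor:
  assumes l: "0 < l" "l \<le> 1" and k: "k \<in> K"
    and ker: "\<And>s. s \<in> K \<Longrightarrow> shapley_snow_kernel (local_game G s l (disc_value G l)) (Is s) (Js s)"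
  obtains R C P t where "R \<subseteq> {..<dim_row (pencil G k)}" "C \<subseteq> {..<dim_col (pencil G k)}" "R \<noteq> {}" "card R = card C"
    "P = det (submatrix (pencil G k) R C)"
    "eval2 P l (disc_value G l k) = 0" "eval2 P l (t :: real) \<noteq> 0"
    "degree (eval_inner l P) \<le> mat_rank (mat_at (reduced_aux G Is Js 0) l)"
proof -
  note upt_Suc [simp del]
  define n where "n = states G"
  define m where "m s = card (Is s)" for s
  define v where "v = disc_value G l"
  note eqz = kernel_equalizers[OF ker _ l]
  have I: "Is s \<subseteq> {..<acts1 G s}" "Js s \<subseteq> {..<acts2 G s}" "card (Js s) = m s" if "s \<in> K" for s
    using eqz[OF that that] by (auto simp: m_def)
  define equalizing where "equalizing s x y \<longleftrightarrow> (\<forall>i<m s. 0 \<le> x i) \<and> (\<Sum>i<m s. x i) = 1 \<and> (\<forall>j<m s. 0 \<le> y j) \<and> (\<Sum>j<m s. y j) = 1 \<and>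
      (\<forall>i<m s. (\<Sum>b<m s. local_game G s l v $$ (pick (Is s) i, pick (Js s) b) * y b) = v s) \<and>
      (\<forall>j<m s. (\<Sum>a<m s. x a * local_game G s l v $$ (pick (Is s) a, pick (Js s) j)) = v s)"
    for s and x y :: "nat \<Rightarrow> real"
  have ex: "\<exists>p. equalizing s (fst p) (snd p)" if "s \<in> K" for s
  proof -
    have "\<exists>x y. equalizing s x y" using eqz(4)[OF that that] by (simp only: equalizing_def m_def v_def)
    thus ?thesis by (metis fst_conv snd_conv)
  qed
  define x where "x s = fst (SOME p. equalizing s (fst p) (snd p))" for s
  define y where "y s = snd (SOME p. equalizing s (fst p) (snd p))" for s
  have "equalizing s (x s) (y s)" if "s \<in> K" for s
    unfolding x_def y_def by (rule someI_ex[OF ex[OF that]])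
  note xy = this[unfolded equalizing_def]
  have pick_less: "pick (Is s) i < acts1 G s" "pick (Js s) i < acts2 G s" if "s \<in> K" "i < m s" for s i
    using I[OF that(1)] that(2) pick_in_set[of i "Is s"] pick_in_set[of i "Js s"] by (auto simp: m_def)
  have pick_mono': "pick (Is s) i < pick (Is s) i'" "pick (Js s) i < pick (Js s) i'"
    if "s \<in> K" "i < i'" "i' < m s" for s i i'
    using I(3)[OF that(1)] that(2,3) by (auto simp: m_def intro!: pick_mono)
  define N where "N = (\<Prod>s\<in>{1..n}. m s)"
  define NR where "NR = (\<Prod>s\<in>{1..n}. acts1 G s)"
  define NC where "NC = (\<Prod>s\<in>{1..n}. acts2 G s)"
  define \<phi> where "\<phi> = embed m (acts1 G) (\<lambda>s. pick (Is s)) [1..<Suc n]"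
  define \<psi> where "\<psi> = embed m (acts2 G) (\<lambda>s. pick (Js s)) [1..<Suc n]"
  have setK: "set [1..<Suc n] = K" by (auto simp: n_def)
  have \<phi>: "i < N \<Longrightarrow> \<phi> i < NR" "i < N \<Longrightarrow> s \<in> K \<Longrightarrow> dg (acts1 G) n (\<phi> i) s = pick (Is s) (dg m n i s)"
    "i < i' \<Longrightarrow> i' < N \<Longrightarrow> \<phi> i < \<phi> i'" for i i' s
    using embed[OF distinct_upt[of 1 "Suc n"], of m "\<lambda>s. pick (Is s)" "acts1 G"] pick_less(1) pick_mono'(1)
    unfolding setK \<phi>_def N_def NR_def prod_list_upt by blast+
  have \<psi>: "i < N \<Longrightarrow> \<psi> i < NC" "i < N \<Longrightarrow> s \<in> K \<Longrightarrow> dg (acts2 G) n (\<psi> i) s = pick (Js s) (dg m n i s)"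
    "i < i' \<Longrightarrow> i' < N \<Longrightarrow> \<psi> i < \<psi> i'" for i i' s
    using embed[OF distinct_upt[of 1 "Suc n"], of m "\<lambda>s. pick (Js s)" "acts2 G"] pick_less(2) pick_mono'(2)
    unfolding setK \<psi>_def N_def NC_def prod_list_upt by blast+
  define a where "a s c i j = data_entry l s c (pick (Is s) i) (pick (Js s) j)" for s c i j
  define \<Delta> where "\<Delta> c i j = array_minor n (\<lambda>s c. a s c (dg m n i s) (dg m n j s)) c" for c i j
  have n1: "1 \<le> n" using n_pos by (simp add: n_def)
  have Dc: "data_array G s c \<in> carrier_mat (acts1 G s) (acts2 G s)" for s c by (simp add: data_array_def)
  have auxc: "aux G c \<in> carrier_mat NR NC" for c
    unfolding aux_def NR_def NC_def n_def by (rule aux_matrix_index(1)[OF n_pos Dc])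
  have aux_entry: "poly (aux G c $$ (\<phi> i, \<psi> j)) l = \<Delta> c i j" if c: "c \<le> n" and ij: "i < N" "j < N" for c i j
  proof -
    have e: "aux G c $$ (\<phi> i, \<psi> j) = array_minor n (\<lambda>s c. data_array G s c $$ (dg (acts1 G) n (\<phi> i) s, dg (acts2 G) n (\<psi> j) s)) c"
      unfolding aux_def n_def[symmetric]
      by (rule aux_matrix_index(2)[OF n1 Dc c])
        (use \<phi>(1)[OF ij(1)] \<psi>(1)[OF ij(2)] in \<open>simp_all only: NR_def NC_def\<close>)
    have "poly (aux G c $$ (\<phi> i, \<psi> j)) l = array_minor n (\<lambda>s c. data_entry l s c (dg (acts1 G) n (\<phi> i) s) (dg (acts2 G) n (\<psi> j) s)) c"
      unfolding e poly_array_minor data_entry_def by (rule refl)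
    also have "\<dots> = \<Delta> c i j" unfolding \<Delta>_def
    proof (rule array_minor_cong)
      fix s c assume "s \<in> {1..n}"
      hence "s \<in> K" by (simp add: n_def)
      thus "data_entry l s c (dg (acts1 G) n (\<phi> i) s) (dg (acts2 G) n (\<psi> j) s) = a s c (dg m n i s) (dg m n j s)"
        unfolding a_def by (simp only: \<phi>(2)[OF ij(1)] \<psi>(2)[OF ij(2)])
    qed
    finally show ?thesis .
  qed
  have redc: "submatrix (data_array G s c) (Is s) (Js s) \<in> carrier_mat (m s) (m s)"
    "i < m s \<Longrightarrow> j < m s \<Longrightarrow> submatrix (data_array G s c) (Is s) (Js s) $$ (i, j) = data_array G s c $$ (pick (Is s) i, pick (Js s) j)"
    if "s \<in> K" for s c i j
    using submatrix_carrier[OF Dc I(1,2)[OF that]] I(3)[OF that] by (simp_all add: m_def)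
  have red: "reduced_aux G Is Js 0 \<in> carrier_mat N N"
    unfolding reduced_aux_def N_def n_def by (rule aux_matrix_index(1)[OF n_pos redc(1)])
  define B0 where "B0 = mat_at (reduced_aux G Is Js 0) l"
  have B0c: "B0 \<in> carrier_mat N N" using red by (simp add: B0_def mat_at_def)
  have B0: "B0 $$ (i, j) = \<Delta> 0 i j" if ij: "i < N" "j < N" for i j
  proof -
    have "reduced_aux G Is Js 0 $$ (i, j) = array_minor n (\<lambda>s c. submatrix (data_array G s c) (Is s) (Js s) $$ (dg m n i s, dg m n j s)) 0"
      unfolding reduced_aux_def n_def[symmetric]
      by (rule aux_matrix_index(2)[OF n1 redc(1)]) (use ij in \<open>simp_all only: N_def n_def\<close>)
    also have "\<dots> = array_minor n (\<lambda>s c. data_array G s c $$ (pick (Is s) (dg m n i s), pick (Js s) (dg m n j s))) 0"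
    proof (rule array_minor_cong)
      fix s c
      show "submatrix (data_array G s c) (Is s) (Js s) $$ (dg m n i s, dg m n j s) =
          data_array G s c $$ (pick (Is s) (dg m n i s), pick (Js s) (dg m n j s))" if s: "s \<in> {1..n}"
      proof -
        have "s \<in> K" using s by (simp add: n_def)
        from redc(2)[OF this dg_less[OF ij(1)[unfolded N_def] s] dg_less[OF ij(2)[unfolded N_def] s]]
        show ?thesis .
      qed
    qed
    finally show ?thesis using red ij by (simp add: B0_def mat_at_def poly_array_minor \<Delta>_def a_def data_entry_def)
  qed
  define z where "z c = (if c = 0 then 1 else v c)" for c
  have k': "k \<le> n" "k \<noteq> 0" using k by (auto simp: n_def)
  have zk: "z k = v k" using k' by (simp add: z_def)
  have a_sum: "(\<Sum>c\<le>n. z c * a s c i j) = local_game G s l v $$ (pick (Is s) i, pick (Js s) j) - v s"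
    if "s \<in> K" "i < m s" "j < m s" for s i j
    unfolding z_def a_def n_def by (rule data_entry_sum) (use that pick_less in auto)
  define A where "A = mat N N (\<lambda>(i, j). \<Delta> k i j - v k * \<Delta> 0 i j)"
  define Y where "Y j = (\<Prod>s\<in>{1..n}. y s (dg m n j s))" for j
  define X where "X i = (\<Prod>s\<in>{1..n}. x s (dg m n i s))" for i
  have \<Delta>Y: "(\<Sum>j<N. \<Delta> c i j * Y j) = array_minor n (\<lambda>s c. \<Sum>b<m s. a s c (dg m n i s) b * y s b) c" for c i
    unfolding \<Delta>_def Y_def N_def by (rule array_minor_contract)
  have \<Delta>X: "(\<Sum>i<N. \<Delta> c i j * X i) = array_minor n (\<lambda>s c. \<Sum>b<m s. a s c b (dg m n j s) * x s b) c" for c j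
    unfolding \<Delta>_def X_def N_def by (rule array_minor_contract)
  have Ay: "(\<Sum>j<N. A $$ (i, j) * Y j) = 0" if i: "i < N" for i
  proof -
    have "(\<Sum>c\<le>n. z c * (\<Sum>b<m s. a s c (dg m n i s) b * y s b)) = 0" if s: "s \<in> {1..n}" for s
    proof -
      have sK: "s \<in> K" using s by (simp add: n_def)
      have di: "dg m n i s < m s" by (rule dg_less[OF i[unfolded N_def] s])
      have "(\<Sum>c\<le>n. z c * (\<Sum>b<m s. a s c (dg m n i s) b * y s b)) =
          (\<Sum>b<m s. (\<Sum>c\<le>n. z c * a s c (dg m n i s) b) * y s b)"
        unfolding sum_distrib_left sum_distrib_right by (subst sum.swap) (simp only: mult.assoc)
      also have "\<dots> = (\<Sum>b<m s. local_game G s l v $$ (pick (Is s) (dg m n i s), pick (Js s) b) * y s b - v s * y s b)"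
        using a_sum[OF sK di] by (intro sum.cong refl) (simp add: left_diff_distrib)
      also have "\<dots> = v s - v s * (\<Sum>b<m s. y s b)"
        using xy[OF sK] di by (simp add: sum_subtractf sum_distrib_left[symmetric])
      finally show ?thesis using xy[OF sK] by simp
    qed
    from array_minor_cramer[OF this _ k'(1)]
    have "(\<Sum>j<N. \<Delta> k i j * Y j) = v k * (\<Sum>j<N. \<Delta> 0 i j * Y j)"
      unfolding \<Delta>Y by (simp add: z_def k'(2))
    moreover have "(\<Sum>j<N. A $$ (i, j) * Y j) = (\<Sum>j<N. \<Delta> k i j * Y j - v k * (\<Delta> 0 i j * Y j))"
      using i by (intro sum.cong refl) (simp add: A_def left_diff_distrib)
    ultimately show ?thesis by (simp add: sum_subtractf sum_distrib_left)
  qed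
  have xA: "(\<Sum>i<N. X i * A $$ (i, j)) = 0" if j: "j < N" for j
  proof -
    have "(\<Sum>c\<le>n. z c * (\<Sum>b<m s. a s c b (dg m n j s) * x s b)) = 0" if s: "s \<in> {1..n}" for s
    proof -
      have sK: "s \<in> K" using s by (simp add: n_def)
      have dj: "dg m n j s < m s" by (rule dg_less[OF j[unfolded N_def] s])
      have "(\<Sum>c\<le>n. z c * (\<Sum>b<m s. a s c b (dg m n j s) * x s b)) =
          (\<Sum>b<m s. (\<Sum>c\<le>n. z c * a s c b (dg m n j s)) * x s b)"
        unfolding sum_distrib_left sum_distrib_right by (subst sum.swap) (simp only: mult.assoc)
      also have "\<dots> = (\<Sum>b<m s. x s b * local_game G s l v $$ (pick (Is s) b, pick (Js s) (dg m n j s)) - v s * x s b)"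
        by (intro sum.cong refl) (simp only: a_sum[OF sK _ dj] lessThan_iff, simp only: algebra_simps)
      also have "\<dots> = v s - v s * (\<Sum>b<m s. x s b)"
        using xy[OF sK] dj by (simp add: sum_subtractf sum_distrib_left[symmetric])
      finally show ?thesis using xy[OF sK] by simp
    qed
    from array_minor_cramer[OF this _ k'(1)]
    have "(\<Sum>i<N. \<Delta> k i j * X i) = v k * (\<Sum>i<N. \<Delta> 0 i j * X i)"
      unfolding \<Delta>X by (simp add: z_def k'(2))
    moreover have "(\<Sum>i<N. X i * A $$ (i, j)) = (\<Sum>i<N. \<Delta> k i j * X i - v k * (\<Delta> 0 i j * X i))"
      using j by (intro sum.cong refl) (simp add: A_def algebra_simps)
    ultimately show ?thesis by (simp add: sum_subtractf sum_distrib_left)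
  qed
  have xBy: "(\<Sum>i<N. \<Sum>j<N. X i * B0 $$ (i, j) * Y j) \<noteq> 0"
  proof -
    define u where "u s c = (\<Sum>i<m s. (\<Sum>b<m s. a s c i b * y s b) * x s i)" for s c
    have "(\<Sum>i<N. \<Sum>j<N. X i * B0 $$ (i, j) * Y j) = (\<Sum>i<N. (\<Sum>j<N. \<Delta> 0 i j * Y j) * X i)"
      unfolding sum_distrib_right by (intro sum.cong refl) (simp add: B0)
    also have "\<dots> = (\<Sum>i<N. array_minor n (\<lambda>s c. \<Sum>b<m s. a s c (dg m n i s) b * y s b) 0 * X i)"
      unfolding \<Delta>Y ..
    also have "\<dots> = array_minor n u 0"
      unfolding X_def N_def u_def[abs_def]
      by (rule array_minor_contract[where n = n and d = m and l = 0 and y = x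
            and a = "\<lambda>s c i. \<Sum>b<m s. a s c i b * y s b"])
    also have "\<dots> \<noteq> 0"
    proof (rule array_minor_0_nonzero)
      fix w :: "nat \<Rightarrow> real" assume w: "\<And>s. s \<in> {1..n} \<Longrightarrow> (\<Sum>c\<in>{1..n}. w c * u s c) = 0"
      define Q where "Q s c = (\<Sum>i<m s. (\<Sum>b<m s. pmf (trans_pmf G s (pick (Is s) i) (pick (Js s) b)) c * y s b) * x s i)" for s c
      have u: "u s c = (1 - l) * Q s c - (if c = s then 1 else 0)" if s: "s \<in> {1..n}" and c: "c \<in> {1..n}" for s c
      proof -
        have sK: "s \<in> K" using s by (simp add: n_def)
        have ae: "a s c i b = (1 - l) * pmf (trans_pmf G s (pick (Is s) i) (pick (Js s) b)) c - (if c = s then 1 else 0)"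
          if "i < m s" "b < m s" for i b
          using pick_less[OF sK that(1)] pick_less[OF sK that(2)] c
          by (simp add: a_def data_entry_def data_array_def left_diff_distrib)
        have "u s c = (\<Sum>i<m s. (\<Sum>b<m s. (1 - l) * (pmf (trans_pmf G s (pick (Is s) i) (pick (Js s) b)) c * y s b) - (if c = s then 1 else 0) * y s b) * x s i)"
          unfolding u_def by (intro sum.cong refl arg_cong2[where f = "(*)"])
            (simp only: ae lessThan_iff, simp only: left_diff_distrib mult.assoc)
        also have "\<dots> = (\<Sum>i<m s. (1 - l) * ((\<Sum>b<m s. pmf (trans_pmf G s (pick (Is s) i) (pick (Js s) b)) c * y s b) * x s i) - (if c = s then 1 else 0) * x s i)"
        proof (intro sum.cong refl)
          fix i
          have "(\<Sum>b<m s. (1 - l) * (pmf (trans_pmf G s (pick (Is s) i) (pick (Js s) b)) c * y s b) - (if c = s then 1 else 0) * y s b) =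
            (1 - l) * (\<Sum>b<m s. pmf (trans_pmf G s (pick (Is s) i) (pick (Js s) b)) c * y s b) - (if c = s then 1 else 0) * (\<Sum>b<m s. y s b)"
            by (simp only: sum_subtractf sum_distrib_left)
          also have "(\<Sum>b<m s. y s b) = 1" using xy[OF sK] by simp
          finally have e: "(\<Sum>b<m s. (1 - l) * (pmf (trans_pmf G s (pick (Is s) i) (pick (Js s) b)) c * y s b) - (if c = s then 1 else 0) * y s b) =
            (1 - l) * (\<Sum>b<m s. pmf (trans_pmf G s (pick (Is s) i) (pick (Js s) b)) c * y s b) - (if c = s then 1 else 0) * 1" .
          show "(\<Sum>b<m s. (1 - l) * (pmf (trans_pmf G s (pick (Is s) i) (pick (Js s) b)) c * y s b) - (if c = s then 1 else 0) * y s b) * x s i =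
            (1 - l) * ((\<Sum>b<m s. pmf (trans_pmf G s (pick (Is s) i) (pick (Js s) b)) c * y s b) * x s i) - (if c = s then 1 else 0) * x s i"
            unfolding e by (simp only: left_diff_distrib mult.assoc mult_1_left)
        qed
        also have "\<dots> = (1 - l) * Q s c - (if c = s then 1 else 0) * (\<Sum>i<m s. x s i)"
          unfolding Q_def by (simp only: sum_subtractf sum_distrib_left)
        also have "(\<Sum>i<m s. x s i) = 1" using xy[OF sK] by simp
        finally show ?thesis by simp
      qed
      show "\<forall>c\<in>{1..n}. w c = 0"
      proof (rule dominant_nonsingular[OF l, of n Q])
        show "0 \<le> Q s c" if "s \<in> {1..n}" "c \<in> {1..n}" for s c
          unfolding Q_def using xy[of s] that by (intro sum_nonneg mult_nonneg_nonneg) (auto simp: n_def)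
        show "(\<Sum>c\<in>{1..n}. Q s c) = 1" if s: "s \<in> {1..n}" for s
        proof -
          have sK: "s \<in> K" using s by (simp add: n_def)
          have "(\<Sum>c\<in>{1..n}. Q s c) = (\<Sum>i<m s. (\<Sum>b<m s. (\<Sum>c\<in>{1..n}. pmf (trans_pmf G s (pick (Is s) i) (pick (Js s) b)) c) * y s b) * x s i)"
          proof -
            have "(\<Sum>c\<in>{1..n}. Q s c) = (\<Sum>i<m s. \<Sum>c\<in>{1..n}. (\<Sum>b<m s. pmf (trans_pmf G s (pick (Is s) i) (pick (Js s) b)) c * y s b) * x s i)"
              unfolding Q_def by (rule sum.swap)
            also have "\<dots> = (\<Sum>i<m s. (\<Sum>c\<in>{1..n}. \<Sum>b<m s. pmf (trans_pmf G s (pick (Is s) i) (pick (Js s) b)) c * y s b) * x s i)"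
              by (simp only: sum_distrib_right)
            also have "\<dots> = (\<Sum>i<m s. (\<Sum>b<m s. \<Sum>c\<in>{1..n}. pmf (trans_pmf G s (pick (Is s) i) (pick (Js s) b)) c * y s b) * x s i)"
              by (subst sum.swap) (rule refl)
            finally show ?thesis by (simp only: sum_distrib_right)
          qed
          also have "\<dots> = (\<Sum>i<m s. (\<Sum>b<m s. y s b) * x s i)"
          proof (intro sum.cong refl arg_cong2[where f = "(*)"])
            fix i b assume "i \<in> {..<m s}" "b \<in> {..<m s}"
            hence "(\<Sum>c\<in>{1..n}. pmf (trans_pmf G s (pick (Is s) i) (pick (Js s) b)) c) = 1"
              using pick_less sK trans_K[OF sK] unfolding n_def by (intro sum_pmf_eq_1) auto
            thus "(\<Sum>c\<in>{1..n}. pmf (trans_pmf G s (pick (Is s) i) (pick (Js s) b)) c) * y s b = y s b" by simp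
          qed
          also have "\<dots> = 1" using xy[OF sK] by simp
          finally show ?thesis .
        qed
        show "(\<Sum>c\<in>{1..n}. w c * ((1 - l) * Q s c - (if c = s then 1 else 0))) = 0" if "s \<in> {1..n}" for s
          using w[OF that] u[OF that] by simp
      qed
    qed
    finally show ?thesis .
  qed
  have Ac: "A \<in> carrier_mat N N" by (simp add: A_def)
  from bordered_minor[OF Ac Ay xA xBy] obtain R C t where RC: "R \<subseteq> {..<N}" "C \<subseteq> {..<N}" "R \<noteq> {}" "card R = card C"
    and det0: "det (submatrix A R C) = 0"
    and dett: "det (submatrix (mat N N (\<lambda>(i, j). A $$ (i, j) - t * B0 $$ (i, j))) R C) \<noteq> 0" by blast
  let ?r = "card R"
  have pR: "pick R i < N" "pick C i < N" if "i < ?r" for i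
    using pick_in_set[of i R] pick_in_set[of i C] that RC by auto
  have penc: "pencil G k \<in> carrier_mat NR NC" using auxc[of 0] by (auto simp: pencil_def)
  define pen where "pen = mat N N (\<lambda>(i, j). pencil G k $$ (\<phi> i, \<psi> j))"
  have penN: "pen \<in> carrier_mat N N" by (simp add: pen_def)
  have sub: "submatrix pen R C = submatrix (pencil G k) (\<phi> ` R) (\<psi> ` C)" "card (\<phi> ` R) = ?r" "card (\<psi> ` C) = card C"
    by (rule submatrix_image[OF penN penc \<phi>(3) \<phi>(1) \<psi>(3) \<psi>(1) _ RC(1,2)]; simp add: pen_def)+
  define P where "P = det (submatrix pen R C)"
  interpret ei: comm_ring_hom "eval_inner l" by (rule eval_inner_hom)
  note subpen = submatrix_carrier[OF penN RC(1,2)]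
  have Pl: "eval_inner l P = det (mat ?r ?r (\<lambda>(i, j). [:\<Delta> k (pick R i) (pick C j), - \<Delta> 0 (pick R i) (pick C j):]))"
  proof -
    have "map_mat (eval_inner l) (submatrix pen R C) =
        mat ?r ?r (\<lambda>(i, j). [:\<Delta> k (pick R i) (pick C j), - \<Delta> 0 (pick R i) (pick C j):])"
    proof (rule eq_matI)
      fix i j assume "i < dim_row (mat ?r ?r (\<lambda>(i, j). [:\<Delta> k (pick R i) (pick C j), - \<Delta> 0 (pick R i) (pick C j):]))"
        "j < dim_col (mat ?r ?r (\<lambda>(i, j). [:\<Delta> k (pick R i) (pick C j), - \<Delta> 0 (pick R i) (pick C j):]))"
      hence ij: "i < ?r" "j < ?r" by auto
      let ?i = "pick R i" and ?j = "pick C j"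
      have "submatrix pen R C $$ (i, j) = [:aux G k $$ (\<phi> ?i, \<psi> ?j), - (aux G 0 $$ (\<phi> ?i, \<psi> ?j)):]"
        using subpen(2)[of i j] ij RC(4) pR[OF ij(1)] pR[OF ij(2)] \<phi>(1)[OF pR(1)[OF ij(1)]] \<psi>(1)[OF pR(2)[OF ij(2)]] auxc[of 0]
        by (simp add: pen_def pencil_def)
      moreover have "eval_inner l [:p, - q:] = [:poly p l, - poly q l:]" for p q
        by (rule poly_eqI) (simp add: eval_inner_def coeff_map_poly coeff_pCons split: nat.split)
      ultimately show "map_mat (eval_inner l) (submatrix pen R C) $$ (i, j) =
          mat ?r ?r (\<lambda>(i, j). [:\<Delta> k (pick R i) (pick C j), - \<Delta> 0 (pick R i) (pick C j):]) $$ (i, j)"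
        using ij subpen(1) RC(4) aux_entry[OF k'(1) pR(1)[OF ij(1)] pR(2)[OF ij(2)]] aux_entry[OF _ pR(1)[OF ij(1)] pR(2)[OF ij(2)], of 0]
        by simp
    qed (use subpen(1) RC(4) in auto)
    thus ?thesis unfolding P_def ei.hom_det[symmetric] by simp
  qed
  have Pw: "eval2 P l (v k + w) = det (submatrix (mat N N (\<lambda>(i, j). A $$ (i, j) - w * B0 $$ (i, j))) R C)" for w :: real
  proof -
    let ?M = "mat N N (\<lambda>(i, j). A $$ (i, j) - w * B0 $$ (i, j))"
    have M: "?M \<in> carrier_mat N N" by simp
    have e: "map_mat (\<lambda>p. poly p (v k + w)) (mat ?r ?r (\<lambda>(i, j). [:\<Delta> k (pick R i) (pick C j), - \<Delta> 0 (pick R i) (pick C j):])) = submatrix ?M R C"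
      by (rule eq_matI)
        (use submatrix_carrier[OF M RC(1,2)] RC(4) pR in \<open>auto simp: A_def B0 algebra_simps\<close>)
    show ?thesis unfolding eval2_eval_inner Pl comm_ring_hom.hom_det[OF eval_hom, symmetric] e by (rule refl)
  qed
  have "degree (eval_inner l P) \<le> vec_space.rank N B0"
  proof -
    obtain XX YY where f: "\<forall>i<N. \<forall>j<N. B0 $$ (i, j) = (\<Sum>e<vec_space.rank N B0. XX i e * YY e j)"
      using rank_factorization[OF B0c] by blast
    show ?thesis unfolding Pl
      by (rule degree_det_pencil[where X = "\<lambda>i. XX (pick R i)" and Y = "\<lambda>e j. YY e (pick C j)"])
        (use f pR in \<open>simp add: B0[symmetric]\<close>)
  qed
  hence deg: "degree (eval_inner l P) \<le> mat_rank (mat_at (reduced_aux G Is Js 0) l)"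
    using B0c unfolding mat_rank_def B0_def by simp
  show ?thesis
  proof (rule that[of "\<phi> ` R" "\<psi> ` C" P "v k + t"])
    show "\<phi> ` R \<subseteq> {..<dim_row (pencil G k)}" using \<phi>(1) RC(1) penc by auto
    show "\<psi> ` C \<subseteq> {..<dim_col (pencil G k)}" using \<psi>(1) RC(2) penc by auto
    show "\<phi> ` R \<noteq> {}" using RC(3) by simp
    show "card (\<phi> ` R) = card (\<psi> ` C)" using sub(2,3) RC(4) by simp
    show "P = det (submatrix (pencil G k) (\<phi> ` R) (\<psi> ` C))" unfolding P_def sub(1) ..
    show "eval2 P l (v k + t) \<noteq> 0" unfolding Pw using dett .
    show "degree (eval_inner l P) \<le> mat_rank (mat_at (reduced_aux G Is Js 0) l)" by (rule deg)
    have "mat N N (\<lambda>(i, j). A $$ (i, j) - 0 * B0 $$ (i, j)) = A" by (rule eq_matI) (auto simp: A_def)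
    thus "eval2 P l (disc_value G l k) = 0" using Pw[of 0] det0 by (simp add: v_def)
  qed
qed

end

context finite_stochastic_game
begin

definition minors :: "nat \<Rightarrow> real poly poly set" where
  "minors k = {P. P \<noteq> 0 \<and> (\<exists>R C. R \<subseteq> {..<dim_row (pencil G k)} \<and> C \<subseteq> {..<dim_col (pencil G k)} \<and>
     R \<noteq> {} \<and> card R = card C \<and> P = det (submatrix (pencil G k) R C))}"

lemma minors: "finite (minors k)" "0 \<notin> minors k" "E_set G a k = {P \<in> minors k. degree P \<le> a}"
proof -
  have "minors k \<subseteq> (\<lambda>(R, C). det (submatrix (pencil G k) R C)) `
      (Pow {..<dim_row (pencil G k)} \<times> Pow {..<dim_col (pencil G k)})"
    unfolding minors_def by force
  thus "finite (minors k)" by (rule finite_subset) simp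
qed (auto simp: minors_def E_set_def)

end

text \<open>The leading coefficient of \<open>P\<close> in \<open>w\<close> is a nonzero polynomial in \<open>\<lambda>\<close>, hence the degree in \<open>w\<close>
  does not drop for small \<open>\<lambda> > 0\<close>.\<close>
lemma degree_le_frequently:
  fixes P :: "real poly poly"
  assumes "\<exists>\<^sub>F l in at_right 0. degree (eval_inner l P) \<le> a"
  shows "degree P \<le> a"
proof (rule ccontr)
  assume a: "\<not> degree P \<le> a"
  hence "lead_coeff P \<noteq> 0" by auto
  from ceval_nonzero_near_0[OF this] obtain r where r: "0 < r"
    "\<And>z. 0 < norm z \<Longrightarrow> norm z < r \<Longrightarrow> ceval z (lead_coeff P) \<noteq> 0" by blast
  have "eventually (\<lambda>l. l \<in> {0<..<r}) (at_right 0)" using r(1) by (rule eventually_at_right_real)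
  hence "eventually (\<lambda>l. \<not> degree (eval_inner l P) \<le> a) (at_right 0)"
  proof eventually_elim
    case (elim l)
    have "poly (lead_coeff P) l \<noteq> 0" using r(2)[of "of_real l"] elim by (simp add: ceval_of_real)
    hence "coeff (eval_inner l P) (degree P) \<noteq> 0" by (simp add: eval_inner_def coeff_map_poly)
    hence "degree P \<le> degree (eval_inner l P)" by (rule le_degree)
    thus ?case using a by simp
  qed
  with assms show False by (simp add: frequently_def)
qed

theorem mainTheorem3:
  fixes G :: sgame
    and Is Js :: "real \<Rightarrow> nat \<Rightarrow> nat set"
    and a k :: nat
  assumes "stochastic_game G"
    and "\<And>l s. 0 < l \<Longrightarrow> l \<le> 1 \<Longrightarrow> s \<in> {1..states G} \<Longrightarrow>
           shapley_snow_kernel (local_game G s l (disc_value G l)) (Is l s) (Js l s)"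
    and "\<exists>\<^sub>F l in at_right 0. mat_rank (mat_at (reduced_aux G (Is l) (Js l) 0) l) = a"
    and "k \<in> {1..states G}"
  shows "(\<exists>P\<in>E_set G a k. \<exists>l0>0. \<forall>l\<in>{0<..<l0}. eval2 P l (disc_value G l k) = 0) \<and>
         (\<exists>l0>0. puiseux_interval (E_set G a k) l0 \<and> finite (W_set G a k l0) \<and>
            (\<lambda>l\<in>{0<..<l0}. complex_of_real (disc_value G l k)) \<in> W_set G a k l0) \<and>
         (\<exists>v0. ((\<lambda>l. disc_value G l k) \<longlongrightarrow> v0) (at_right 0) \<and>
            (\<lambda>l. \<bar>disc_value G l k - v0\<bar>) \<in> O[at_right 0](\<lambda>l. l powr (1 / real a)))"
proof -
  interpret finite_stochastic_game G by unfold_locales (rule assms(1))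
  define V where "V l = disc_value G l k" for l
  define v where "v l = complex_of_real (V l)" for l
  let ?E = "E_set G a k"
  note k = assms(4)
  have minor: "\<exists>P\<in>minors k. eval2 P l (V l) = 0 \<and>
      degree (eval_inner l P) \<le> mat_rank (mat_at (reduced_aux G (Is l) (Js l) 0) l)"
    if l: "0 < l" "l \<le> 1" for l
  proof -
    obtain R C P t where *: "R \<subseteq> {..<dim_row (pencil G k)}" "C \<subseteq> {..<dim_col (pencil G k)}" "R \<noteq> {}" "card R = card C"
      "P = det (submatrix (pencil G k) R C)"
      "eval2 P l (disc_value G l k) = 0" "eval2 P l (t :: real) \<noteq> 0"
      "degree (eval_inner l P) \<le> mat_rank (mat_at (reduced_aux G (Is l) (Js l) 0) l)"
      by (rule local_minor[OF l k assms(2)[OF l]])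
    have "P \<noteq> 0" using *(7) by (auto simp: eval2_altdef)
    hence "P \<in> minors k" unfolding minors_def using *(1-5) by blast
    thus ?thesis using *(6,8) by (auto simp: V_def)
  qed
  have opt: "optimal_at l" if "0 < l" "l \<le> 1" for l
    unfolding optimal_at_def using kernel_optimal(2)[OF assms(2)[OF that] _ that] by blast
  have contV: "continuous_on {0<..<1} V" unfolding V_def[abs_def] by (rule disc_value_continuous[OF opt k])
  from squarefree_family[OF minors(1,2), of k] obtain R r where r: "0 < r" "r < 1"
    and sep': "\<forall>P\<in>minors k. separated_on r R P"
    and fam': "1 \<le> degree R \<longrightarrow> simple_root_family R r"
    and deg0': "degree R = 0 \<longrightarrow> (\<forall>z w. 0 < norm z \<and> norm z < r \<longrightarrow> beval R z w \<noteq> 0)"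
    by (elim exE conjE) (rule that)
  note sep = sep'[rule_format] and fam = fam'[rule_format] and deg0 = deg0'[rule_format, OF _ conjI]
  have RP: "beval R z w = 0" if "P \<in> minors k" "beval P z w = 0" for P z w
    using sep[OF that(1)] that(2) by (auto simp: separated_on_def)
  have vR: "beval R (of_real l) (v l) = 0" if l: "l \<in> {0<..<r}" for l
    using minor[of l] l r(2) RP by (auto simp: eval2_real_beval v_def)
  have l1: "r / 2 \<in> {0<..<r}" using r by simp
  have "degree R \<noteq> 0" using deg0[of "of_real (r / 2)"] vR[OF l1] l1 by auto
  then interpret simple_root_family R r by (intro fam) simp
  have contv: "continuous_on {0<..<r} v" unfolding v_def[abs_def]
  proof -
    have "continuous_on {0<..<r} V" by (rule continuous_on_subset[OF contV]) (use r(2) in auto)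
    thus "continuous_on {0<..<r} (\<lambda>l. complex_of_real (V l))" by (intro continuous_intros)
  qed
  have dich: "beval P (of_real l) (f l) = 0"
    if "P \<in> minors k" "continuous_on {0<..<r} f" "\<And>l. l \<in> {0<..<r} \<Longrightarrow> beval R (of_real l) (f l) = 0"
      "l0 \<in> {0<..<r}" "beval P (of_real l0) (f l0) = 0" "l \<in> {0<..<r}" for P f l0 l
  proof (rule root_function_separated[OF sep[OF that(1)] _ _ that(2) _ that(3) that(4,5,6)])
    show "continuous_on {0<..<r} complex_of_real" by (intro continuous_intros)
  qed auto

  have "\<exists>\<^sub>F l in at_right 0. \<exists>P\<in>minors k. eval2 P l (V l) = 0 \<and> degree (eval_inner l P) \<le> a"
  proof -
    have "eventually (\<lambda>l. l \<in> {0<..<1}) (at_right (0::real))" by (rule eventually_at_right_real) simp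
    with assms(3) have "\<exists>\<^sub>F l in at_right 0. mat_rank (mat_at (reduced_aux G (Is l) (Js l) 0) l) = a \<and> l \<in> {0<..<1}"
      by (rule frequently_eventually_frequently)
    thus ?thesis by (rule frequently_elim1) (use minor in force)
  qed
  \<comment> \<open>There are finitely many minors, so a single one serves for \<open>\<lambda>\<close> arbitrarily close to \<open>0\<close>.\<close>
  from frequently_bex_finite[OF minors(1) this] obtain P where P: "P \<in> minors k"
    and freq: "\<exists>\<^sub>F l in at_right 0. eval2 P l (V l) = 0 \<and> degree (eval_inner l P) \<le> a" by blast
  have "degree P \<le> a" by (rule degree_le_frequently) (rule frequently_elim1[OF freq], simp)
  hence PE: "P \<in> ?E" using P by (simp add: minors(3))
  have "\<exists>\<^sub>F l in at_right 0. (eval2 P l (V l) = 0 \<and> degree (eval_inner l P) \<le> a) \<and> l \<in> {0<..<r}"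
    by (rule frequently_eventually_frequently[OF freq eventually_at_right_real[OF r(1)]])
  \<comment> \<open>One zero inside the interval is enough: the dichotomy extends it to all of \<open>(0, r)\<close>.\<close>
  from frequently_ex[OF this] obtain l2 where l2: "l2 \<in> {0<..<r}" "eval2 P l2 (V l2) = 0" by blast
  have Pv: "beval P (of_real l) (v l) = 0" if "l \<in> {0<..<r}" for l
    by (rule dich[OF P contv vR l2(1) _ that]) (use l2(2) in \<open>simp_all add: eval2_real_beval v_def\<close>)
  have i: "\<exists>P\<in>?E. \<exists>l0>0. \<forall>l\<in>{0<..<l0}. eval2 P l (V l) = 0"
    using PE r(1) Pv by (intro bexI[of _ P] exI[of _ r]) (auto simp: eval2_real_beval v_def)

  \<comment> \<open>The branch through the value at \<open>r / 2\<close> coincides with the value function.\<close>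
  from puiseux_branch[OF l1 vR[OF l1]] obtain f N \<psi> M where f: "f (r / 2) = v (r / 2)" "continuous_on {0<..<r} f"
    and fR': "\<forall>l\<in>{0<..<r}. beval R (of_real l) (f l) = 0"
    and N: "1 \<le> N" and hol: "\<psi> holomorphic_on ball 0 (r powr (1 / real N))"
    and f\<psi>': "\<forall>l\<in>{0<..<r}. f l = \<psi> (of_real (l powr (1 / real N))) / of_real (l powr (1 / real N)) ^ M"
    and degN': "\<forall>P. separated_on r R P \<longrightarrow> beval P (of_real (r / 2)) (v (r / 2)) = 0 \<longrightarrow> N \<le> degree P"
    by (elim exE conjE) (rule that)
  note fR = fR'[rule_format] and f\<psi> = f\<psi>'[rule_format] and degN = degN'[rule_format]
  have fv: "f l = v l" if "l \<in> {0<..<r}" for l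
    by (rule real_root_unique[OF f(2) contv fR vR l1 f(1) that])
  have NP: "N \<le> degree P" by (rule degN[OF sep[OF P] Pv[OF l1]])
  hence Na: "N \<le> a" using \<open>degree P \<le> a\<close> by simp

  have W: "W_set G a k r = root_series ?E r" by (simp add: W_set_def)
  have cong: "puiseux_on r (restrict g {0<..<r})" if "puiseux_on r g" for g
    using that unfolding puiseux_on_def by simp
  have pint: "puiseux_interval ?E r"
    unfolding puiseux_interval_def
  proof (intro conjI ballI impI allI r(1))
    fix Q l and w :: complex
    assume Q: "Q \<in> ?E" "1 \<le> degree Q" and l: "l \<in> {0<..<r}" and w: "eval2 Q l w = 0"
    have Qm: "Q \<in> minors k" using Q(1) by (simp add: minors(3))
    have Qw: "beval Q (of_real l) w = 0" using w by (simp add: eval2_beval)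
    from puiseux_branch[OF l RP[OF Qm Qw]] obtain g N' \<psi>' M' where g: "g l = w" "continuous_on {0<..<r} g"
      and gR: "\<forall>l\<in>{0<..<r}. beval R (of_real l) (g l) = 0"
      and g': "1 \<le> N'" "\<psi>' holomorphic_on ball 0 (r powr (1 / real N'))"
      and g\<psi>: "\<forall>l\<in>{0<..<r}. g l = \<psi>' (of_real (l powr (1 / real N'))) / of_real (l powr (1 / real N')) ^ M'"
      by (elim exE conjE) (rule that)
    have g_puiseux: "puiseux_on r g" by (rule puiseux_onI[OF g'(2,1)]) (use g\<psi> in auto)
    have "beval Q (of_real l') (g l') = 0" if "l' \<in> {0<..<r}" for l'
      by (rule dich[OF Qm g(2) gR[rule_format] l _ that]) (use g(1) Qw in auto)
    hence "restrict g {0<..<r} \<in> root_series {Q} r"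
      unfolding root_series_def using Q(2) cong[OF g_puiseux] by (auto simp: eval2_beval)
    thus "\<exists>f\<in>root_series {Q} r. f l = w" using g(1) l by (intro bexI[of _ "restrict g {0<..<r}"]) auto
  qed
  have series: "continuous_on {0<..<r} g" "\<And>l. l \<in> {0<..<r} \<Longrightarrow> beval R (of_real l) (g l) = 0"
    "g \<in> extensional {0<..<r}" if "g \<in> root_series ?E r" for g
    using that RP puiseux_on_continuous by (auto simp: root_series_def eval2_beval minors(3))
  \<comment> \<open>A Puiseux series that is a root of a member of \<open>?E\<close> is a continuous root function of \<open>R\<close>, so
    it is determined by its value at \<open>r / 2\<close>, one of finitely many roots.\<close>
  have fin: "finite (root_series ?E r)"
  proof (rule finite_imageD[of "\<lambda>g. g (r / 2)"])
    have "(\<lambda>g. g (r / 2)) ` root_series ?E r \<subseteq> rts (of_real (r / 2))"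
      using series(2)[OF _ l1] by (auto simp: rts_def)
    moreover have "finite (rts (of_real (r / 2)))" by (rule card_rts(1)) (use l1 in \<open>simp add: pdisc_def\<close>)
    ultimately show "finite ((\<lambda>g. g (r / 2)) ` root_series ?E r)" by (rule finite_subset)
    show "inj_on (\<lambda>g. g (r / 2)) (root_series ?E r)"
    proof (rule inj_onI)
      fix g h assume g: "g \<in> root_series ?E r" and h: "h \<in> root_series ?E r" and eq: "g (r / 2) = h (r / 2)"
      show "g = h"
        by (rule extensionalityI[OF series(3)[OF g] series(3)[OF h]])
          (rule real_root_unique[OF series(1)[OF g] series(1)[OF h] series(2)[OF g] series(2)[OF h] l1 eq])
    qed
  qed
  have vW: "restrict v {0<..<r} \<in> root_series ?E r"
  proof -
    have "puiseux_on r v"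
    proof (rule puiseux_onI[OF hol N, where M = M])
      fix l assume "0 < l" "l < r"
      thus "v l = \<psi> (of_real (l powr (1 / real N))) / of_real (l powr (1 / real N)) ^ M"
        using f\<psi>[of l] fv[of l] by simp
    qed
    thus ?thesis unfolding root_series_def using cong PE NP N Pv
      by (auto simp: eval2_beval intro!: bexI[of _ P])
  qed
  have ii: "\<exists>l0>0. puiseux_interval ?E l0 \<and> finite (W_set G a k l0) \<and>
      (\<lambda>l\<in>{0<..<l0}. complex_of_real (V l)) \<in> W_set G a k l0"
  proof (rule exI[of _ r], intro conjI)
    show "finite (W_set G a k r)" unfolding W by (rule fin)
    have "(\<lambda>l\<in>{0<..<r}. complex_of_real (V l)) = restrict v {0<..<r}" by (simp add: v_def[abs_def])
    thus "(\<lambda>l\<in>{0<..<r}. complex_of_real (V l)) \<in> W_set G a k r" unfolding W using vW by (simp only:)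
  qed (rule r(1), rule pint)

  obtain C where "0 \<le> C" "\<And>k i j. k \<in> {1..states G} \<Longrightarrow> i < acts1 G k \<Longrightarrow> j < acts2 G k \<Longrightarrow> \<bar>stage G k i j\<bar> \<le> C"
    and C: "\<And>l k. 0 < l \<Longrightarrow> l \<le> 1 \<Longrightarrow> k \<in> {1..states G} \<Longrightarrow> \<bar>disc_value G l k\<bar> \<le> C"
    using disc_value_bounded by blast
  define \<rho> where "\<rho> = r powr (1 / real N)"
  have \<rho>: "0 < \<rho>" using r(1) by (simp add: \<rho>_def)
  \<comment> \<open>The quotient is the value at \<open>l = t\<^sup>N\<close>, which is bounded like the stage payoffs.\<close>
  have bnd: "norm (\<psi> (of_real t) / of_real t ^ M) \<le> C" if t: "0 < t" "t < \<rho>" for t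
  proof -
    define l where "l = t powr real N"
    have "l < \<rho> powr real N" unfolding l_def using t N by (intro powr_less_mono2) auto
    hence l: "0 < l" "l < r" using t N r(1) by (simp_all add: l_def \<rho>_def powr_powr)
    have "l powr (1 / real N) = t" using t N by (simp add: l_def powr_powr)
    hence "\<psi> (of_real t) / of_real t ^ M = v l" using f\<psi>[of l] fv[of l] l by simp
    thus ?thesis using C[OF l(1) _ k] l r(2) by (simp add: v_def V_def)
  qed
  have "\<exists>c B \<delta>. 0 < \<delta> \<and> (\<forall>t. 0 < t \<and> t < \<delta> \<longrightarrow> norm (\<psi> (of_real t) / of_real t ^ M - c) \<le> B * t)"
    by (rule bounded_quotient_limit[OF \<rho> hol[folded \<rho>_def]]) (rule bnd)
  then obtain c B \<delta> where \<delta>: "0 < \<delta>"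
    and cB: "\<forall>t. 0 < t \<and> t < \<delta> \<longrightarrow> norm (\<psi> (of_real t) / of_real t ^ M - c) \<le> B * t"
    by (elim exE conjE) (rule that)
  define v0 where "v0 = Re c"
  have lim0: "((\<lambda>l. l powr (1 / real N)) \<longlongrightarrow> 0) (at_right 0)"
  proof -
    have "((\<lambda>l. l powr (1 / real N)) \<longlongrightarrow> 0 powr (1 / real N)) (at_right (0::real))"
      by (rule tendsto_powr2) (use N in \<open>auto simp: eventually_at_filter intro!: tendsto_intros\<close>)
    thus ?thesis by simp
  qed
  have "eventually (\<lambda>l. l \<in> {0<..<r}) (at_right 0)" by (rule eventually_at_right_real[OF r(1)])
  moreover have "eventually (\<lambda>l. l powr (1 / real N) < \<delta>) (at_right 0)"
    using lim0 \<delta> by (rule order_tendstoD)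
  ultimately have ev: "eventually (\<lambda>l. l \<in> {0<..<r} \<and> \<bar>V l - v0\<bar> \<le> B * l powr (1 / real N)) (at_right 0)"
  proof eventually_elim
    case (elim l)
    let ?t = "l powr (1 / real N)"
    have "\<bar>V l - v0\<bar> = \<bar>Re (v l - c)\<bar>" by (simp add: v_def v0_def)
    also have "\<dots> \<le> norm (v l - c)" by (rule abs_Re_le_cmod)
    also have "v l = \<psi> (of_real ?t) / of_real ?t ^ M" using f\<psi>[of l] fv[of l] elim(1) by simp
    also have "norm (\<dots> - c) \<le> B * ?t" using elim by (intro cB[rule_format]) auto
    finally show ?case using elim(1) by simp
  qed
  have lim: "(V \<longlongrightarrow> v0) (at_right 0)"
  proof (rule LIM_zero_cancel, rule Lim_null_comparison)
    show "eventually (\<lambda>l. norm (V l - v0) \<le> B * l powr (1 / real N)) (at_right 0)"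
      using ev by eventually_elim simp
    show "((\<lambda>l. B * l powr (1 / real N)) \<longlongrightarrow> 0) (at_right 0)"
      using tendsto_mult[OF tendsto_const lim0, of B] by simp
  qed
  have bigo: "(\<lambda>l. \<bar>V l - v0\<bar>) \<in> O[at_right 0](\<lambda>l. l powr (1 / real a))"
  proof (rule bigoI[of _ "\<bar>B\<bar>"])
    show "eventually (\<lambda>l. norm \<bar>V l - v0\<bar> \<le> \<bar>B\<bar> * norm (l powr (1 / real a))) (at_right 0)"
      using ev
    proof eventually_elim
      case (elim l)
      have "1 / real a \<le> 1 / real N" using Na N by (intro divide_left_mono) auto
      hence "l powr (1 / real N) \<le> l powr (1 / real a)"
        using elim r(2) by (intro powr_mono') auto
      hence "\<bar>B\<bar> * l powr (1 / real N) \<le> \<bar>B\<bar> * l powr (1 / real a)" by (intro mult_left_mono) auto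
      moreover have "B * l powr (1 / real N) \<le> \<bar>B\<bar> * l powr (1 / real N)" by (intro mult_right_mono) auto
      ultimately have "\<bar>V l - v0\<bar> \<le> \<bar>B\<bar> * l powr (1 / real a)" using elim by linarith
      thus ?case by simp
    qed
  qed
  show ?thesis unfolding V_def[symmetric] 
    by (rule conjI[OF i], rule conjI[OF ii], rule exI[of _ v0], rule conjI[OF lim bigo])
qed

end
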